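(* Let $\xi\in\partial\widetilde{S}$ be arbitrary. Then for some point $x\in\widetilde{S}$ there exist at least two (distinct) geodesic rays $r_1,r_2$ in $\widetilde{S}$ such that $r_1(0)=r_2(0)=x$ and $r_1(+\infty)=r_2(+\infty)=\xi$.
   Context: $S$ is a closed surface of genus $\geq 1$ equipped with a Euclidean metric (length metric) $d$ with finitely many conical singularities $s_1,\dots,s_n$: every other point has a neighborhood isometric to a Euclidean disk, and $s_i$ has a neighborhood isometric to a Euclidean cone of total angle $\theta(s_i)\in(0,+\infty)\setminus\{2\pi\}$ at its apex. It is assumed that at least one conical point has angle $<2\pi$, that $\pi_1(S)$ is hyperbolic in the sense of Gromov, and that the boundary $\partial\widetilde{S}$ below is homeomorphic to the circle $\mathbb{S}^1$ (for orientable $S$ the last two conditions mean genus $\geq 2$). Let $p:\widetilde{S}\to S$ be the universal covering, with $\widetilde{S}$ carrying the lifted metric for which $p$ is a local isometry; $\widetilde{S}$ is homeomorphic to $\mathbb{R}^2$ and is a proper Gromov hyperbolic geodesic space. A geodesic ray is a globally isometric embedding $r:[0,\infty)\to\widetilde{S}$. $\partial\widetilde{S}$ is the visual (Gromov) boundary of $\widetilde{S}$ defined by means of geodesic rays, and $r(+\infty)\in\partial\widetilde{S}$ denotes the boundary point determined by $r$. *)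

theory Defs
  imports "HOL-Analysis.Analysis" "HOL-Algebra.Generated_Groups"
begin

section \<open>Length metrics\<close>

definition path_length :: "(real \<Rightarrow> 'a::metric_space) \<Rightarrow> ennreal" where
  "path_length g =
     (SUP ts \<in> {ts. sorted ts \<and> set ts \<subseteq> {0..1}}.
        \<Sum>i<length ts - 1. ennreal (dist (g (ts ! i)) (g (ts ! Suc i))))"

definition length_metric_on :: "'a::metric_space set \<Rightarrow> bool" where
  "length_metric_on S \<longleftrightarrow>
     (\<forall>x\<in>S. \<forall>y\<in>S. ennreal (dist x y) =
        (INF g \<in> {g. path g \<and> path_image g \<subseteq> S \<and> pathstart g = x \<and> pathfinish g = y}. path_length g))"


section \<open>Closed surfaces with a Euclidean cone metric\<close>

definition closed_surface :: "'a::metric_space set \<Rightarrow> bool" where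
  "closed_surface S \<longleftrightarrow>
     compact S \<and> connected S \<and> S \<noteq> {} \<and>
     (\<forall>x\<in>S. \<exists>U. x \<in> U \<and> openin (top_of_set S) U \<and> U homeomorphic (ball 0 1 :: complex set))"

text \<open>The genus of a closed surface is the maximal number of pairwise disjoint simple closed
  curves whose union does not separate it. This covers the orientable case (number of handles) and
  the non-orientable case (number of crosscaps).\<close>

definition genus_at_least :: "nat \<Rightarrow> 'a::metric_space set \<Rightarrow> bool" where
  "genus_at_least n S \<longleftrightarrow>
     (\<exists>c :: nat \<Rightarrow> real \<Rightarrow> 'a.
        (\<forall>i<n. simple_path (c i) \<and> pathfinish (c i) = pathstart (c i) \<and> path_image (c i) \<subseteq> S) \<and>
        (\<forall>i<n. \<forall>j<n. i \<noteq> j \<longrightarrow> path_image (c i) \<inter> path_image (c j) = {}) \<and>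
        connected (S - (\<Union>i<n. path_image (c i))))"

definition regular_point :: "'a::metric_space set \<Rightarrow> 'a \<Rightarrow> bool" where
  "regular_point S x \<longleftrightarrow>
     (\<exists>\<epsilon>>0. \<exists>f :: complex \<Rightarrow> 'a.
        f 0 = x \<and> f ` ball 0 \<epsilon> = ball x \<epsilon> \<inter> S \<and>
        (\<forall>u\<in>ball 0 \<epsilon>. \<forall>v\<in>ball 0 \<epsilon>. dist (f u) (f v) = dist u v))"

text \<open>The Euclidean cone of total angle \<open>\<theta>\<close> in polar coordinates \<open>(r, \<phi>)\<close> with \<open>0 \<le> r\<close> and
  \<open>0 \<le> \<phi> < \<theta>\<close>. The angle between two rays from the apex is the distance on a circle of length
  \<open>\<theta>\<close>; if it is at least \<open>\<pi>\<close>, the shortest path runs through the apex, and otherwise the law of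
  cosines applies. All pairs \<open>(0, \<phi>)\<close> are at distance zero and denote the apex, so a
  distance-preserving map on coordinate pairs is a map defined on the cone itself.\<close>

definition cone_dist :: "real \<Rightarrow> real \<times> real \<Rightarrow> real \<times> real \<Rightarrow> real" where
  "cone_dist \<theta> = (\<lambda>(r, \<phi>) (s, \<psi>).
     sqrt (r\<^sup>2 + s\<^sup>2 - 2 * r * s * cos (min pi (min \<bar>\<phi> - \<psi>\<bar> (\<theta> - \<bar>\<phi> - \<psi>\<bar>)))))"

lemma cone_dist_2pi:
  assumes "\<phi> \<in> {0..<2*pi}" "\<psi> \<in> {0..<2*pi}"
  shows "cone_dist (2 * pi) (r, \<phi>) (s, \<psi>) = dist (rcis r \<phi>) (rcis s \<psi>)"
proof -
  have "cos (min pi (min a (2 * pi - a))) = cos a" for a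
    by (auto simp: min_def cos_2pi_minus)
  then have *: "cos (min pi (min \<bar>\<phi> - \<psi>\<bar> (2 * pi - \<bar>\<phi> - \<psi>\<bar>))) = cos \<phi> * cos \<psi> + sin \<phi> * sin \<psi>"
    by (metis cos_abs_real cos_diff)
  have "r\<^sup>2 + s\<^sup>2 - 2 * r * s * (cos \<phi> * cos \<psi> + sin \<phi> * sin \<psi>) =
      r\<^sup>2 * ((cos \<phi>)\<^sup>2 + (sin \<phi>)\<^sup>2) + s\<^sup>2 * ((cos \<psi>)\<^sup>2 + (sin \<psi>)\<^sup>2)
        - 2 * r * s * (cos \<phi> * cos \<psi> + sin \<phi> * sin \<psi>)"
    by simp
  also have "\<dots> = (r * cos \<phi> - s * cos \<psi>)\<^sup>2 + (r * sin \<phi> - s * sin \<psi>)\<^sup>2"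
    by (simp only: power2_eq_square) algebra
  finally show ?thesis
    unfolding cone_dist_def using * by (simp add: dist_norm cmod_def)
qed

definition cone_point :: "'a::metric_space set \<Rightarrow> 'a \<Rightarrow> real \<Rightarrow> bool" where
  "cone_point S x \<theta> \<longleftrightarrow>
     (\<exists>\<epsilon>>0. \<exists>f :: real \<times> real \<Rightarrow> 'a.
        f (0, 0) = x \<and> f ` ({0..<\<epsilon>} \<times> {0..<\<theta>}) = ball x \<epsilon> \<inter> S \<and>
        (\<forall>u \<in> {0..<\<epsilon>} \<times> {0..<\<theta>}. \<forall>v \<in> {0..<\<epsilon>} \<times> {0..<\<theta>}. dist (f u) (f v) = cone_dist \<theta> u v))"

definition euclidean_cone_surface :: "'a::metric_space set \<Rightarrow> 'a set \<Rightarrow> ('a \<Rightarrow> real) \<Rightarrow> bool" where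
  "euclidean_cone_surface S Sing \<theta> \<longleftrightarrow>
     closed_surface S \<and> length_metric_on S \<and> finite Sing \<and> Sing \<subseteq> S \<and>
     (\<forall>s\<in>Sing. 0 < \<theta> s \<and> \<theta> s \<noteq> 2 * pi \<and> cone_point S s (\<theta> s)) \<and>
     (\<forall>x\<in>S - Sing. regular_point S x)"


section \<open>The universal covering with the lifted metric\<close>

definition local_isometry_on ::
    "'b::metric_space set \<Rightarrow> ('b \<Rightarrow> 'a::metric_space) \<Rightarrow> 'a set \<Rightarrow> bool" where
  "local_isometry_on X p S \<longleftrightarrow>
     (\<forall>x\<in>X. \<exists>\<epsilon>>0. p ` (ball x \<epsilon> \<inter> X) = ball (p x) \<epsilon> \<inter> S \<and>
        (\<forall>u \<in> ball x \<epsilon> \<inter> X. \<forall>v \<in> ball x \<epsilon> \<inter> X. dist (p u) (p v) = dist u v))"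

text \<open>The lifted metric is the length metric on the covering space that makes \<open>p\<close> a local isometry;
  these two properties determine it.\<close>

definition metric_universal_covering ::
    "'b::metric_space set \<Rightarrow> ('b \<Rightarrow> 'a::metric_space) \<Rightarrow> 'a set \<Rightarrow> bool" where
  "metric_universal_covering X p S \<longleftrightarrow>
     covering_space X p S \<and> path_connected X \<and> simply_connected X \<and>
     length_metric_on X \<and> local_isometry_on X p S"


section \<open>Gromov hyperbolicity\<close>

definition gromov_product :: "('a \<Rightarrow> 'a \<Rightarrow> real) \<Rightarrow> 'a \<Rightarrow> 'a \<Rightarrow> 'a \<Rightarrow> real" where
  "gromov_product d w x y = (d x w + d y w - d x y) / 2"

definition gromov_hyperbolic :: "'a set \<Rightarrow> ('a \<Rightarrow> 'a \<Rightarrow> real) \<Rightarrow> bool" where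
  "gromov_hyperbolic M d \<longleftrightarrow>
     (\<exists>\<delta>\<ge>0. \<forall>w\<in>M. \<forall>x\<in>M. \<forall>y\<in>M. \<forall>z\<in>M.
        min (gromov_product d w x y) (gromov_product d w y z) - \<delta> \<le> gromov_product d w x z)"

definition word_length :: "('a, 'b) monoid_scheme \<Rightarrow> 'a set \<Rightarrow> 'a \<Rightarrow> nat" where
  "word_length G A g =
     (LEAST n. \<exists>xs. length xs = n \<and> set xs \<subseteq> A \<union> m_inv G ` A \<and> foldr (mult G) xs \<one>\<^bsub>G\<^esub> = g)"

definition hyperbolic_group :: "('a, 'b) monoid_scheme \<Rightarrow> bool" where
  "hyperbolic_group G \<longleftrightarrow>
     group G \<and>
     (\<exists>A. finite A \<and> A \<subseteq> carrier G \<and> generate G A = carrier G \<and>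
        gromov_hyperbolic (carrier G) (\<lambda>g h. real (word_length G A (inv\<^bsub>G\<^esub> g \<otimes>\<^bsub>G\<^esub> h))))"


section \<open>The fundamental group\<close>

definition loops_at :: "'a::topological_space set \<Rightarrow> 'a \<Rightarrow> (real \<Rightarrow> 'a) set" where
  "loops_at S x = {g. path g \<and> path_image g \<subseteq> S \<and> pathstart g = x \<and> pathfinish g = x}"

definition path_class :: "'a::topological_space set \<Rightarrow> (real \<Rightarrow> 'a) \<Rightarrow> (real \<Rightarrow> 'a) set" where
  "path_class S g = {h. homotopic_paths S g h}"

definition fundamental_group :: "'a::topological_space set \<Rightarrow> 'a \<Rightarrow> (real \<Rightarrow> 'a) set monoid" where
  "fundamental_group S x =
     \<lparr>carrier = path_class S ` loops_at S x,
      mult = (\<lambda>A B. {h. \<exists>a\<in>A. \<exists>b\<in>B. homotopic_paths S (a +++ b) h}),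
      one = path_class S (\<lambda>_. x)\<rparr>"

lemma path_class_eq_iff:
  assumes "g \<in> loops_at S x"
  shows "path_class S g = path_class S h \<longleftrightarrow> homotopic_paths S g h"
proof -
  have "homotopic_paths S g g"
    using assms by (simp add: loops_at_def)
  then show ?thesis
    unfolding path_class_def set_eq_iff mem_Collect_eq
    by (metis homotopic_paths_sym homotopic_paths_trans)
qed

lemma loops_at_join: "g \<in> loops_at S x \<Longrightarrow> h \<in> loops_at S x \<Longrightarrow> g +++ h \<in> loops_at S x"
  by (auto simp: loops_at_def path_image_join)

lemma fundamental_group_mult:
  assumes "g \<in> loops_at S x" "h \<in> loops_at S x"
  shows "path_class S g \<otimes>\<^bsub>fundamental_group S x\<^esub> path_class S h = path_class S (g +++ h)"
proof -
  have gh: "homotopic_paths S g g" "homotopic_paths S h h" "pathfinish g = pathstart h"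
    using assms by (auto simp: loops_at_def)
  have "homotopic_paths S (g +++ h) k"
    if "homotopic_paths S g a" "homotopic_paths S h b" "homotopic_paths S (a +++ b) k" for a b k
    using homotopic_paths_join[OF that(1,2) gh(3)] that(3) by (rule homotopic_paths_trans)
  then show ?thesis
    unfolding fundamental_group_def path_class_def monoid.simps mem_Collect_eq using gh(1,2)
    by blast
qed

lemma loops_at_const: "x \<in> S \<Longrightarrow> (\<lambda>_. x) \<in> loops_at S x"
  by (auto simp: loops_at_def path_def path_image_def pathstart_def pathfinish_def)

lemma loops_at_reversepath: "g \<in> loops_at S x \<Longrightarrow> reversepath g \<in> loops_at S x"
  by (simp add: loops_at_def)

lemma homotopic_const_join:
  assumes "g \<in> loops_at S x"
  shows "homotopic_paths S ((\<lambda>_. x) +++ g) g"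
proof (rule homotopic_paths_sym, rule homotopic_paths_reparametrize)
  show "continuous_on {0..1} (\<lambda>t::real. max 0 (2 * t - 1))"
    by (intro continuous_intros)
  show "((\<lambda>_. x) +++ g) t = g (max 0 (2 * t - 1))" if "t \<in> {0..1}" for t
    using assms that
    by (cases "2 * t = 1") (auto simp: loops_at_def joinpaths_def pathstart_def max_def)
qed (use assms in \<open>auto simp: loops_at_def\<close>)

lemma homotopic_reversepath_join:
  assumes "g \<in> loops_at S x"
  shows "homotopic_paths S (reversepath g +++ g) (\<lambda>_. x)"
proof -
  have g: "continuous_on {0..1} g" "g ` {0..1} \<subseteq> S" "g 1 = x"
    using assms by (auto simp: loops_at_def path_def path_image_def pathfinish_def)
  define k :: "real \<times> real \<Rightarrow> real" where "k = (\<lambda>(s, t). max s \<bar>2 * t - 1\<bar>)"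
  have "continuous_on ({0..1} \<times> {0..1}) k"
    unfolding k_def case_prod_unfold by (intro continuous_intros)
  moreover have k: "k \<in> {0..1} \<times> {0..1} \<rightarrow> {0..1}"
    by (auto simp: k_def)
  ultimately have "continuous_on ({0..1} \<times> {0..1}) (g \<circ> k)"
    using g(1) by (intro continuous_on_compose) (auto intro: continuous_on_subset)
  moreover have "g \<circ> k \<in> {0..1} \<times> {0..1} \<rightarrow> S"
    using k g(2) by (auto simp: Pi_iff image_subset_iff)
  moreover have "(g \<circ> k) (0, t) = (reversepath g +++ g) t" for t
    by (cases "2 * t = 1") (auto simp: k_def joinpaths_def reversepath_def max_def abs_if)
  ultimately show ?thesis
    unfolding homotopic_paths using g(3)
    by (intro exI[of _ "g \<circ> k"])
       (auto simp: k_def joinpaths_def reversepath_def pathstart_def pathfinish_def max_def)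
qed

lemma group_fundamental_group:
  assumes "x \<in> S"
  shows "group (fundamental_group S x)"
proof (rule groupI)
  let ?G = "fundamental_group S x"
  have carr: "carrier ?G = path_class S ` loops_at S x" and one: "\<one>\<^bsub>?G\<^esub> = path_class S (\<lambda>_. x)"
    by (simp_all add: fundamental_group_def)
  show "\<one>\<^bsub>?G\<^esub> \<in> carrier ?G"
    using assms by (simp add: carr one loops_at_const)
  show "a \<otimes>\<^bsub>?G\<^esub> b \<in> carrier ?G" if "a \<in> carrier ?G" "b \<in> carrier ?G" for a b
    using that by (auto simp: carr fundamental_group_mult loops_at_join)
  show "a \<otimes>\<^bsub>?G\<^esub> b \<otimes>\<^bsub>?G\<^esub> c = a \<otimes>\<^bsub>?G\<^esub> (b \<otimes>\<^bsub>?G\<^esub> c)"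
    if abc: "a \<in> carrier ?G" "b \<in> carrier ?G" "c \<in> carrier ?G" for a b c
  proof -
    obtain f g h where fgh: "f \<in> loops_at S x" "g \<in> loops_at S x" "h \<in> loops_at S x"
      and eq: "a = path_class S f" "b = path_class S g" "c = path_class S h"
      using abc unfolding carr by blast
    have "homotopic_paths S (f +++ (g +++ h)) ((f +++ g) +++ h)"
      using fgh by (intro homotopic_paths_assoc) (auto simp: loops_at_def)
    then have "homotopic_paths S ((f +++ g) +++ h) (f +++ (g +++ h))"
      by (rule homotopic_paths_sym)
    then have "path_class S ((f +++ g) +++ h) = path_class S (f +++ (g +++ h))"
      using fgh by (subst path_class_eq_iff) (auto intro: loops_at_join)
    then show ?thesis
      using fgh by (simp add: eq fundamental_group_mult loops_at_join)
  qed
  show "\<one>\<^bsub>?G\<^esub> \<otimes>\<^bsub>?G\<^esub> a = a" if ac: "a \<in> carrier ?G" for a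
  proof -
    obtain f where f: "f \<in> loops_at S x" and a: "a = path_class S f"
      using ac unfolding carr by blast
    have c: "(\<lambda>_. x) \<in> loops_at S x"
      using assms by (rule loops_at_const)
    show ?thesis
      unfolding a one fundamental_group_mult[OF c f]
      by (subst path_class_eq_iff) (use c f in \<open>auto intro: loops_at_join homotopic_const_join\<close>)
  qed
  show "\<exists>b\<in>carrier ?G. b \<otimes>\<^bsub>?G\<^esub> a = \<one>\<^bsub>?G\<^esub>" if ac: "a \<in> carrier ?G" for a
  proof -
    obtain f where f: "f \<in> loops_at S x" and a: "a = path_class S f"
      using ac unfolding carr by blast
    have r: "reversepath f \<in> loops_at S x"
      using f by (rule loops_at_reversepath)
    have "path_class S (reversepath f) \<otimes>\<^bsub>?G\<^esub> a = \<one>\<^bsub>?G\<^esub>"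
      unfolding a one fundamental_group_mult[OF r f]
      by (subst path_class_eq_iff) (use r f in \<open>auto intro: loops_at_join homotopic_reversepath_join\<close>)
    then show ?thesis
      using r unfolding carr by blast
  qed
qed


section \<open>Geodesic rays and the visual boundary\<close>

text \<open>A ray is a function on \<open>[0, \<infinity>)\<close>; its values at negative arguments are irrelevant.\<close>

definition geodesic_ray :: "'a::metric_space set \<Rightarrow> (real \<Rightarrow> 'a) \<Rightarrow> bool" where
  "geodesic_ray X r \<longleftrightarrow>
     r ` {0..} \<subseteq> X \<and> (\<forall>s\<ge>0. \<forall>t\<ge>0. dist (r s) (r t) = \<bar>s - t\<bar>)"

definition asymptotic :: "(real \<Rightarrow> 'a::metric_space) \<Rightarrow> (real \<Rightarrow> 'a) \<Rightarrow> bool" where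
  "asymptotic r r' \<longleftrightarrow> (\<exists>C. \<forall>t\<ge>0. dist (r t) (r' t) \<le> C)"

text \<open>The boundary point \<open>r(+\<infinity>)\<close>.\<close>

definition ray_end :: "'a::metric_space set \<Rightarrow> (real \<Rightarrow> 'a) \<Rightarrow> (real \<Rightarrow> 'a) set" where
  "ray_end X r = {r'. geodesic_ray X r' \<and> asymptotic r r'}"

definition visual_boundary :: "'a::metric_space set \<Rightarrow> (real \<Rightarrow> 'a) set set" where
  "visual_boundary X = ray_end X ` {r. geodesic_ray X r}"

lemma asymptotic_trans:
  assumes "asymptotic q r" "asymptotic r s"
  shows "asymptotic q s"
proof -
  obtain C D where "\<forall>t\<ge>0. dist (q t) (r t) \<le> C" "\<forall>t\<ge>0. dist (r t) (s t) \<le> D"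
    using assms unfolding asymptotic_def by blast
  then have "\<forall>t\<ge>0. dist (q t) (s t) \<le> C + D"
    by (meson add_mono dist_triangle order_trans)
  then show ?thesis
    unfolding asymptotic_def by blast
qed

lemma ray_end_eq_iff:
  assumes "geodesic_ray X r" "geodesic_ray X r'"
  shows "ray_end X r = ray_end X r' \<longleftrightarrow> asymptotic r r'"
proof
  assume "ray_end X r = ray_end X r'"
  moreover have "r' \<in> ray_end X r'"
    using assms by (auto simp: ray_end_def asymptotic_def)
  ultimately show "asymptotic r r'"
    by (auto simp: ray_end_def)
next
  assume "asymptotic r r'"
  moreover from this have "asymptotic r' r"
    by (simp add: asymptotic_def dist_commute)
  ultimately show "ray_end X r = ray_end X r'"
    unfolding ray_end_def using asymptotic_trans by blast
qed

text \<open>The boundary carries the quotient of the topology of uniform convergence on compact sets on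
  the space of all geodesic rays. On a proper Gromov hyperbolic geodesic space, restricting to rays
  issuing from a fixed base point yields the same topology.\<close>

definition boundary_open :: "'a::metric_space set \<Rightarrow> (real \<Rightarrow> 'a) set set \<Rightarrow> bool" where
  "boundary_open X U \<longleftrightarrow>
     U \<subseteq> visual_boundary X \<and>
     (\<forall>r. geodesic_ray X r \<and> ray_end X r \<in> U \<longrightarrow>
        (\<exists>T. \<exists>\<epsilon>>0. \<forall>r'. geodesic_ray X r' \<and> (\<forall>t\<in>{0..T}. dist (r t) (r' t) < \<epsilon>) \<longrightarrow>
            ray_end X r' \<in> U))"

definition boundary_topology :: "'a::metric_space set \<Rightarrow> (real \<Rightarrow> 'a) set topology" where
  "boundary_topology X = topology (boundary_open X)"

lemma istopology_boundary_open: "istopology (boundary_open X)"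
  unfolding istopology_def
proof (intro conjI allI impI)
  fix U V assume U: "boundary_open X U" and V: "boundary_open X V"
  show "boundary_open X (U \<inter> V)"
    unfolding boundary_open_def
  proof (intro conjI allI impI)
    show "U \<inter> V \<subseteq> visual_boundary X"
      using U unfolding boundary_open_def by blast
    fix r assume r: "geodesic_ray X r \<and> ray_end X r \<in> U \<inter> V"
    obtain T \<epsilon> where 1: "\<epsilon> > 0" "\<And>r'. geodesic_ray X r' \<Longrightarrow> \<forall>t\<in>{0..T}. dist (r t) (r' t) < \<epsilon> \<Longrightarrow> ray_end X r' \<in> U"
      using U r unfolding boundary_open_def by (metis IntD1)
    obtain T' \<epsilon>' where 2: "\<epsilon>' > 0" "\<And>r'. geodesic_ray X r' \<Longrightarrow> \<forall>t\<in>{0..T'}. dist (r t) (r' t) < \<epsilon>' \<Longrightarrow> ray_end X r' \<in> V"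
      using V r unfolding boundary_open_def by (metis IntD2)
    show "\<exists>T. \<exists>\<epsilon>>0. \<forall>r'. geodesic_ray X r' \<and> (\<forall>t\<in>{0..T}. dist (r t) (r' t) < \<epsilon>) \<longrightarrow> ray_end X r' \<in> U \<inter> V"
      by (intro exI[of _ "max T T'"] exI[of _ "min \<epsilon> \<epsilon>'"] conjI allI impI IntI 1(2) 2(2))
         (use 1(1) 2(1) in auto)
  qed
next
  fix \<U> assume \<U>: "\<forall>U\<in>\<U>. boundary_open X U"
  show "boundary_open X (\<Union>\<U>)"
    unfolding boundary_open_def
  proof (intro conjI allI impI)
    show "\<Union>\<U> \<subseteq> visual_boundary X"
      using \<U> unfolding boundary_open_def by blast
    fix r assume r: "geodesic_ray X r \<and> ray_end X r \<in> \<Union>\<U>"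
    then obtain U where "U \<in> \<U>" "ray_end X r \<in> U"
      by blast
    moreover from this \<U> r obtain T \<epsilon> where "\<epsilon> > 0"
        "\<forall>r'. geodesic_ray X r' \<and> (\<forall>t\<in>{0..T}. dist (r t) (r' t) < \<epsilon>) \<longrightarrow> ray_end X r' \<in> U"
      unfolding boundary_open_def by blast
    ultimately show "\<exists>T. \<exists>\<epsilon>>0. \<forall>r'. geodesic_ray X r' \<and> (\<forall>t\<in>{0..T}. dist (r t) (r' t) < \<epsilon>) \<longrightarrow> ray_end X r' \<in> \<Union>\<U>"
      by (meson UnionI)
  qed
qed

lemma openin_boundary_topology: "openin (boundary_topology X) = boundary_open X"
  unfolding boundary_topology_def using istopology_boundary_open by (rule topology_inverse')

lemma topspace_boundary_topology: "topspace (boundary_topology X) = visual_boundary X"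
proof -
  have "boundary_open X (visual_boundary X)"
    unfolding boundary_open_def visual_boundary_def by (auto intro: exI[of _ "1::real"])
  then show ?thesis
    unfolding topspace_def openin_boundary_topology by (auto simp: boundary_open_def)
qed

end

theory Submission
  imports Defs "HOL-Real_Asymp.Real_Asymp"
begin

text \<open>Suppose that every point \<open>x\<close> of the universal covering \<open>X\<close> had only one ray to \<open>\<xi>\<close>. Following these
rays for time \<open>t\<close> gives maps \<open>\<phi>\<^sub>t : X \<rightarrow> X\<close> with \<open>\<phi>\<^sub>0 = id\<close>, and every \<open>\<phi>\<^sub>t\<close> is continuous: a limit
of rays to \<open>\<xi>\<close> is again a ray to \<open>\<xi>\<close>, hence the unique one. Let \<open>s\<close> be a lift of a
cone point of angle less than \<open>2\<pi>\<close>. No geodesic passes through \<open>s\<close>, because two points at the same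
distance \<open>h\<close> from the apex of a sharp cone are less than \<open>2h\<close> apart. Hence \<open>s\<close> is not in the image
of \<open>\<phi>\<^sub>t\<close> for \<open>t > 0\<close>. On a small disc around \<open>s\<close> the homotopy from the identity to \<open>\<phi>\<^sub>t\<close>
then moves the bounding circle in the complement of \<open>s\<close> to a curve that bounds a disc there,
and radial projection turns this into a retraction of the disc onto its boundary circle, which
does not exist (\<open>no_flow_avoiding_sharp_cone_point\<close>). The argument is local at \<open>s\<close>.

What remains is that each \<open>x\<close> has a ray to \<open>\<xi>\<close> and that rays to \<open>\<xi>\<close> are closed under limits.
Both hold because geodesics of \<open>X\<close> with a common end, in \<open>X\<close> or at infinity, fellow travel within a
distance that depends only on the distance of their starting points (\<open>segments_fellow_travel\<close>,
\<open>asymptotic_rays_fellow_travel\<close>). This is where hyperbolicity of the fundamental group enters. By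
the argument of Svarc and Milnor (\<open>svarc_milnor\<close>), \<open>X\<close> is quasi-isometric to \<open>\<pi>\<^sub>1(S)\<close> with a word
metric. Pulling the word metric back to \<open>X\<close> gives a pseudometric \<open>E\<close> that satisfies
Gromov's four-point condition and is comparable to the distance of \<open>X\<close>; by stability
of quasi-geodesics (\<open>quasi_geodesic_gromov_product_le\<close>), the geodesics of \<open>X\<close> are nearly
geodesic for \<open>E\<close>. These two properties suffice for fellow travelling, so the proof works with
the pair of metrics and does not transport the four-point condition to the distance itself.\<close>

section \<open>Stability of quasi-geodesics under the four-point condition\<close>

locale hyperbolic_pseudometric =
  fixes M :: "'m set" and d :: "'m \<Rightarrow> 'm \<Rightarrow> real" and \<delta> :: real
  assumes self [simp]: "x \<in> M \<Longrightarrow> d x x = 0"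
    and sym: "x \<in> M \<Longrightarrow> y \<in> M \<Longrightarrow> d x y = d y x"
    and triangle: "x \<in> M \<Longrightarrow> y \<in> M \<Longrightarrow> z \<in> M \<Longrightarrow> d x z \<le> d x y + d y z"
    and delta_nonneg: "0 \<le> \<delta>"
    and four_point: "w \<in> M \<Longrightarrow> x \<in> M \<Longrightarrow> y \<in> M \<Longrightarrow> z \<in> M \<Longrightarrow>
      min (gromov_product d w x y) (gromov_product d w y z) - \<delta> \<le> gromov_product d w x z"
begin

lemma nonneg: "x \<in> M \<Longrightarrow> y \<in> M \<Longrightarrow> 0 \<le> d x y"
  using triangle[of x y x] sym[of x y] by simp

lemma gromov_product_commute:
  "x \<in> M \<Longrightarrow> y \<in> M \<Longrightarrow> gromov_product d w x y = gromov_product d w y x"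
  by (simp add: gromov_product_def sym[of x y])

lemma gromov_product_ge:
  assumes "w \<in> M" "x \<in> M" "y \<in> M"
  shows "d x w - d x y \<le> gromov_product d w x y"
  using triangle[OF assms(2,3,1)] by (simp add: gromov_product_def)

text \<open>Halving a chain of length at most \<open>2 ^ k\<close> costs one application of the four-point condition for each
of the \<open>k\<close> levels. This logarithmic loss plays the part of the exponential divergence of geodesics:
a path that avoids a large ball around a point between its endpoints must be very long.\<close>

lemma gromov_product_chain:
  assumes "p \<in> M" "\<And>i. i \<le> n \<Longrightarrow> w i \<in> M" "n \<le> 2 ^ k"
    and "\<And>i. i \<le> n \<Longrightarrow> b \<le> d (w i) p"
    and "\<And>i. i < n \<Longrightarrow> b \<le> gromov_product d p (w i) (w (Suc i))"
  shows "b - k * \<delta> \<le> gromov_product d p (w 0) (w n)"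
  using assms
proof (induction k arbitrary: n w)
  case 0
  then consider "n = 0" | "n = 1"
    by fastforce
  then show ?case
    using 0 by cases (auto simp: gromov_product_def)
next
  case (Suc k)
  show ?case
  proof (cases "n \<le> 2 ^ k")
    case True
    have "b - k * \<delta> \<le> gromov_product d p (w 0) (w n)"
      using Suc.prems True by (intro Suc.IH) auto
    with delta_nonneg show ?thesis
      by (simp add: algebra_simps)
  next
    case False
    have 1: "b - k * \<delta> \<le> gromov_product d p (w 0) (w (2 ^ k))"
      using Suc.prems False by (intro Suc.IH) auto
    have 2: "b - k * \<delta> \<le> gromov_product d p (w (2 ^ k + 0)) (w (2 ^ k + (n - 2 ^ k)))"
      using Suc.prems False by (intro Suc.IH[where w = "\<lambda>i. w (2 ^ k + i)"]) auto
    have "b - k * \<delta> \<le> min (gromov_product d p (w 0) (w (2 ^ k))) (gromov_product d p (w (2 ^ k)) (w n))"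
      using 1 2 False by simp
    moreover have "min (gromov_product d p (w 0) (w (2 ^ k))) (gromov_product d p (w (2 ^ k)) (w n)) - \<delta>
        \<le> gromov_product d p (w 0) (w n)"
      using Suc.prems False by (intro four_point) auto
    ultimately have "b - k * \<delta> - \<delta> \<le> gromov_product d p (w 0) (w n)"
      by linarith
    then show ?thesis
      by (simp add: algebra_simps)
  qed
qed

definition discrete_geodesic :: "(nat \<Rightarrow> 'm) \<Rightarrow> nat \<Rightarrow> bool" where
  "discrete_geodesic q n \<longleftrightarrow>
     (\<forall>i\<le>n. q i \<in> M) \<and> (\<forall>i\<le>n. \<forall>j\<le>n. d (q i) (q j) = \<bar>real i - real j\<bar>)"

definition quasi_geodesic :: "real \<Rightarrow> (nat \<Rightarrow> 'm) \<Rightarrow> nat \<Rightarrow> bool" where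
  "quasi_geodesic c w n \<longleftrightarrow>
     (\<forall>i\<le>n. w i \<in> M) \<and>
     (\<forall>i\<le>n. \<forall>j\<le>n. d (w i) (w j) \<le> c * \<bar>real i - real j\<bar> \<and>
        \<bar>real i - real j\<bar> \<le> c * d (w i) (w j) + c)"

lemma quasi_geodesicD:
  assumes "quasi_geodesic c w n" "i \<le> n" "j \<le> n"
  shows "d (w i) (w j) \<le> c * \<bar>real i - real j\<bar>"
    and "\<bar>real i - real j\<bar> \<le> c * d (w i) (w j) + c"
  using assms by (auto simp: quasi_geodesic_def)

lemma quasi_geodesic_gromov_product_ge:
  assumes w: "quasi_geodesic c w n" and c: "0 \<le> c" and p: "p \<in> M" and ij: "i \<le> n" "j \<le> n"
    and m: "\<And>l. l \<le> n \<Longrightarrow> m \<le> d p (w l)"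
    and k: "\<bar>real i - real j\<bar> \<le> 2 ^ k"
  shows "m - c - k * \<delta> \<le> gromov_product d p (w i) (w j)"
proof -
  have *: "m - c - k * \<delta> \<le> gromov_product d p (w i) (w j)"
    if "i \<le> j" "j \<le> n" "\<bar>real i - real j\<bar> \<le> 2 ^ k" for i j
  proof -
    have wM: "w l \<in> M" if "l \<le> n" for l
      using w that by (simp add: quasi_geodesic_def)
    have m': "m \<le> d (w l) p" if "l \<le> n" for l
      using m[OF that] sym[OF p wM[OF that]] by simp
    have "real (j - i) \<le> 2 ^ k"
      using that by (simp add: of_nat_diff)
    then have "j - i \<le> 2 ^ k"
      by (metis of_nat_le_iff of_nat_numeral of_nat_power)
    moreover have "m - c \<le> gromov_product d p (w (i + l)) (w (i + Suc l))" if "l < j - i" for l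
    proof -
      have "d (w (i + l)) (w (i + Suc l)) \<le> c * \<bar>real (i + l) - real (i + Suc l)\<bar>"
        using w that \<open>j \<le> n\<close> by (intro quasi_geodesicD(1)) auto
      then have "d (w (i + l)) (w (i + Suc l)) \<le> c"
        by simp
      then show ?thesis
        using gromov_product_ge[OF p wM[of "i + l"] wM[of "i + Suc l"]] m'[of "i + l"] that \<open>j \<le> n\<close>
        by linarith
    qed
    ultimately have "m - c - k * \<delta> \<le> gromov_product d p (w (i + 0)) (w (i + (j - i)))"
      using that wM m' p c
      by (intro gromov_product_chain[where w = "\<lambda>l. w (i + l)"]) (auto intro: order_trans[of _ m])
    then show ?thesis
      using that by simp
  qed
  show ?thesis
  proof (cases "i \<le> j")
    case True
    then show ?thesis using * ij k by simp
  next
    case False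
    then have "m - c - k * \<delta> \<le> gromov_product d p (w j) (w i)"
      using * ij k by (simp add: abs_minus_commute)
    then show ?thesis
      using w ij by (simp add: quasi_geodesic_def gromov_product_commute[of "w i"])
  qed
qed

text \<open>Let \<open>p\<close> be a point of the geodesic at the largest distance \<open>m\<close> from the quasi-geodesic. Go about
\<open>2 m\<close> along the geodesic to both sides of \<open>p\<close>, or to its end, and from there to nearest points of
the quasi-geodesic. The part of the quasi-geodesic between these two points has length linear in
\<open>m\<close> and keeps distance \<open>m\<close> from \<open>p\<close>, so the logarithmic loss in \<open>gromov_product_chain\<close> bounds \<open>m\<close>.\<close>

lemma discrete_geodesic_near_quasi_geodesic:
  assumes c: "1 \<le> c"
  shows "\<exists>m0\<ge>0. \<forall>w n q N j. quasi_geodesic c w n \<longrightarrow> discrete_geodesic q N \<longrightarrow>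
    q 0 = w 0 \<longrightarrow> q N = w n \<longrightarrow> j \<le> N \<longrightarrow> (\<exists>i\<le>n. d (q j) (w i) \<le> m0)"
proof -
  \<comment> \<open>The bound obtained below grows logarithmically in \<open>m\<close>, so it fails for large \<open>m\<close>.\<close>
  have "eventually (\<lambda>m::real. c + (log 2 (c * (6 * m + 5)) + 4) * (\<delta> + 1) < m) at_top"
    using c delta_nonneg by real_asymp
  then obtain m1 where m1: "\<And>m. m \<ge> m1 \<Longrightarrow> c + (log 2 (c * (6 * m + 5)) + 4) * (\<delta> + 1) < m"
    unfolding eventually_at_top_linorder by blast
  define m0 where "m0 = max 1 m1"
  have "\<exists>i\<le>n. d (q j) (w i) \<le> m0"
    if w: "quasi_geodesic c w n" and q: "discrete_geodesic q N"
      and ends: "q 0 = w 0" "q N = w n" and "j \<le> N" for w n q N j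
  proof -
    have wM: "w l \<in> M" if "l \<le> n" for l
      using w that by (simp add: quasi_geodesic_def)
    have qM: "q l \<in> M" if "l \<le> N" for l
      using q that by (simp add: discrete_geodesic_def)
    have dq: "d (q i) (q l) = \<bar>real i - real l\<bar>" if "i \<le> N" "l \<le> N" for i l
      using q that by (simp add: discrete_geodesic_def)
    define D where "D l = Min ((\<lambda>i. d (q l) (w i)) ` {..n})" for l
    have D_le: "D l \<le> d (q l) (w i)" if "i \<le> n" for l i
      unfolding D_def using that by (intro Min_le) auto
    have D_ex: "\<exists>i\<le>n. d (q l) (w i) = D l" for l
    proof -
      have "D l \<in> (\<lambda>i. d (q l) (w i)) ` {..n}"
        unfolding D_def by (intro Min_in) auto
      then show ?thesis by auto
    qed
    define m where "m = Max (D ` {..N})"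
    have m_ge: "D l \<le> m" if "l \<le> N" for l
      unfolding m_def using that by (intro Max_ge) auto
    have "m \<in> D ` {..N}"
      unfolding m_def by (intro Max_in) auto
    then obtain t where t: "t \<le> N" "D t = m"
      by auto
    have p: "q t \<in> M"
      using qM t by simp
    have m_le: "m \<le> d (q t) (w i)" if "i \<le> n" for i
      using D_le[of i t] that t by simp
    obtain i0 where "i0 \<le> n" "d (q t) (w i0) = m"
      using D_ex t by metis
    then have "m \<ge> 0"
      using nonneg p wM by metis
    define k where "k = nat \<lceil>m\<rceil>"
    have k: "m \<le> k" "k \<le> m + 1"
      using \<open>m \<ge> 0\<close> by (auto simp: k_def)
    \<comment> \<open>Truncated subtraction and \<open>min\<close> make \<open>a\<close> and \<open>b\<close> the endpoints of the geodesic if these are near.\<close>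
    define a b where "a = t - 2 * k" and "b = min N (t + 2 * k)"
    have ab: "a \<le> t" "t \<le> b" "b \<le> N"
      using t by (auto simp: a_def b_def)
    have "\<exists>i\<le>n. m \<le> gromov_product d (q t) (q a) (w i) \<and> d (q t) (w i) \<le> 3 * m + 2"
    proof (cases "2 * k \<le> t")
      case True
      obtain i where i: "i \<le> n" "d (q a) (w i) = D a"
        using D_ex by metis
      then have "d (q a) (w i) \<le> m"
        using m_ge[of a] ab by simp
      moreover have "d (q a) (q t) = 2 * k" "d (q t) (q a) = 2 * k"
        using True t by (auto simp: dq a_def)
      moreover have "d (q a) (q t) - d (q a) (w i) \<le> gromov_product d (q t) (q a) (w i)"
        using i ab t qM wM by (intro gromov_product_ge) auto
      moreover have "d (q t) (w i) \<le> d (q t) (q a) + d (q a) (w i)"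
        using i ab t qM wM by (intro triangle) auto
      ultimately show ?thesis
        using i k by (intro exI[of _ i]) auto
    next
      case False
      then have "q a = w 0"
        using ends by (simp add: a_def)
      moreover have "d (w 0) (q t) = t" "d (q t) (w 0) = t"
        using dq[of 0 t] dq[of t 0] t ends by auto
      moreover have "real t \<le> 2 * real k"
        using False by linarith
      ultimately show ?thesis
        using k m_le[of 0] wM[of 0] \<open>m \<ge> 0\<close> by (intro exI[of _ 0]) (auto simp: gromov_product_def)
    qed
    then obtain i where i: "i \<le> n" "m \<le> gromov_product d (q t) (q a) (w i)" "d (q t) (w i) \<le> 3 * m + 2"
      by blast
    have "\<exists>i\<le>n. m \<le> gromov_product d (q t) (q b) (w i) \<and> d (q t) (w i) \<le> 3 * m + 2"
    proof (cases "t + 2 * k \<le> N")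
      case True
      obtain i where i: "i \<le> n" "d (q b) (w i) = D b"
        using D_ex by metis
      then have "d (q b) (w i) \<le> m"
        using m_ge[of b] ab by simp
      moreover have "d (q b) (q t) = 2 * k" "d (q t) (q b) = 2 * k"
        using True t by (auto simp: dq b_def)
      moreover have "d (q b) (q t) - d (q b) (w i) \<le> gromov_product d (q t) (q b) (w i)"
        using i ab t qM wM by (intro gromov_product_ge) auto
      moreover have "d (q t) (w i) \<le> d (q t) (q b) + d (q b) (w i)"
        using i ab t qM wM by (intro triangle) auto
      ultimately show ?thesis
        using i k by (intro exI[of _ i]) auto
    next
      case False
      then have "q b = w n"
        using ends by (simp add: b_def)
      moreover have "d (w n) (q t) = real N - t" "d (q t) (w n) = real N - t"
        using dq[of N t] dq[of t N] t ends by auto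
      moreover have "real N - t \<le> 2 * real k"
        using False by linarith
      ultimately show ?thesis
        using k m_le[of n] wM[of n] \<open>m \<ge> 0\<close> by (intro exI[of _ n]) (auto simp: gromov_product_def)
    qed
    then obtain j' where j': "j' \<le> n" "m \<le> gromov_product d (q t) (q b) (w j')" "d (q t) (w j') \<le> 3 * m + 2"
      by blast
    have "d (w i) (w j') \<le> d (w i) (q t) + d (q t) (w j')"
      using i j' p wM by (intro triangle) auto
    then have "d (w i) (w j') \<le> 6 * m + 4"
      using i j' sym[OF p wM[of i]] by simp
    moreover have "\<bar>real i - real j'\<bar> \<le> c * d (w i) (w j') + c"
      using w i j' by (intro quasi_geodesicD(2)) auto
    ultimately have len: "\<bar>real i - real j'\<bar> \<le> c * (6 * m + 5)"
      using c mult_left_mono[of "d (w i) (w j')" "6 * m + 4" c] by (simp add: algebra_simps)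
    define e where "e = nat \<lceil>log 2 (c * (6 * m + 5))\<rceil>"
    have pos: "c * (6 * m + 5) \<ge> 1"
      using c \<open>m \<ge> 0\<close> mult_mono[of 1 c 1 "6 * m + 5"] by simp
    have e: "log 2 (c * (6 * m + 5)) \<le> e" "e \<le> log 2 (c * (6 * m + 5)) + 1"
    proof -
      have "log 2 (c * (6 * m + 5)) \<ge> 0"
        using pos by simp
      then show "log 2 (c * (6 * m + 5)) \<le> e" "e \<le> log 2 (c * (6 * m + 5)) + 1"
        unfolding e_def by (auto simp: of_nat_nat)
    qed
    have "c * (6 * m + 5) \<le> 2 powr e"
      using e(1) pos by (simp add: log_le_iff)
    then have "\<bar>real i - real j'\<bar> \<le> 2 ^ e"
      using len by (simp add: powr_realpow)
    then have mid: "m - c - e * \<delta> \<le> gromov_product d (q t) (w i) (w j')"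
      using w c p i j' m_le by (intro quasi_geodesic_gromov_product_ge) auto
    have M4: "q t \<in> M" "q a \<in> M" "q b \<in> M" "w i \<in> M" "w j' \<in> M"
      using qM wM t ab i j' by auto
    \<comment> \<open>The Gromov product of \<open>q a\<close> and \<open>q b\<close> at \<open>q t\<close> vanishes, but all three steps \<open>q a\<close>, \<open>w i\<close>, \<open>w j'\<close>, \<open>q b\<close> have a large one.\<close>
    have "min (gromov_product d (q t) (q a) (w i)) (gromov_product d (q t) (w i) (w j')) - \<delta>
        \<le> gromov_product d (q t) (q a) (w j')"
      using M4 by (intro four_point)
    moreover have "min (gromov_product d (q t) (q a) (w j')) (gromov_product d (q t) (w j') (q b)) - \<delta>
        \<le> gromov_product d (q t) (q a) (q b)"
      using M4 by (intro four_point)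
    moreover have "gromov_product d (q t) (q a) (q b) = 0"
      using ab t by (simp add: gromov_product_def dq)
    moreover have "gromov_product d (q t) (w j') (q b) = gromov_product d (q t) (q b) (w j')"
      using M4 by (intro gromov_product_commute)
    moreover have "0 \<le> e * \<delta>"
      using delta_nonneg by simp
    ultimately have "m \<le> c + e * \<delta> + 2 * \<delta>"
      using i j' mid c delta_nonneg by linarith
    also have "\<dots> \<le> c + (log 2 (c * (6 * m + 5)) + 4) * (\<delta> + 1)"
    proof -
      have "(e + 2) * \<delta> \<le> (log 2 (c * (6 * m + 5)) + 4) * (\<delta> + 1)"
        using e delta_nonneg pos by (intro mult_mono) auto
      then show ?thesis
        by (simp add: algebra_simps)
    qed
    finally have "m < m1"
      using m1[of m] by linarith
    moreover obtain i where "i \<le> n" "d (q j) (w i) = D j"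
      using D_ex by metis
    ultimately show ?thesis
      using m_ge[OF \<open>j \<le> N\<close>] by (auto simp: m0_def)
  qed
  then show ?thesis
    by (intro exI[of _ m0]) (auto simp: m0_def)
qed

text \<open>The points of a geodesic between the endpoints are near the quasi-geodesic. The first point of
the geodesic that is not near the part of the quasi-geodesic up to \<open>w i\<close> is near the part after it, so
its predecessor is near both some \<open>w a\<close> and some \<open>w b\<close> with \<open>a \<le> i \<le> b\<close>. Then \<open>b - a\<close> is bounded, so \<open>w i\<close> is near the geodesic.
The conclusion is stated with Gromov products, which keeps the geodesic out of later arguments.\<close>

theorem quasi_geodesic_gromov_product_le:
  assumes c: "1 \<le> c"
    and geod: "\<And>u v. u \<in> M \<Longrightarrow> v \<in> M \<Longrightarrow> \<exists>q N. discrete_geodesic q N \<and> q 0 = u \<and> q N = v"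
  shows "\<exists>C. \<forall>w n i. quasi_geodesic c w n \<longrightarrow> i \<le> n \<longrightarrow> gromov_product d (w i) (w 0) (w n) \<le> C"
proof -
  obtain m where m: "m \<ge> 0" "\<And>w n q N j. quasi_geodesic c w n \<Longrightarrow> discrete_geodesic q N \<Longrightarrow>
      q 0 = w 0 \<Longrightarrow> q N = w n \<Longrightarrow> j \<le> N \<Longrightarrow> \<exists>i\<le>n. d (q j) (w i) \<le> m"
    using discrete_geodesic_near_quasi_geodesic[OF c] by metis
  define L where "L = c * (2 * m + 1) + c"
  have "gromov_product d (w i) (w 0) (w n) \<le> c * L + m"
    if w: "quasi_geodesic c w n" and i: "i \<le> n" for w n i
  proof -
    have wM: "w l \<in> M" if "l \<le> n" for l
      using w that by (simp add: quasi_geodesic_def)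
    obtain q N where q: "discrete_geodesic q N" and ends: "q 0 = w 0" "q N = w n"
      using geod wM by (metis le0 order_refl)
    have qM: "q l \<in> M" if "l \<le> N" for l
      using q that by (simp add: discrete_geodesic_def)
    have dq: "d (q i) (q l) = \<bar>real i - real l\<bar>" if "i \<le> N" "l \<le> N" for i l
      using q that by (simp add: discrete_geodesic_def)
    have "\<exists>j a b. j \<le> N \<and> a \<le> i \<and> i \<le> b \<and> b \<le> n \<and> d (q j) (w a) \<le> m \<and> d (q j) (w b) \<le> m + 1"
    proof (cases "\<exists>l\<le>i. d (q N) (w l) \<le> m")
      case True
      then obtain l where "l \<le> i" "d (q N) (w l) \<le> m"
        by blast
      moreover have "d (q N) (w n) \<le> m + 1"
        using m(1) wM ends by simp
      ultimately show ?thesis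
        using i by blast
    next
      case False
      define j where "j = (LEAST j. \<not> (\<exists>l\<le>i. d (q j) (w l) \<le> m))"
      have j: "\<not> (\<exists>l\<le>i. d (q j) (w l) \<le> m)"
        unfolding j_def using False by (rule LeastI)
      have "j \<le> N"
        unfolding j_def using False by (rule Least_le)
      have "\<exists>l\<le>i. d (q 0) (w l) \<le> m"
        using m(1) wM ends by auto
      then have "j \<noteq> 0"
        using j by metis
      then obtain j' where j': "j = Suc j'"
        using not0_implies_Suc by blast
      then have "\<exists>l\<le>i. d (q j') (w l) \<le> m"
        using not_less_Least[of j' "\<lambda>j. \<not> (\<exists>l\<le>i. d (q j) (w l) \<le> m)"] unfolding j_def by auto
      then obtain a where a: "a \<le> i" "d (q j') (w a) \<le> m"
        by blast
      obtain b where b: "b \<le> n" "d (q j) (w b) \<le> m"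
        using m(2)[OF w q ends \<open>j \<le> N\<close>] by blast
      have "d (q j') (w b) \<le> d (q j') (q j) + d (q j) (w b)"
        using qM wM b j' \<open>j \<le> N\<close> by (intro triangle) auto
      also have "d (q j') (q j) = 1"
        using j' \<open>j \<le> N\<close> by (simp add: dq)
      finally have "d (q j') (w b) \<le> m + 1"
        using b by simp
      moreover have "i \<le> b"
        using j b by (meson nat_le_linear)
      ultimately show ?thesis
        using a b j' \<open>j \<le> N\<close> by (metis Suc_leD)
    qed
    then obtain j a b where jab: "j \<le> N" "a \<le> i" "i \<le> b" "b \<le> n"
        "d (q j) (w a) \<le> m" "d (q j) (w b) \<le> m + 1"
      by blast
    have Ms: "q j \<in> M" "w a \<in> M" "w b \<in> M" "w i \<in> M" "w 0 \<in> M" "w n \<in> M"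
      using qM wM jab i by auto
    have "d (w a) (w b) \<le> 2 * m + 1"
      using triangle[of "w a" "q j" "w b"] sym[of "w a" "q j"] Ms jab by simp
    moreover have "\<bar>real a - real b\<bar> \<le> c * d (w a) (w b) + c"
      using jab i by (intro quasi_geodesicD(2)[OF w]) auto
    ultimately have "\<bar>real a - real b\<bar> \<le> L"
      using c mult_left_mono[of "d (w a) (w b)" "2 * m + 1" c] unfolding L_def by linarith
    then have "\<bar>real i - real a\<bar> \<le> L"
      using jab by simp
    moreover have "d (w i) (w a) \<le> c * \<bar>real i - real a\<bar>"
      using jab i by (intro quasi_geodesicD(1)[OF w]) auto
    ultimately have "d (w i) (w a) \<le> c * L"
      using c mult_left_mono[of "\<bar>real i - real a\<bar>" L c] by linarith
    then have near: "d (w i) (q j) \<le> c * L + m"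
      using triangle[of "w i" "w a" "q j"] sym[of "w a" "q j"] Ms jab by simp
    have "d (q 0) (q j) + d (q j) (q N) = d (q 0) (q N)"
      using jab by (simp add: dq)
    then have "d (w 0) (q j) + d (q j) (w n) = d (w 0) (w n)"
      by (simp add: ends)
    then show ?thesis
      using near triangle[of "w 0" "q j" "w i"] triangle[of "w n" "q j" "w i"] Ms
        sym[of "w i" "q j"] sym[of "w n" "q j"]
      by (simp add: gromov_product_def)
  qed
  then show ?thesis
    by blast
qed

end

section \<open>Word metrics\<close>

abbreviation word_product :: "('a, 'b) monoid_scheme \<Rightarrow> 'a list \<Rightarrow> 'a" where
  "word_product G xs \<equiv> foldr (mult G) xs \<one>\<^bsub>G\<^esub>"

definition word_metric :: "('a, 'b) monoid_scheme \<Rightarrow> 'a set \<Rightarrow> 'a \<Rightarrow> 'a \<Rightarrow> real" where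
  "word_metric G A g h = real (word_length G A (inv\<^bsub>G\<^esub> g \<otimes>\<^bsub>G\<^esub> h))"

context group
begin

lemma word_product_closed: "set xs \<subseteq> carrier G \<Longrightarrow> word_product G xs \<in> carrier G"
  by (induction xs) auto

lemma word_product_append:
  "set xs \<subseteq> carrier G \<Longrightarrow> set ys \<subseteq> carrier G \<Longrightarrow>
    word_product G (xs @ ys) = word_product G xs \<otimes> word_product G ys"
  by (induction xs) (auto simp: word_product_closed m_assoc)

lemma inv_word_product:
  "set xs \<subseteq> carrier G \<Longrightarrow> inv (word_product G xs) = word_product G (map (m_inv G) (rev xs))"
proof (induction xs)
  case (Cons x xs)
  then have "set (map (m_inv G) (rev xs)) \<subseteq> carrier G" "set [inv x] \<subseteq> carrier G"
    by auto
  from word_product_append[OF this] show ?case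
    using Cons by (simp add: inv_mult_group word_product_closed)
qed simp

lemma word_length_le:
  assumes "set xs \<subseteq> A \<union> m_inv G ` A"
  shows "word_length G A (word_product G xs) \<le> length xs"
  unfolding word_length_def using assms by (intro Least_le) auto

context
  fixes A assumes A: "A \<subseteq> carrier G" "generate G A = carrier G"
begin

lemma letters_closed: "A \<union> m_inv G ` A \<subseteq> carrier G"
  using A by auto

lemma word_exists:
  assumes "g \<in> carrier G"
  shows "\<exists>xs. set xs \<subseteq> A \<union> m_inv G ` A \<and> word_product G xs = g"
proof -
  have "g \<in> generate G A"
    using assms A by simp
  then show ?thesis
  proof (induction rule: generate.induct)
    case one
    then show ?case by (intro exI[of _ "[]"]) auto
  next
    case (incl h)
    then show ?case using A by (intro exI[of _ "[h]"]) auto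
  next
    case (inv h)
    then show ?case using A by (intro exI[of _ "[inv h]"]) auto
  next
    case (eng h1 h2)
    then obtain xs ys where "set xs \<subseteq> A \<union> m_inv G ` A" "word_product G xs = h1"
      "set ys \<subseteq> A \<union> m_inv G ` A" "word_product G ys = h2"
      by blast
    then show ?case
      using word_product_append[of xs ys] letters_closed by (intro exI[of _ "xs @ ys"]) auto
  qed
qed

lemma shortest_word_exists:
  assumes "g \<in> carrier G"
  shows "\<exists>xs. length xs = word_length G A g \<and> set xs \<subseteq> A \<union> m_inv G ` A \<and> word_product G xs = g"
  unfolding word_length_def by (rule LeastI_ex) (use word_exists[OF assms] in auto)

lemma word_length_mult_le:
  assumes "g \<in> carrier G" "h \<in> carrier G"
  shows "word_length G A (g \<otimes> h) \<le> word_length G A g + word_length G A h"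
proof -
  obtain xs ys where x: "length xs = word_length G A g" "set xs \<subseteq> A \<union> m_inv G ` A" "word_product G xs = g"
    and y: "length ys = word_length G A h" "set ys \<subseteq> A \<union> m_inv G ` A" "word_product G ys = h"
    using shortest_word_exists[OF assms(1)] shortest_word_exists[OF assms(2)] by blast
  have "word_product G (xs @ ys) = g \<otimes> h"
    using x y letters_closed by (subst word_product_append) auto
  then show ?thesis
    using word_length_le[of "xs @ ys" A] x y by simp
qed

lemma word_length_inv_le:
  assumes "g \<in> carrier G"
  shows "word_length G A (inv g) \<le> word_length G A g"
proof -
  obtain xs where x: "length xs = word_length G A g" "set xs \<subseteq> A \<union> m_inv G ` A" "word_product G xs = g"
    using shortest_word_exists[OF assms(1)] by blast
  have "inv (inv a) = a" if "a \<in> A" for a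
    using A that by auto
  then have "set (map (m_inv G) (rev xs)) \<subseteq> A \<union> m_inv G ` A"
    using x A by auto
  then have "word_length G A (word_product G (map (m_inv G) (rev xs))) \<le> length (map (m_inv G) (rev xs))"
    by (rule word_length_le)
  then show ?thesis
    using x letters_closed by (subst (asm) inv_word_product[symmetric]) auto
qed

lemma word_metric_sym:
  assumes "g \<in> carrier G" "h \<in> carrier G"
  shows "word_metric G A g h = word_metric G A h g"
proof -
  have "inv (inv g \<otimes> h) = inv h \<otimes> g" "inv (inv h \<otimes> g) = inv g \<otimes> h"
    using assms by (simp_all add: inv_mult_group)
  then show ?thesis
    using word_length_inv_le[of "inv g \<otimes> h"] word_length_inv_le[of "inv h \<otimes> g"] assms
    by (simp add: word_metric_def)
qed

lemma word_metric_triangle: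
  assumes "g \<in> carrier G" "h \<in> carrier G" "k \<in> carrier G"
  shows "word_metric G A g k \<le> word_metric G A g h + word_metric G A h k"
proof -
  have "(inv g \<otimes> h) \<otimes> (inv h \<otimes> k) = inv g \<otimes> k"
    using assms by (simp add: m_assoc) (simp add: m_assoc[symmetric])
  then show ?thesis
    using word_length_mult_le[of "inv g \<otimes> h" "inv h \<otimes> k"] assms by (simp add: word_metric_def)
qed

lemma word_metric_self: "g \<in> carrier G \<Longrightarrow> word_metric G A g g = 0"
  using word_length_le[of "[]" A] by (simp add: word_metric_def)

lemma word_metric_le_length:
  assumes "g \<in> carrier G" "set xs \<subseteq> A \<union> m_inv G ` A"
  shows "word_metric G A g (g \<otimes> word_product G xs) \<le> length xs"
proof -
  have "word_product G xs \<in> carrier G"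
    using assms letters_closed by (intro word_product_closed) blast
  then have "inv g \<otimes> (g \<otimes> word_product G xs) = word_product G xs"
    using assms by (simp add: m_assoc[symmetric])
  then show ?thesis
    using word_length_le[OF assms(2)] by (simp add: word_metric_def)
qed

text \<open>The prefixes of a shortest word for \<open>u\<^sup>-\<^sup>1 v\<close> trace a geodesic from \<open>u\<close> to \<open>v\<close>.\<close>

lemma word_metric_discrete_geodesic:
  assumes u: "u \<in> carrier G" and v: "v \<in> carrier G"
  shows "\<exists>q N. (\<forall>i\<le>N. q i \<in> carrier G) \<and>
    (\<forall>i\<le>N. \<forall>j\<le>N. word_metric G A (q i) (q j) = \<bar>real i - real j\<bar>) \<and> q 0 = u \<and> q N = v"
proof -
  obtain xs where len: "length xs = word_length G A (inv u \<otimes> v)"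
    and xs: "set xs \<subseteq> A \<union> m_inv G ` A" "word_product G xs = inv u \<otimes> v"
    using shortest_word_exists[of "inv u \<otimes> v"] u v by auto
  define q where "q i = u \<otimes> word_product G (take i xs)" for i
  have closed: "word_product G ys \<in> carrier G" if "set ys \<subseteq> set xs" for ys
    using that xs letters_closed by (intro word_product_closed) auto
  have q_closed: "q i \<in> carrier G" for i
    unfolding q_def using u closed[of "take i xs"] set_take_subset[of i xs] by simp
  have le: "word_metric G A (q i) (q j) \<le> real j - real i" if "i \<le> j" "j \<le> length xs" for i j
  proof -
    have "take j xs = take i xs @ take (j - i) (drop i xs)"
      using that by (metis le_add_diff_inverse take_add)
    moreover have "set (take i xs) \<subseteq> carrier G"
      using xs letters_closed set_take_subset[of i xs] by blast
    moreover have t: "set (take (j - i) (drop i xs)) \<subseteq> A \<union> m_inv G ` A"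
      using xs by (meson order_trans set_drop_subset set_take_subset)
    moreover have "set (take (j - i) (drop i xs)) \<subseteq> carrier G"
      using t letters_closed by blast
    ultimately have "q j = q i \<otimes> word_product G (take (j - i) (drop i xs))"
      unfolding q_def using u by (simp add: word_product_append m_assoc word_product_closed del: foldr_append)
    then show ?thesis
      using word_metric_le_length[OF q_closed t, of i] that by simp
  qed
  have q0: "q 0 = u"
    using u by (simp add: q_def)
  have qN: "q (length xs) = v"
    using u v xs by (simp add: q_def m_assoc[symmetric])
  have total: "word_metric G A u v = length xs"
    by (simp add: word_metric_def len)
  have eq: "word_metric G A (q i) (q j) = real j - real i" if "i \<le> j" "j \<le> length xs" for i j
    using le[OF that] le[of 0 i] le[of j "length xs"] that total q0 qN u v q_closed
      word_metric_triangle[of u "q i" v] word_metric_triangle[of "q i" "q j" v]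
    by (simp add: of_nat_diff)
  have "word_metric G A (q i) (q j) = \<bar>real i - real j\<bar>" if "i \<le> length xs" "j \<le> length xs" for i j
  proof (cases "i \<le> j")
    case True
    then show ?thesis using eq[of i j] that by simp
  next
    case False
    then show ?thesis using eq[of j i] that word_metric_sym[OF q_closed q_closed, of i j] by simp
  qed
  then show ?thesis
    using q0 qN q_closed by blast
qed

end

end

theorem hyperbolic_group_word_metric:
  assumes "hyperbolic_group G"
  obtains A \<delta> where "finite A" "A \<subseteq> carrier G" "generate G A = carrier G"
    "hyperbolic_pseudometric (carrier G) (word_metric G A) \<delta>"
    "\<And>u v. u \<in> carrier G \<Longrightarrow> v \<in> carrier G \<Longrightarrow>
      \<exists>q N. hyperbolic_pseudometric.discrete_geodesic (carrier G) (word_metric G A) q N \<and> q 0 = u \<and> q N = v"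
proof -
  interpret group G
    using assms by (simp add: hyperbolic_group_def)
  obtain A where A: "finite A" "A \<subseteq> carrier G" "generate G A = carrier G"
    and "gromov_hyperbolic (carrier G) (word_metric G A)"
    using assms unfolding hyperbolic_group_def word_metric_def[abs_def] by blast
  then obtain \<delta> where "\<delta> \<ge> 0" and \<delta>: "\<And>w x y z. w \<in> carrier G \<Longrightarrow> x \<in> carrier G \<Longrightarrow> y \<in> carrier G \<Longrightarrow> z \<in> carrier G \<Longrightarrow>
      min (gromov_product (word_metric G A) w x y) (gromov_product (word_metric G A) w y z) - \<delta>
        \<le> gromov_product (word_metric G A) w x z"
    unfolding gromov_hyperbolic_def by blast
  interpret hyperbolic_pseudometric "carrier G" "word_metric G A" \<delta>
    using A \<open>\<delta> \<ge> 0\<close> \<delta> word_metric_self word_metric_sym word_metric_triangle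
    by unfold_locales auto
  show thesis
  proof (rule that)
    show "hyperbolic_pseudometric (carrier G) (word_metric G A) \<delta>"
      by unfold_locales
    show "\<exists>q N. discrete_geodesic q N \<and> q 0 = u \<and> q N = v" if "u \<in> carrier G" "v \<in> carrier G" for u v
      using word_metric_discrete_geodesic[OF A(2,3) that] unfolding discrete_geodesic_def by blast
  qed (use A in auto)
qed

section \<open>Proper length spaces\<close>

text \<open>The two length estimates that are used of an almost shortest path: inscribed polygons with equidistant
parameters, and those with one or two inner vertices. They replace the length itself, which
has to be compared only along fine subdivisions.\<close>

definition near_minimal_path :: "'a::metric_space set \<Rightarrow> 'a \<Rightarrow> 'a \<Rightarrow> real \<Rightarrow> (real \<Rightarrow> 'a) \<Rightarrow> bool" where
  "near_minimal_path S x y e g \<longleftrightarrow>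
     path g \<and> path_image g \<subseteq> S \<and> pathstart g = x \<and> pathfinish g = y \<and>
     (\<forall>n>0. (\<Sum>i<n. dist (g (real i / real n)) (g (real (Suc i) / real n))) < dist x y + e) \<and>
     (\<forall>s t. 0 \<le> s \<longrightarrow> s \<le> t \<longrightarrow> t \<le> 1 \<longrightarrow>
        dist x (g s) + dist (g s) (g t) + dist (g t) y < dist x y + e)"

lemma near_minimal_pathD:
  assumes "near_minimal_path S x y e g"
  shows "path g" "path_image g \<subseteq> S" "pathstart g = x" "pathfinish g = y"
    "n > 0 \<Longrightarrow> (\<Sum>i<n. dist (g (real i / real n)) (g (real (Suc i) / real n))) < dist x y + e"
    "0 \<le> s \<Longrightarrow> s \<le> t \<Longrightarrow> t \<le> 1 \<Longrightarrow>
      dist x (g s) + dist (g s) (g t) + dist (g t) y < dist x y + e"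
  using assms unfolding near_minimal_path_def by blast+

theorem near_minimal_path_exists:
  assumes S: "length_metric_on S" and x: "x \<in> S" "y \<in> S" and e: "e > 0"
  shows "\<exists>g. near_minimal_path S x y e g"
proof -
  have "ennreal (dist x y) = (INF g \<in> {g. path g \<and> path_image g \<subseteq> S \<and> pathstart g = x \<and> pathfinish g = y}. path_length g)"
    using S x unfolding length_metric_on_def by blast
  moreover have "ennreal (dist x y) < ennreal (dist x y + e)"
    using e by (simp add: ennreal_less_iff)
  ultimately have "(INF g \<in> {g. path g \<and> path_image g \<subseteq> S \<and> pathstart g = x \<and> pathfinish g = y}. path_length g)
      < ennreal (dist x y + e)"
    by simp
  then obtain g where g: "path g" "path_image g \<subseteq> S" "pathstart g = x" "pathfinish g = y"
    and len: "path_length g < ennreal (dist x y + e)"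
    unfolding INF_less_iff by blast
  have *: "(\<Sum>i<length ts - 1. dist (g (ts ! i)) (g (ts ! Suc i))) < dist x y + e"
    if "sorted ts" "set ts \<subseteq> {0..1}" for ts
  proof -
    have "ennreal (\<Sum>i<length ts - 1. dist (g (ts ! i)) (g (ts ! Suc i))) \<le> path_length g"
      unfolding path_length_def using that by (subst sum_ennreal[symmetric]) (auto intro!: SUP_upper)
    from le_less_trans[OF this len] show ?thesis
      by (subst (asm) ennreal_less_iff) (auto intro: sum_nonneg)
  qed
  have mesh: "(\<Sum>i<n. dist (g (real i / real n)) (g (real (Suc i) / real n))) < dist x y + e"
    if n: "n > 0" for n
  proof -
    let ?ts = "map (\<lambda>i. real i / real n) [0..<Suc n]"
    have "sorted ?ts"
      by (auto simp: sorted_iff_nth_mono divide_right_mono simp del: upt_Suc)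
    moreover have "set ?ts \<subseteq> {0..1}"
      using n by (auto simp: field_simps)
    ultimately have "(\<Sum>i<length ?ts - 1. dist (g (?ts ! i)) (g (?ts ! Suc i))) < dist x y + e"
      by (rule *)
    also have "(\<Sum>i<length ?ts - 1. dist (g (?ts ! i)) (g (?ts ! Suc i)))
        = (\<Sum>i<n. dist (g (real i / real n)) (g (real (Suc i) / real n)))"
      by (intro sum.cong) (auto simp del: upt_Suc)
    finally show ?thesis .
  qed
  have "dist x (g s) + dist (g s) (g t) + dist (g t) y < dist x y + e"
    if "0 \<le> s" "s \<le> t" "t \<le> 1" for s t
    using *[of "[0, s, t, 1]"] g that by (simp add: lessThan_Suc pathstart_def pathfinish_def)
  with g mesh show ?thesis
    unfolding near_minimal_path_def by blast
qed

lemma path_point_at_distance: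
  fixes x :: "'a::metric_space"
  assumes "path g" "pathstart g = x" "pathfinish g = y" "0 \<le> t" "t \<le> dist x y"
  shows "\<exists>u\<in>{0..1}. dist x (g u) = t"
proof -
  have "continuous_on {0..1} (\<lambda>u. dist x (g u))"
    using assms by (intro continuous_intros) (simp add: path_def)
  moreover have "dist x (g 0) = 0" "dist x (g 1) = dist x y"
    using assms by (auto simp: pathstart_def pathfinish_def)
  ultimately show ?thesis
    using IVT'[of "\<lambda>u. dist x (g u)" 0 t 1] assms by auto
qed

text \<open>The radius of a compact ball can be enlarged by \<open>\<rho> / 2\<close>: an almost shortest path to a point of the
larger ball leaves the smaller one at distance little more than \<open>\<rho> / 2\<close> from its end, so finitely
many balls of radius \<open>\<rho>\<close> cover the larger ball.\<close>

theorem length_space_proper: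
  assumes X: "length_metric_on X" and \<rho>: "\<rho> > 0"
    and loc: "\<And>x. x \<in> X \<Longrightarrow> compact (cball x \<rho> \<inter> X)" and x: "x \<in> X"
  shows "compact (cball x R \<inter> X)"
proof -
  have *: "compact (cball x (real n * (\<rho> / 2)) \<inter> X)" for n
  proof (induction n)
    case 0
    have "cball x (real 0 * (\<rho> / 2)) \<inter> X = {x}"
      using x by auto
    then show ?case by simp
  next
    case (Suc n)
    define r where "r = real n * (\<rho> / 2)"
    define B where "B = cball x r \<inter> X"
    have "compact B"
      using Suc by (simp add: B_def r_def)
    then obtain F where F: "F \<subseteq> B" "finite F" "B \<subseteq> (\<Union>z\<in>F. ball z (\<rho> / 4))"
      by (rule compactE_image[of B B "\<lambda>z. ball z (\<rho> / 4)"]) (use \<rho> in auto)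
    have "cball x (r + \<rho> / 2) \<inter> X \<subseteq> (\<Union>z\<in>F. cball z \<rho> \<inter> X)"
    proof
      fix y assume y: "y \<in> cball x (r + \<rho> / 2) \<inter> X"
      have "\<exists>z\<in>B. dist z y \<le> 5 / 8 * \<rho>"
      proof (cases "dist x y \<le> r")
        case True
        then have "y \<in> B" "dist y y \<le> 5 / 8 * \<rho>"
          using y \<rho> by (auto simp: B_def)
        then show ?thesis by blast
      next
        case False
        have "y \<in> X" "\<rho> / 8 > 0"
          using y \<rho> by auto
        then obtain g where g: "near_minimal_path X x y (\<rho> / 8) g"
          using near_minimal_path_exists[OF X x] by blast
        note gD = near_minimal_pathD[OF g]
        have "0 \<le> r"
          using \<rho> by (simp add: r_def)
        then obtain u where u: "u \<in> {0..1}" "dist x (g u) = r"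
          using path_point_at_distance[of g x y r] gD(1,3,4) False by auto
        have "dist (g u) y < \<rho> / 8 + \<rho> / 2"
          using gD(6)[of u u] u y by simp
        moreover have "g u \<in> B"
          using gD(2) u by (auto simp: B_def path_image_def)
        ultimately show ?thesis
          by (intro bexI[of _ "g u"]) auto
      qed
      then obtain z where z: "z \<in> B" "dist z y \<le> 5 / 8 * \<rho>"
        by blast
      then obtain z' where z': "z' \<in> F" "dist z' z < \<rho> / 4"
        using F by auto
      have "dist z' y \<le> \<rho>"
        using dist_triangle[of z' y z] z z' \<rho> by simp
      then show "y \<in> (\<Union>z\<in>F. cball z \<rho> \<inter> X)"
        using z' y by auto
    qed
    then have "cball x (r + \<rho> / 2) \<inter> X = (\<Union>z\<in>F. cball z \<rho> \<inter> X) \<inter> cball x (r + \<rho> / 2)"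
      by auto
    moreover have "compact (cball z \<rho> \<inter> X)" if "z \<in> F" for z
      using F(1) that by (intro loc) (auto simp: B_def)
    then have "compact ((\<Union>z\<in>F. cball z \<rho> \<inter> X) \<inter> cball x (r + \<rho> / 2))"
      using F(2) by (intro compact_Int_closed[OF compact_UN]) auto
    ultimately have "compact (cball x (r + \<rho> / 2) \<inter> X)"
      by simp
    moreover have "r + \<rho> / 2 = real (Suc n) * (\<rho> / 2)"
      by (simp add: r_def algebra_simps)
    ultimately show ?case
      by simp
  qed
  obtain n where "R / (\<rho> / 2) \<le> real n"
    using real_arch_simple by blast
  then have "R \<le> real n * (\<rho> / 2)"
    using \<rho> by (simp add: field_simps)
  then have "cball x R \<inter> X = (cball x (real n * (\<rho> / 2)) \<inter> X) \<inter> cball x R"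
    by auto
  then show ?thesis
    using *[of n] by (metis compact_Int_closed closed_cball)
qed

definition proper_on :: "'a::metric_space set \<Rightarrow> bool" where
  "proper_on X \<longleftrightarrow> (\<forall>x\<in>X. \<forall>R. compact (cball x R \<inter> X))"

text \<open>Tychonoff's theorem in place of the theorem of Arzela and Ascoli. Approximation at finitely many
arguments is enough to pass metric identities to the limit, so the functions
need not be continuous and no subsequence has to be chosen.\<close>

lemma pointwise_cluster_function:
  fixes f :: "nat \<Rightarrow> 'i \<Rightarrow> 'a::metric_space"
  assumes K: "\<And>i. compact (K i)" and f: "\<And>n i. f n i \<in> K i"
  shows "\<exists>g. (\<forall>i. g i \<in> K i) \<and>
    (\<forall>F e N. finite F \<longrightarrow> e > 0 \<longrightarrow> (\<exists>n\<ge>N. \<forall>i\<in>F. dist (f n i) (g i) < e))"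
proof -
  have "compact (Pi\<^sub>E UNIV K)"
    using K compactin_PiE[of "\<lambda>_. euclidean" UNIV K]
    by (simp add: euclidean_product_topology)
  moreover have "eventually (\<lambda>h. h \<in> Pi\<^sub>E UNIV K) (filtermap f sequentially)"
    using f by (simp add: eventually_filtermap PiE_UNIV_domain)
  moreover have "filtermap f sequentially \<noteq> bot"
    by (simp add: filtermap_bot_iff)
  ultimately obtain g where g: "g \<in> Pi\<^sub>E UNIV K" and inf: "inf (nhds g) (filtermap f sequentially) \<noteq> bot"
    unfolding compact_filter by blast
  have "\<exists>n\<ge>N. \<forall>i\<in>F. dist (f n i) (g i) < e" if "finite F" "e > 0" for F e N
  proof (rule ccontr)
    assume none: "\<not> ?thesis"
    define U where "U = (\<Inter>i\<in>F. (\<lambda>h. h i) -` ball (g i) e)"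
    have "open U"
      unfolding U_def using that
      by (intro open_INT ballI open_vimage open_ball continuous_on_product_coordinates)
    moreover have "g \<in> U"
      using that by (simp add: U_def)
    ultimately have "eventually (\<lambda>h. h \<in> U) (nhds g)"
      by (rule eventually_nhds_in_open)
    moreover have "eventually (\<lambda>h. h \<notin> U) (filtermap f sequentially)"
      unfolding eventually_filtermap using none
      by (intro eventually_sequentiallyI[of N]) (auto simp: U_def dist_commute)
    ultimately have "eventually (\<lambda>h. False) (inf (nhds g) (filtermap f sequentially))"
      unfolding eventually_inf by blast
    with inf show False
      by (simp add: eventually_False)
  qed
  with g show ?thesis
    by (metis PiE_UNIV_domain UNIV_I PiE_mem)
qed

definition geodesic_segment :: "'a::metric_space set \<Rightarrow> (real \<Rightarrow> 'a) \<Rightarrow> real \<Rightarrow> bool" where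
  "geodesic_segment X \<sigma> l \<longleftrightarrow>
     \<sigma> ` {0..l} \<subseteq> X \<and> (\<forall>s\<in>{0..l}. \<forall>t\<in>{0..l}. dist (\<sigma> s) (\<sigma> t) = \<bar>s - t\<bar>)"

lemma geodesic_ray_imp_segment: "geodesic_ray X r \<Longrightarrow> geodesic_segment X r l"
  by (auto simp: geodesic_ray_def geodesic_segment_def)

text \<open>On an almost shortest path from \<open>x\<close>, choose for each \<open>t\<close> a point at distance \<open>t\<close> from \<open>x\<close>. Up to the
length defect these points have the mutual distances of a geodesic, whatever the choice, and a
pointwise cluster function is a geodesic.\<close>

theorem geodesic_segment_exists:
  assumes X: "length_metric_on X" "proper_on X" and x: "x \<in> X" and y: "y \<in> X"
  shows "\<exists>\<sigma>. geodesic_segment X \<sigma> (dist x y) \<and> \<sigma> 0 = x \<and> \<sigma> (dist x y) = y"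
proof -
  define l where "l = dist x y"
  have l: "0 \<le> l"
    by (simp add: l_def)
  define P where "P n f \<longleftrightarrow> (\<forall>t. f t \<in> cball x l \<inter> X) \<and>
     (\<forall>t\<in>{0..l}. dist x (f t) = t \<and> dist (f t) y \<le> l - t + 1 / real (Suc n)) \<and>
     (\<forall>s\<in>{0..l}. \<forall>t\<in>{0..l}. dist (f s) (f t) \<le> \<bar>s - t\<bar> + 1 / real (Suc n))" for n f
  have "\<exists>f. P n f" for n
  proof -
    have pos: "1 / real (Suc n) > 0"
      by simp
    obtain g where "near_minimal_path X x y (1 / real (Suc n)) g"
      using near_minimal_path_exists[OF X(1) x y pos] by blast
    note g = near_minimal_pathD[OF this]
    have len: "dist x (g s) + dist (g s) (g t) + dist (g t) y < l + 1 / real (Suc n)"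
      if "0 \<le> s" "s \<le> t" "t \<le> 1" for s t
      using g(6)[OF that] by (simp add: l_def)
    have "\<forall>t\<in>{0..l}. \<exists>u\<in>{0..1}. dist x (g u) = t"
      using path_point_at_distance[OF g(1,3,4)] by (auto simp: l_def)
    then obtain \<tau> where \<tau>: "\<And>t. t \<in> {0..l} \<Longrightarrow> \<tau> t \<in> {0..1} \<and> dist x (g (\<tau> t)) = t"
      by metis
    define f where "f t = (if t \<in> {0..l} then g (\<tau> t) else x)" for t
    \<comment> \<open>The choice \<open>\<tau>\<close> need not be monotone: the estimate uses only the order of the two parameters on the path.\<close>
    have half: "dist (f s) (f t) \<le> \<bar>s - t\<bar> + 1 / real (Suc n)"
      if st: "s \<in> {0..l}" "t \<in> {0..l}" and le: "\<tau> s \<le> \<tau> t" for s t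
    proof -
      have "l \<le> t + dist (g (\<tau> t)) y"
        using dist_triangle[of x y "g (\<tau> t)"] \<tau>[OF st(2)] by (simp add: l_def)
      moreover have "s + dist (g (\<tau> s)) (g (\<tau> t)) + dist (g (\<tau> t)) y < l + 1 / real (Suc n)"
        using len[of "\<tau> s" "\<tau> t"] \<tau>[OF st(1)] \<tau>[OF st(2)] le by simp
      ultimately show ?thesis
        using st by (simp add: f_def)
    qed
    have "P n f"
      unfolding P_def
    proof (intro conjI ballI allI)
      show "f t \<in> cball x l \<inter> X" for t
        using \<tau>[of t] g(2) x l by (auto simp: f_def path_image_def)
      show "dist x (f t) = t" if "t \<in> {0..l}" for t
        using \<tau>[OF that] that by (simp add: f_def)
      show "dist (f t) y \<le> l - t + 1 / real (Suc n)" if "t \<in> {0..l}" for t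
        using \<tau>[OF that] len[of "\<tau> t" "\<tau> t"] that by (simp add: f_def)
      show "dist (f s) (f t) \<le> \<bar>s - t\<bar> + 1 / real (Suc n)" if "s \<in> {0..l}" "t \<in> {0..l}" for s t
        using half[of s t] half[of t s] that by (cases "\<tau> s \<le> \<tau> t") (auto simp: dist_commute abs_minus_commute)
    qed
    then show ?thesis
      by blast
  qed
  then obtain f where f: "\<And>n. P n (f n)"
    by metis
  have "compact (cball x l \<inter> X)"
    using X x by (simp add: proper_on_def)
  then obtain \<sigma> where \<sigma>: "\<And>t. \<sigma> t \<in> cball x l \<inter> X"
    and cluster: "\<And>F e N. finite F \<Longrightarrow> e > 0 \<Longrightarrow> \<exists>n\<ge>N. \<forall>t\<in>F. dist (f n t) (\<sigma> t) < e"
    using pointwise_cluster_function[of "\<lambda>_. cball x l \<inter> X" f] f unfolding P_def by metis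
  have approx: "\<exists>n. 1 / real (Suc n) < e \<and> (\<forall>t\<in>F. dist (f n t) (\<sigma> t) < e)" if "finite F" "e > 0" for F e
  proof -
    obtain N where N: "1 / real (Suc N) < e"
      using nat_approx_posE[OF \<open>e > 0\<close>] by metis
    obtain n where n: "n \<ge> N" "\<forall>t\<in>F. dist (f n t) (\<sigma> t) < e"
      using cluster[OF \<open>finite F\<close> \<open>e > 0\<close>] by blast
    have "1 / real (Suc n) \<le> 1 / real (Suc N)"
      using n by (simp add: frac_le)
    then show ?thesis
      using N n by (intro exI[of _ n]) auto
  qed
  have dx: "dist x (\<sigma> t) = t" if t: "t \<in> {0..l}" for t
  proof -
    have "\<bar>dist x (\<sigma> t) - t\<bar> \<le> e" if "e > 0" for e
    proof -
      obtain n where n: "dist (f n t) (\<sigma> t) < e"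
        using approx[of "{t}" e] \<open>e > 0\<close> by auto
      have "dist x (f n t) = t"
        using f[of n] t by (simp add: P_def)
      then show ?thesis
        using n dist_triangle[of x "\<sigma> t" "f n t"] dist_triangle[of x "f n t" "\<sigma> t"]
        by (simp add: dist_commute)
    qed
    then show ?thesis
      using field_le_epsilon[of "\<bar>dist x (\<sigma> t) - t\<bar>" 0] by simp
  qed
  have upper: "dist (\<sigma> s) (\<sigma> t) \<le> \<bar>s - t\<bar>" if st: "s \<in> {0..l}" "t \<in> {0..l}" for s t
  proof (rule field_le_epsilon)
    fix e :: real assume "e > 0"
    then obtain n where n: "1 / real (Suc n) < e / 3" "\<forall>u\<in>{s, t}. dist (f n u) (\<sigma> u) < e / 3"
      using approx[of "{s, t}" "e / 3"] by auto
    have "dist (f n s) (f n t) \<le> \<bar>s - t\<bar> + 1 / real (Suc n)"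
      using f[of n] st by (simp add: P_def)
    then show "dist (\<sigma> s) (\<sigma> t) \<le> \<bar>s - t\<bar> + e"
      using n dist_triangle[of "\<sigma> s" "\<sigma> t" "f n s"] dist_triangle[of "f n s" "\<sigma> t" "f n t"]
        dist_commute[of "f n s" "\<sigma> s"] by simp
  qed
  have "dist (\<sigma> s) (\<sigma> t) = \<bar>s - t\<bar>" if st: "s \<in> {0..l}" "t \<in> {0..l}" for s t
    using upper[OF st] dx[OF st(1)] dx[OF st(2)]
      dist_triangle[of x "\<sigma> s" "\<sigma> t"] dist_triangle[of x "\<sigma> t" "\<sigma> s"] by (simp add: dist_commute)
  moreover have "x = \<sigma> 0"
    using dx[of 0] l by simp
  moreover have "dist (\<sigma> l) y \<le> 0"
  proof (rule field_le_epsilon)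
    fix e :: real assume "e > 0"
    then obtain n where n: "1 / real (Suc n) < e / 2" "dist (f n l) (\<sigma> l) < e / 2"
      using approx[of "{l}" "e / 2"] by auto
    have "\<forall>t\<in>{0..l}. dist (f n t) y \<le> l - t + 1 / real (Suc n)"
      using f[of n] unfolding P_def by blast
    from bspec[OF this, of l] have "dist (f n l) y \<le> 1 / real (Suc n)"
      using l by simp
    then show "dist (\<sigma> l) y \<le> 0 + e"
      using n dist_triangle[of "\<sigma> l" y "f n l"] by (simp add: dist_commute)
  qed
  ultimately show ?thesis
    using \<sigma> by (intro exI[of _ \<sigma>]) (auto simp: geodesic_segment_def l_def)
qed

text \<open>The cluster property in the conclusion, at finitely many times and along arbitrarily late segments,
is what later proofs use to identify the origin and the end of the limit ray.\<close>

theorem geodesic_segments_cluster_ray: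
  assumes X: "proper_on X" and a: "a \<in> X"
    and \<sigma>: "\<And>n. geodesic_segment X (\<sigma> n) (l n)" and l: "filterlim l at_top sequentially"
    and base: "\<And>n. dist a (\<sigma> n 0) \<le> D"
  shows "\<exists>r. geodesic_ray X r \<and>
    (\<forall>F e N. finite F \<longrightarrow> F \<subseteq> {0..} \<longrightarrow> e > 0 \<longrightarrow>
      (\<exists>n\<ge>N. \<forall>t\<in>F. t \<le> l n \<and> dist (\<sigma> n t) (r t) < e))"
proof -
  \<comment> \<open>Beyond the segment the value \<open>a\<close> is a placeholder; it is irrelevant in the limit because the lengths tend to infinity.\<close>
  define f where "f n t = (if t \<in> {0..l n} then \<sigma> n t else a)" for n t
  have "D \<ge> 0"
    using base[of 0] zero_le_dist order_trans by blast
  have "f n t \<in> cball a (D + \<bar>t\<bar>) \<inter> X" for n t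
  proof (cases "t \<in> {0..l n}")
    case True
    then have "dist (\<sigma> n 0) (\<sigma> n t) = t" "\<sigma> n t \<in> X"
      using \<sigma>[of n] by (auto simp: geodesic_segment_def)
    then show ?thesis
      using True base[of n] dist_triangle[of a "\<sigma> n t" "\<sigma> n 0"] by (simp add: f_def)
  next
    case False
    then show ?thesis
      using a \<open>D \<ge> 0\<close> by (auto simp: f_def)
  qed
  moreover have "compact (cball a (D + \<bar>t\<bar>) \<inter> X)" for t
    using X a by (simp add: proper_on_def)
  ultimately obtain r where r: "\<And>t. r t \<in> cball a (D + \<bar>t\<bar>) \<inter> X"
    and cluster: "\<And>F e N. finite F \<Longrightarrow> e > 0 \<Longrightarrow> \<exists>n\<ge>N. \<forall>t\<in>F. dist (f n t) (r t) < e"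
    using pointwise_cluster_function[of "\<lambda>t. cball a (D + \<bar>t\<bar>) \<inter> X" f] by metis
  have near: "\<exists>n\<ge>N. \<forall>t\<in>F. t \<le> l n \<and> dist (\<sigma> n t) (r t) < e"
    if "finite F" "F \<subseteq> {0..}" "e > 0" for F e N
  proof -
    have "eventually (\<lambda>n. \<forall>t\<in>F. t \<le> l n) sequentially"
      using that(1) l by (auto simp: eventually_ball_finite filterlim_at_top)
    then obtain N' where N': "\<And>n. n \<ge> N' \<Longrightarrow> \<forall>t\<in>F. t \<le> l n"
      by (auto simp: eventually_sequentially)
    obtain n where "n \<ge> max N N'" "\<forall>t\<in>F. dist (f n t) (r t) < e"
      using cluster[OF \<open>finite F\<close> \<open>e > 0\<close>] by blast
    then show ?thesis
      using N'[of n] that(2) by (intro exI[of _ n]) (auto simp: f_def subset_iff)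
  qed
  have "dist (r s) (r t) = \<bar>s - t\<bar>" if st: "s \<ge> 0" "t \<ge> 0" for s t
  proof -
    have "\<bar>dist (r s) (r t) - \<bar>s - t\<bar>\<bar> \<le> e" if "e > 0" for e
    proof -
      obtain n where n: "s \<le> l n" "t \<le> l n" "dist (\<sigma> n s) (r s) < e / 2" "dist (\<sigma> n t) (r t) < e / 2"
        using near[of "{s, t}" "e / 2"] st \<open>e > 0\<close> by auto
      then have "dist (\<sigma> n s) (\<sigma> n t) = \<bar>s - t\<bar>"
        using \<sigma>[of n] st by (simp add: geodesic_segment_def)
      then show ?thesis
        using n dist_triangle[of "r s" "r t" "\<sigma> n s"] dist_triangle[of "\<sigma> n s" "r t" "\<sigma> n t"]
          dist_triangle[of "\<sigma> n s" "\<sigma> n t" "r s"] dist_triangle[of "r s" "\<sigma> n t" "r t"]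
          dist_commute[of "r s" "\<sigma> n s"] dist_commute[of "r t" "\<sigma> n t"] by linarith
    qed
    then show ?thesis
      using field_le_epsilon[of "\<bar>dist (r s) (r t) - \<bar>s - t\<bar>\<bar>" 0] by simp
  qed
  then have "geodesic_ray X r"
    using r by (auto simp: geodesic_ray_def)
  with near show ?thesis
    by blast
qed

section \<open>Covering spaces of metric spaces\<close>

text \<open>The isometric embedding of a metric space into the normed space of bounded continuous functions;
subtracting the distance from an arbitrary base point makes the functions bounded. Along this
embedding, path lifting, monodromy and the homotopy of paths in simply connected sets carry over
from subsets of normed spaces to metric spaces.\<close>

definition kuratowski :: "'a::metric_space \<Rightarrow> 'a \<Rightarrow>\<^sub>C real" where
  "kuratowski x = Bcontfun (\<lambda>y. dist x y - dist undefined y)"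

lemma kuratowski_apply: "apply_bcontfun (kuratowski x) y = dist x y - dist undefined y"
proof -
  have "\<bar>dist x y - dist undefined y\<bar> \<le> dist x undefined" for y
    using dist_triangle[of x y undefined] dist_triangle[of undefined y x] by (simp add: dist_commute)
  then have "(\<lambda>y. dist x y - dist undefined y) \<in> bcontfun"
    unfolding bcontfun_def bounded_iff by (auto intro!: continuous_intros)
  then show ?thesis
    by (simp add: kuratowski_def Bcontfun_inverse)
qed

lemma dist_kuratowski: "dist (kuratowski x) (kuratowski y) = dist x y"
proof (rule antisym)
  show "dist (kuratowski x) (kuratowski y) \<le> dist x y"
    using dist_triangle[of x _ y] dist_triangle[of y _ x]
    by (intro dist_bound) (simp add: kuratowski_apply dist_real_def abs_le_iff dist_commute algebra_simps)
  show "dist x y \<le> dist (kuratowski x) (kuratowski y)"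
    using dist_bounded[of "kuratowski x" y "kuratowski y"] by (simp add: kuratowski_apply dist_real_def)
qed

lemma inj_kuratowski: "inj kuratowski"
  by (rule injI) (metis dist_kuratowski dist_eq_0_iff)

definition kuratowski_inv :: "('a::metric_space \<Rightarrow>\<^sub>C real) \<Rightarrow> 'a" where
  "kuratowski_inv = inv_into UNIV kuratowski"

lemma kuratowski_inv_apply [simp]: "kuratowski_inv (kuratowski x) = x"
  by (simp add: kuratowski_inv_def inv_into_f_f[OF inj_kuratowski])

lemma kuratowski_inv_comp [simp]: "kuratowski_inv \<circ> kuratowski = id"
  by (simp add: fun_eq_iff)

lemma homeomorphism_kuratowski: "homeomorphism S (kuratowski ` S) kuratowski kuratowski_inv"
proof (rule homeomorphismI)
  show "continuous_on S kuratowski"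
    unfolding continuous_on_iff dist_kuratowski by blast
  show "continuous_on (kuratowski ` S) kuratowski_inv"
    unfolding continuous_on_iff by (auto simp: kuratowski_inv_apply dist_kuratowski)
qed (auto simp: kuratowski_inv_apply)

text \<open>Evenly covered sets and their sheets are carried along both homeomorphisms.\<close>

lemma covering_space_homeomorphism:
  assumes cov: "covering_space C p S"
    and f: "homeomorphism C C' f f'" and g: "homeomorphism S S' g g'"
  shows "covering_space C' (g \<circ> p \<circ> f') S'"
proof
  have f_simps: "f ` C = C'" "f' ` C' = C" "\<And>x. x \<in> C \<Longrightarrow> f' (f x) = x" "\<And>x. x \<in> C' \<Longrightarrow> f (f' x) = x"
    and g_simps: "g ` S = S'" "g' ` S' = S" "\<And>x. x \<in> S \<Longrightarrow> g' (g x) = x" "\<And>x. x \<in> S' \<Longrightarrow> g (g' x) = x"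
    and cont: "continuous_on C' f'" "continuous_on S g"
    using f g by (auto simp: homeomorphism_def)
  have p: "continuous_on C p" "p ` C = S"
    using cov by (auto simp: covering_space_def)
  show "continuous_on C' (g \<circ> p \<circ> f')"
    using cont p f_simps by (intro continuous_on_compose) auto
  show "(g \<circ> p \<circ> f') ` C' = S'"
    using p(2) f_simps(2) g_simps(1) by (simp only: image_comp[symmetric])
  show "\<exists>T. x \<in> T \<and> openin (top_of_set S') T \<and>
      (\<exists>v. \<Union>v = C' \<inter> (g \<circ> p \<circ> f') -` T \<and> (\<forall>u\<in>v. openin (top_of_set C') u) \<and>
        pairwise disjnt v \<and> (\<forall>u\<in>v. \<exists>q. homeomorphism u T (g \<circ> p \<circ> f') q))" if x: "x \<in> S'" for x
  proof -
    have "g' x \<in> S"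
      using x g_simps by auto
    then obtain T v where T: "g' x \<in> T" "openin (top_of_set S) T"
      and v: "\<Union>v = C \<inter> p -` T" "\<And>u. u \<in> v \<Longrightarrow> openin (top_of_set C) u" "pairwise disjnt v"
        "\<And>u. u \<in> v \<Longrightarrow> \<exists>q. homeomorphism u T p q"
      using cov unfolding covering_space_def by metis
    have TS: "T \<subseteq> S"
      using T by (simp add: openin_imp_subset)
    have uC: "u \<subseteq> C" if "u \<in> v" for u
      using v(2)[OF that] by (simp add: openin_imp_subset)
    have inj: "inj_on f C"
      using f_simps by (metis inj_onI)
    show ?thesis
    proof (intro exI[of _ "g ` T"] exI[of _ "(`) f ` v"] conjI ballI)
      show "x \<in> g ` T"
        using T g_simps x by (metis imageI)
      show "openin (top_of_set S') (g ` T)"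
        using g T(2) by (rule homeomorphism_imp_open_map)
      have "f ` (\<Union>v) = C' \<inter> (g \<circ> p \<circ> f') -` (g ` T)"
      proof (intro equalityI subsetI)
        fix y assume "y \<in> f ` (\<Union>v)"
        then show "y \<in> C' \<inter> (g \<circ> p \<circ> f') -` (g ` T)"
          using v(1) f_simps by auto
      next
        fix y assume y: "y \<in> C' \<inter> (g \<circ> p \<circ> f') -` (g ` T)"
        then obtain t where t: "t \<in> T" "g (p (f' y)) = g t"
          by auto
        have "p (f' y) \<in> S"
          using y p f_simps by blast
        then have "p (f' y) = t"
          using t g_simps TS by (metis subsetD)
        then have "f' y \<in> \<Union>v"
          using v(1) y t f_simps by auto
        then show "y \<in> f ` (\<Union>v)"
          using y f_simps by (metis IntD1 imageI)
      qed
      then show "\<Union> ((`) f ` v) = C' \<inter> (g \<circ> p \<circ> f') -` (g ` T)"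
        by blast
      show "openin (top_of_set C') u" if u: "u \<in> (`) f ` v" for u
        using that v(2) homeomorphism_imp_open_map[OF f] by auto
      show "pairwise disjnt ((`) f ` v)"
      proof (rule pairwiseI)
        fix a b assume "a \<in> (`) f ` v" "b \<in> (`) f ` v" "a \<noteq> b"
        then obtain a' b' where ab: "a' \<in> v" "b' \<in> v" "a = f ` a'" "b = f ` b'" "a' \<noteq> b'"
          by blast
        then have "a' \<inter> b' = {}"
          using v(3) by (auto simp: pairwise_def disjnt_def)
        then show "disjnt a b"
          unfolding disjnt_def ab(3,4) using inj_on_image_Int[OF inj uC[OF ab(1)] uC[OF ab(2)]] by simp
      qed
      show "\<exists>q. homeomorphism u (g ` T) (g \<circ> p \<circ> f') q" if u: "u \<in> (`) f ` v" for u
      proof -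
        obtain u' where u': "u' \<in> v" "u = f ` u'"
          using u by blast
        obtain q where q: "homeomorphism u' T p q"
          using v(4) u' by blast
        have "u \<subseteq> C'"
          using u' uC[OF u'(1)] f_simps(1) by blast
        then have "homeomorphism u' u f f'"
          by (rule homeomorphism_of_subsets[OF f uC[OF u'(1)]]) (simp add: u'(2))
        then have f'u: "homeomorphism u u' f' f"
          by (rule homeomorphism_symD)
        have "g ` T \<subseteq> S'"
          using TS g_simps(1) by blast
        then have gT: "homeomorphism T (g ` T) g g'"
          by (rule homeomorphism_of_subsets[OF g TS]) simp
        show ?thesis
          using homeomorphism_compose[OF homeomorphism_compose[OF f'u q] gT] by (auto simp: comp_assoc)
      qed
    qed
  qed
qed

lemma covering_space_kuratowski:
  fixes p :: "'b::metric_space \<Rightarrow> 'a::metric_space"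
  assumes "covering_space C p S"
  shows "covering_space (kuratowski ` C) (kuratowski \<circ> p \<circ> kuratowski_inv) (kuratowski ` S)"
  using assms homeomorphism_kuratowski homeomorphism_kuratowski by (rule covering_space_homeomorphism)

lemma path_kuratowski_iff: "path (kuratowski \<circ> g) \<longleftrightarrow> path g"
  unfolding path_def by (simp add: continuous_on_iff dist_kuratowski)

lemma path_inv_kuratowski:
  fixes h :: "real \<Rightarrow> 'a::metric_space \<Rightarrow>\<^sub>C real"
  assumes "path h" "path_image h \<subseteq> range kuratowski"
  shows "path (kuratowski_inv \<circ> h)"
proof -
  have "continuous_on (range kuratowski) (kuratowski_inv :: _ \<Rightarrow> 'a)"
    using homeomorphism_kuratowski[of "UNIV :: 'a set"] by (simp add: homeomorphism_def)
  then show ?thesis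
    using assms by (intro path_continuous_image) (auto intro: continuous_on_subset)
qed

theorem metric_covering_space_lift_path:
  fixes p :: "'b::metric_space \<Rightarrow> 'a::metric_space"
  assumes cov: "covering_space C p S" and a: "a \<in> C"
    and g: "path g" "path_image g \<subseteq> S" "pathstart g = p a"
  obtains h where "path h" "path_image h \<subseteq> C" "pathstart h = a" "\<And>t. t \<in> {0..1} \<Longrightarrow> p (h t) = g t"
proof -
  have "path (kuratowski \<circ> g)" "path_image (kuratowski \<circ> g) \<subseteq> kuratowski ` S"
    using g by (auto simp: path_kuratowski_iff path_image_compose)
  moreover have "pathstart (kuratowski \<circ> g) = (kuratowski \<circ> p \<circ> kuratowski_inv) (kuratowski a)"
    using g by (simp add: pathstart_compose kuratowski_inv_apply)
  ultimately obtain h where h: "path h" "path_image h \<subseteq> kuratowski ` C" "pathstart h = kuratowski a"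
    "\<And>t. t \<in> {0..1} \<Longrightarrow> (kuratowski \<circ> p \<circ> kuratowski_inv) (h t) = (kuratowski \<circ> g) t"
    using covering_space_lift_path_strong[OF covering_space_kuratowski[OF cov], of "kuratowski a" "kuratowski \<circ> g"] a
    by blast
  show thesis
  proof (rule that[of "kuratowski_inv \<circ> h"])
    show "path (kuratowski_inv \<circ> h)"
      using h by (intro path_inv_kuratowski) auto
    show "path_image (kuratowski_inv \<circ> h) \<subseteq> C"
      using image_mono[OF h(2), of "kuratowski_inv"]
      by (simp add: path_image_compose image_image kuratowski_inv_apply)
    show "pathstart (kuratowski_inv \<circ> h) = a"
      using h by (simp add: pathstart_compose kuratowski_inv_apply)
    show "p ((kuratowski_inv \<circ> h) t) = g t" if "t \<in> {0..1}" for t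
      using h(4)[OF that] by (simp add: inj_eq[OF inj_kuratowski])
  qed
qed

theorem metric_covering_space_monodromy:
  fixes p :: "'b::metric_space \<Rightarrow> 'a::metric_space"
  assumes cov: "covering_space C p S"
    and hom: "homotopic_paths S g1 g2"
    and h1: "path h1" "path_image h1 \<subseteq> C" "\<And>t. t \<in> {0..1} \<Longrightarrow> p (h1 t) = g1 t"
    and h2: "path h2" "path_image h2 \<subseteq> C" "\<And>t. t \<in> {0..1} \<Longrightarrow> p (h2 t) = g2 t"
    and start: "pathstart h1 = pathstart h2"
  shows "pathfinish h1 = pathfinish h2"
proof -
  let ?k = "kuratowski :: 'a \<Rightarrow> _" and ?l = "kuratowski :: 'b \<Rightarrow> _"
  have hom': "homotopic_paths (?k ` S) (?k \<circ> g1) (?k \<circ> g2)"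
    using hom homeomorphism_kuratowski[of S]
    by (intro homotopic_paths_continuous_image) (auto simp: homeomorphism_def)
  have "pathfinish (?l \<circ> h1) = pathfinish (?l \<circ> h2)"
    using h1 h2 homotopic_paths_imp_path[OF hom] homotopic_paths_imp_subset[OF hom] start
    by (intro covering_space_monodromy[OF covering_space_kuratowski[OF cov], where ?g1.0 = "?k \<circ> g1" and ?g2.0 = "?k \<circ> g2"] hom')
       (auto simp: path_kuratowski_iff path_image_compose pathstart_compose kuratowski_inv_apply)
  then show ?thesis
    by (simp add: pathfinish_compose inj_eq[OF inj_kuratowski])
qed

theorem metric_simply_connected_homotopic_paths:
  fixes X :: "'a::metric_space set"
  assumes X: "simply_connected X"
    and g: "path g" "path_image g \<subseteq> X" and h: "path h" "path_image h \<subseteq> X"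
    and ends: "pathstart g = pathstart h" "pathfinish g = pathfinish h"
  shows "homotopic_paths X g h"
proof -
  have "simply_connected (kuratowski ` X)"
    using X homeomorphism_kuratowski[of X] homeomorphic_simply_connected homeomorphic_def by metis
  moreover have "path (kuratowski \<circ> g)" "path_image (kuratowski \<circ> g) \<subseteq> kuratowski ` X"
    "path (kuratowski \<circ> h)" "path_image (kuratowski \<circ> h) \<subseteq> kuratowski ` X"
    "pathstart (kuratowski \<circ> h) = pathstart (kuratowski \<circ> g)"
    "pathfinish (kuratowski \<circ> h) = pathfinish (kuratowski \<circ> g)"
    using g h ends by (auto simp: path_kuratowski_iff path_image_compose pathstart_compose pathfinish_compose)
  ultimately have "homotopic_paths (kuratowski ` X) (kuratowski \<circ> g) (kuratowski \<circ> h)"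
    unfolding simply_connected_eq_homotopic_paths by blast
  then have "homotopic_paths X (kuratowski_inv \<circ> (kuratowski \<circ> g)) (kuratowski_inv \<circ> (kuratowski \<circ> h))"
    using homeomorphism_kuratowski[of X]
    by (intro homotopic_paths_continuous_image[where S = "kuratowski ` X"]) (auto simp: homeomorphism_def)
  then show ?thesis
    by (simp add: comp_assoc[symmetric] kuratowski_inv_comp)
qed

section \<open>Local isometries that are coverings\<close>

text \<open>For a fine enough subdivision, consecutive points of the path lie in a common ball on which \<open>p\<close> is
isometric (Lebesgue number and uniform continuity).\<close>

lemma local_isometry_path_mesh:
  assumes p: "local_isometry_on X p S" and h: "path h" "path_image h \<subseteq> X"
  shows "\<exists>n>0. \<forall>i<n. dist (p (h (real i / real n))) (p (h (real (Suc i) / real n))) =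
    dist (h (real i / real n)) (h (real (Suc i) / real n))"
proof -
  obtain \<eta> where \<eta>: "\<And>x. x \<in> X \<Longrightarrow> \<eta> x > 0 \<and>
      (\<forall>u \<in> ball x (\<eta> x) \<inter> X. \<forall>v \<in> ball x (\<eta> x) \<inter> X. dist (p u) (p v) = dist u v)"
    using p unfolding local_isometry_on_def by metis
  obtain e where e: "e > 0" "\<And>x. x \<in> path_image h \<Longrightarrow> \<exists>G\<in>(\<lambda>x. ball x (\<eta> x)) ` X. ball x e \<subseteq> G"
  proof (rule Heine_Borel_lemma[of "path_image h" "(\<lambda>x. ball x (\<eta> x)) ` X"])
    show "compact (path_image h)"
      using h by (rule_tac compact_path_image)
    show "path_image h \<subseteq> \<Union> ((\<lambda>x. ball x (\<eta> x)) ` X)"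
      using h \<eta> by force
  qed auto
  have "uniformly_continuous_on {0..1} h"
    using h by (auto simp: path_def intro: compact_uniformly_continuous)
  then obtain d where d: "d > 0" "\<And>s t. s \<in> {0..1} \<Longrightarrow> t \<in> {0..1} \<Longrightarrow> dist t s < d \<Longrightarrow> dist (h t) (h s) < e"
    using e unfolding uniformly_continuous_on_def by metis
  obtain m where m: "1 / real (Suc m) < d"
    using nat_approx_posE[OF d(1)] by metis
  define n where "n = Suc m"
  have "dist (p (h (real i / real n))) (p (h (real (Suc i) / real n))) =
      dist (h (real i / real n)) (h (real (Suc i) / real n))" if "i < n" for i
  proof -
    let ?s = "real i / real n" and ?t = "real (Suc i) / real n"
    have st: "?s \<in> {0..1}" "?t \<in> {0..1}"
      using that by (auto simp: n_def)
    have "?t - ?s = 1 / real n"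
      by (simp add: diff_divide_distrib[symmetric])
    then have "dist ?t ?s = 1 / real n"
      by (simp add: dist_real_def)
    then have *: "dist (h ?s) (h ?t) < e"
      using d(2)[OF st] m by (simp add: n_def dist_commute)
    have "h ?s \<in> path_image h" "h ?t \<in> path_image h"
      using st by (auto simp: path_image_def)
    then obtain x where x: "x \<in> X" "ball (h ?s) e \<subseteq> ball x (\<eta> x)" and "h ?s \<in> X" "h ?t \<in> X"
      using e(2)[of "h ?s"] h(2) by blast
    moreover have "h ?s \<in> ball (h ?s) e" "h ?t \<in> ball (h ?s) e"
      using * e by auto
    ultimately show ?thesis
      using \<eta>[of x] by blast
  qed
  then show ?thesis
    by (intro exI[of _ n]) (simp add: n_def)
qed

lemma dist_path_le_sum:
  fixes h :: "real \<Rightarrow> 'a::metric_space"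
  assumes "n > 0"
  shows "dist (h 0) (h 1) \<le> (\<Sum>i<n. dist (h (real i / real n)) (h (real (Suc i) / real n)))"
proof -
  have "dist (h (real 0 / real n)) (h (real m / real n))
      \<le> (\<Sum>i<m. dist (h (real i / real n)) (h (real (Suc i) / real n)))" for m
  proof (induction m)
    case (Suc m)
    then show ?case
      using dist_triangle[of "h (real 0 / real n)" "h (real (Suc m) / real n)" "h (real m / real n)"] by simp
  qed simp
  from this[of n] show ?thesis
    using assms by simp
qed

lemma local_isometry_nonexpanding:
  assumes X: "length_metric_on X" and p: "local_isometry_on X p S" and "x \<in> X" "y \<in> X"
  shows "dist (p x) (p y) \<le> dist x y"
proof (rule field_le_epsilon)
  fix e :: real assume "e > 0"
  then obtain h where "near_minimal_path X x y e h"
    using near_minimal_path_exists[OF X assms(3,4)] by blast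
  note h = near_minimal_pathD[OF this]
  obtain n where n: "n > 0" "\<And>i. i < n \<Longrightarrow> dist (p (h (real i / real n))) (p (h (real (Suc i) / real n))) =
      dist (h (real i / real n)) (h (real (Suc i) / real n))"
    using local_isometry_path_mesh[OF p h(1,2)] by blast
  have "dist (p (h 0)) (p (h 1)) \<le> (\<Sum>i<n. dist (p (h (real i / real n))) (p (h (real (Suc i) / real n))))"
    using dist_path_le_sum[OF n(1), of "p \<circ> h"] by simp
  also have "\<dots> = (\<Sum>i<n. dist (h (real i / real n)) (h (real (Suc i) / real n)))"
    using n(2) by (intro sum.cong) auto
  also have "\<dots> < dist x y + e"
    by (rule h(5)[OF n(1)])
  finally show "dist (p x) (p y) \<le> dist x y + e"
    using h(3,4) by (simp add: pathstart_def pathfinish_def)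
qed

text \<open>Inscribed polygons of a path and of its lift have equal length once the subdivision is fine.
The hypothesis concerns all \<open>n\<close> because that subdivision depends on the lift.\<close>

lemma lift_path_displacement:
  assumes cov: "covering_space X p S" and p: "local_isometry_on X p S" and x: "x \<in> X"
    and g: "path g" "path_image g \<subseteq> S" "pathstart g = p x"
    and len: "\<And>n. n > 0 \<Longrightarrow> (\<Sum>i<n. dist (g (real i / real n)) (g (real (Suc i) / real n))) < b"
  obtains h where "path h" "path_image h \<subseteq> X" "pathstart h = x" "\<And>t. t \<in> {0..1} \<Longrightarrow> p (h t) = g t"
    "dist x (pathfinish h) < b"
proof -
  obtain h where h: "path h" "path_image h \<subseteq> X" "pathstart h = x" "\<And>t. t \<in> {0..1} \<Longrightarrow> p (h t) = g t"
    using metric_covering_space_lift_path[OF cov x g] by blast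
  obtain n where n: "n > 0" "\<And>i. i < n \<Longrightarrow> dist (p (h (real i / real n))) (p (h (real (Suc i) / real n))) =
      dist (h (real i / real n)) (h (real (Suc i) / real n))"
    using local_isometry_path_mesh[OF p h(1,2)] by blast
  have "dist (h 0) (h 1) \<le> (\<Sum>i<n. dist (h (real i / real n)) (h (real (Suc i) / real n)))"
    using n(1) by (rule dist_path_le_sum)
  also have "\<dots> = (\<Sum>i<n. dist (p (h (real i / real n))) (p (h (real (Suc i) / real n))))"
    using n(2) by (intro sum.cong) auto
  also have "\<dots> = (\<Sum>i<n. dist (g (real i / real n)) (g (real (Suc i) / real n)))"
    by (intro sum.cong refl arg_cong2[where f = dist] h(4)) auto
  also have "\<dots> < b"
    by (rule len[OF n(1)])
  finally have "dist x (pathfinish h) < b"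
    using h(3) by (simp add: pathstart_def pathfinish_def)
  then show thesis
    using that h by blast
qed

lemma lift_near_minimal_path:
  assumes cov: "covering_space X p S" and p: "local_isometry_on X p S"
    and g: "near_minimal_path S (p x) y e g" and x: "x \<in> X"
  obtains h where "path h" "path_image h \<subseteq> X" "pathstart h = x" "\<And>t. t \<in> {0..1} \<Longrightarrow> p (h t) = g t"
    "p (pathfinish h) = y" "dist x (pathfinish h) < dist (p x) y + e"
proof -
  note gD = near_minimal_pathD[OF g]
  obtain h where h: "path h" "path_image h \<subseteq> X" "pathstart h = x" "\<And>t. t \<in> {0..1} \<Longrightarrow> p (h t) = g t"
    "dist x (pathfinish h) < dist (p x) y + e"
    using lift_path_displacement[OF cov p x gD(1-3,5)] by blast
  moreover have "p (pathfinish h) = y"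
    using h(4)[of 1] gD(4) by (simp add: pathfinish_def)
  ultimately show thesis
    using that by blast
qed

text \<open>An almost shortest path between two nearby points of a fibre projects into an evenly covered set.
It stays in one sheet by connectedness, and \<open>p\<close> is injective there.\<close>

lemma covering_space_fibre_separation:
  assumes S: "compact S" and X: "length_metric_on X"
    and cov: "covering_space X p S" and p: "local_isometry_on X p S"
  shows "\<exists>r>0. \<forall>v\<in>X. \<forall>w\<in>X. p v = p w \<longrightarrow> dist v w < r \<longrightarrow> v = w"
proof -
  define evenly where "evenly T \<longleftrightarrow> openin (top_of_set S) T \<and>
      (\<exists>\<V>. \<Union>\<V> = X \<inter> p -` T \<and> (\<forall>u\<in>\<V>. openin (top_of_set X) u) \<and> pairwise disjnt \<V> \<and>
        (\<forall>u\<in>\<V>. \<exists>q. homeomorphism u T p q))" for T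
  have "\<exists>T. open T \<and> y \<in> T \<and> evenly (S \<inter> T)" if y: "y \<in> S" for y
  proof -
    have "\<exists>T. y \<in> T \<and> evenly T"
      unfolding evenly_def using cov[unfolded covering_space_def] y by (elim conjE) (erule bspec)
    then obtain T where T: "y \<in> T" "evenly T"
      by blast
    then have "openin (top_of_set S) T"
      by (simp add: evenly_def)
    then obtain U where "open U" "T = S \<inter> U"
      by (metis openin_open)
    then show ?thesis
      using T by blast
  qed
  then obtain T where T: "\<And>y. y \<in> S \<Longrightarrow> open (T y) \<and> y \<in> T y \<and> evenly (S \<inter> T y)"
    by metis
  have "S \<subseteq> \<Union>(T ` S)" "\<And>G. G \<in> T ` S \<Longrightarrow> open G"
    using T by auto
  then obtain r where r: "r > 0" "\<And>y. y \<in> S \<Longrightarrow> \<exists>G\<in>T ` S. ball y r \<subseteq> G"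
    using Heine_Borel_lemma[OF S] by metis
  have "v = w" if vw: "v \<in> X" "w \<in> X" "p v = p w" "dist v w < r" for v w
  proof -
    have "r - dist v w > 0"
      using vw by simp
    then obtain h where "near_minimal_path X v w (r - dist v w) h"
      using near_minimal_path_exists[OF X vw(1,2)] by blast
    note h = near_minimal_pathD[OF this]
    have pX: "p ` X = S"
      using cov by (simp add: covering_space_def)
    then obtain y where y: "y \<in> S" "ball (p v) r \<subseteq> T y"
      using r(2) vw(1) by blast
    have "evenly (S \<inter> T y)"
      using T[OF y(1)] by simp
    then have "\<exists>\<V>. \<Union>\<V> = X \<inter> p -` (S \<inter> T y) \<and> (\<forall>u\<in>\<V>. openin (top_of_set X) u) \<and>
        pairwise disjnt \<V> \<and> (\<forall>u\<in>\<V>. \<exists>q. homeomorphism u (S \<inter> T y) p q)"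
      unfolding evenly_def by (elim conjE)
    then obtain \<V> where \<V>: "\<Union>\<V> = X \<inter> p -` (S \<inter> T y)" "\<And>u. u \<in> \<V> \<Longrightarrow> openin (top_of_set X) u"
      "pairwise disjnt \<V>" "\<And>u. u \<in> \<V> \<Longrightarrow> \<exists>q. homeomorphism u (S \<inter> T y) p q"
      by (elim exE conjE) (rule that, auto)
    have "path_image h \<subseteq> \<Union>\<V>"
    proof
      fix z assume "z \<in> path_image h"
      then obtain t where t: "t \<in> {0..1}" "z = h t"
        by (auto simp: path_image_def)
      have z: "z \<in> X"
        using h(2) \<open>z \<in> path_image h\<close> by blast
      have "dist v z + dist z w < r"
        using h(6)[of t t] t by auto
      then have "dist v z < r"
        using zero_le_dist[of z w] by linarith
      then have "dist (p v) (p z) < r"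
        using local_isometry_nonexpanding[OF X p vw(1) z] by simp
      then show "z \<in> \<Union>\<V>"
        using \<V>(1) y z pX by auto
    qed
    moreover have "v \<in> path_image h" "w \<in> path_image h"
      using h(3,4) by (metis pathstart_in_path_image pathfinish_in_path_image)+
    ultimately obtain u where u: "u \<in> \<V>" "v \<in> u"
      by blast
    define u' where "u' = \<Union>(\<V> - {u})"
    have "openin (top_of_set X) u" "openin (top_of_set X) u'"
      unfolding u'_def using \<V>(2) u by (auto intro: openin_Union)
    moreover have "openin (top_of_set (path_image h)) (path_image h \<inter> a)" if a: "openin (top_of_set X) a" for a
    proof -
      obtain A where "open A" "a = X \<inter> A"
        using a by (auto simp: openin_open)
      then have "path_image h \<inter> a = path_image h \<inter> A"
        using h(2) by blast
      with \<open>open A\<close> show ?thesis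
        by (simp add: openin_open_Int)
    qed
    ultimately have "openin (top_of_set (path_image h)) (path_image h \<inter> u)"
      "openin (top_of_set (path_image h)) (path_image h \<inter> u')"
      by blast+
    moreover have "u \<inter> u' = {}"
      using \<V>(3) u unfolding u'_def pairwise_def disjnt_def by blast
    moreover have "path_image h \<subseteq> u \<union> u'"
      using \<open>path_image h \<subseteq> \<Union>\<V>\<close> by (auto simp: u'_def)
    moreover have "connected (path_image h)"
      using h(1) by (rule connected_path_image)
    moreover have "path_image h \<inter> u \<noteq> {}"
      using \<open>v \<in> u\<close> \<open>v \<in> path_image h\<close> by blast
    ultimately have "path_image h \<inter> u' = {}"
      unfolding connected_openin by blast
    then have "w \<in> u"
      using \<open>w \<in> path_image h\<close> \<open>path_image h \<subseteq> u \<union> u'\<close> by blast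
    moreover obtain q where "homeomorphism u (S \<inter> T y) p q"
      using \<V>(4) u by blast
    ultimately show "v = w"
      using u vw by (metis homeomorphism_apply1)
  qed
  with r(1) show ?thesis
    by blast
qed

text \<open>A local isometry only has a radius for each point. A uniform radius comes from the
separation of fibres: a near-minimal path between \<open>p u\<close> and \<open>p v\<close> lifts to a path from \<open>u\<close> that ends
in the fibre of \<open>v\<close> and near \<open>v\<close>, hence at \<open>v\<close>.\<close>

theorem covering_uniform_isometry:
  assumes S: "compact S" "length_metric_on S" and X: "length_metric_on X"
    and cov: "covering_space X p S" and p: "local_isometry_on X p S"
  shows "\<exists>\<epsilon>>0. \<forall>x\<in>X. p ` (ball x \<epsilon> \<inter> X) = ball (p x) \<epsilon> \<inter> S \<and>
    (\<forall>u\<in>ball x \<epsilon> \<inter> X. \<forall>v\<in>ball x \<epsilon> \<inter> X. dist (p u) (p v) = dist u v)"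
proof -
  obtain r where r: "r > 0" "\<And>v w. v \<in> X \<Longrightarrow> w \<in> X \<Longrightarrow> p v = p w \<Longrightarrow> dist v w < r \<Longrightarrow> v = w"
    using covering_space_fibre_separation[OF S(1) X cov p] by blast
  \<comment> \<open>The lift from \<open>u\<close> ends within \<open>2\<epsilon> + 2\<epsilon> + \<epsilon>\<close> of \<open>v\<close>.\<close>
  define \<epsilon> where "\<epsilon> = r / 5"
  have \<epsilon>: "\<epsilon> > 0"
    using r by (simp add: \<epsilon>_def)
  have pX: "p z \<in> S" if "z \<in> X" for z
    using cov that by (auto simp: covering_space_def)
  have lift: "\<exists>v\<in>X. p v = y \<and> dist x v < dist (p x) y + e" if xy: "x \<in> X" "y \<in> S" "e > 0" for x y e
  proof -
    obtain g where g: "near_minimal_path S (p x) y e g"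
      using near_minimal_path_exists[OF S(2) pX[OF xy(1)] xy(2,3)] by blast
    obtain h where h: "path_image h \<subseteq> X" "p (pathfinish h) = y" "dist x (pathfinish h) < dist (p x) y + e"
      using lift_near_minimal_path[OF cov p g xy(1)] by metis
    then show ?thesis
      by (intro bexI[of _ "pathfinish h"]) auto
  qed
  have "p ` (ball x \<epsilon> \<inter> X) = ball (p x) \<epsilon> \<inter> S" if x: "x \<in> X" for x
  proof (intro equalityI subsetI)
    fix y assume "y \<in> p ` (ball x \<epsilon> \<inter> X)"
    then show "y \<in> ball (p x) \<epsilon> \<inter> S"
      using local_isometry_nonexpanding[OF X p x] pX by force
  next
    fix y assume y: "y \<in> ball (p x) \<epsilon> \<inter> S"
    then obtain v where "v \<in> X" "p v = y" "dist x v < dist (p x) y + (\<epsilon> - dist (p x) y)"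
      using lift[OF x, of y "\<epsilon> - dist (p x) y"] by auto
    then show "y \<in> p ` (ball x \<epsilon> \<inter> X)"
      by auto
  qed
  moreover have "dist (p u) (p v) = dist u v" if x: "x \<in> X" and u: "u \<in> ball x \<epsilon> \<inter> X" and v: "v \<in> ball x \<epsilon> \<inter> X" for x u v
  proof (rule antisym)
    show "dist (p u) (p v) \<le> dist u v"
      using local_isometry_nonexpanding[OF X p] u v by blast
    have uv: "dist u v < 2 * \<epsilon>"
      using u v dist_triangle[of u v x] by (simp add: dist_commute)
    show "dist u v \<le> dist (p u) (p v)"
    proof (rule field_le_epsilon)
      fix e :: real assume "e > 0"
      then obtain w where w: "w \<in> X" "p w = p v" "dist u w < dist (p u) (p v) + min e \<epsilon>"
        using lift[of u "p v" "min e \<epsilon>"] u v pX \<epsilon> by auto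
      have "dist (p u) (p v) \<le> dist u v"
        using local_isometry_nonexpanding[OF X p] u v by blast
      then have "dist w v < r"
        using w uv dist_triangle[of w v u] by (simp add: \<epsilon>_def dist_commute)
      then have "w = v"
        using r(2)[of w v] w v by simp
      then show "dist u v \<le> dist (p u) (p v) + e"
        using w by simp
    qed
  qed
  ultimately show ?thesis
    using \<epsilon> by blast
qed

lemma isometry_inverse:
  fixes p :: "'b::metric_space \<Rightarrow> 'a::metric_space"
  assumes im: "p ` A = B" and iso: "\<And>u v. u \<in> A \<Longrightarrow> v \<in> A \<Longrightarrow> dist (p u) (p v) = dist u v"
  obtains q where "q ` B = A" "\<And>x. x \<in> A \<Longrightarrow> q (p x) = x" "\<And>y. y \<in> B \<Longrightarrow> p (q y) = y"
    "\<And>y z. y \<in> B \<Longrightarrow> z \<in> B \<Longrightarrow> dist (q y) (q z) = dist y z"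
proof -
  have "inj_on p A"
    by (rule inj_onI) (metis iso dist_eq_0_iff)
  then have q: "inv_into A p (p x) = x" if "x \<in> A" for x
    using that by simp
  show thesis
  proof (rule that[of "inv_into A p"])
    show "inv_into A p ` B = A"
      using q by (auto simp: im[symmetric] image_image)
    show "dist (inv_into A p y) (inv_into A p z) = dist y z" if "y \<in> B" "z \<in> B" for y z
      using that q iso by (auto simp: im[symmetric])
  qed (use q im in auto)
qed

text \<open>Balls of the uniform radius are isometric to balls of the compact base, so the covering
space is uniformly locally compact.\<close>

theorem covering_proper:
  assumes S: "compact S" "length_metric_on S" and X: "length_metric_on X"
    and cov: "covering_space X p S" and p: "local_isometry_on X p S"
  shows "proper_on X"
proof -
  obtain \<epsilon> where \<epsilon>: "\<epsilon> > 0" and im: "\<And>x. x \<in> X \<Longrightarrow> p ` (ball x \<epsilon> \<inter> X) = ball (p x) \<epsilon> \<inter> S"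
    and iso: "\<And>x u v. x \<in> X \<Longrightarrow> u \<in> ball x \<epsilon> \<inter> X \<Longrightarrow> v \<in> ball x \<epsilon> \<inter> X \<Longrightarrow> dist (p u) (p v) = dist u v"
    using covering_uniform_isometry[OF S X cov p] by metis
  have "compact (cball x (\<epsilon> / 2) \<inter> X)" if x: "x \<in> X" for x
  proof -
    obtain q where qim: "q ` (ball (p x) \<epsilon> \<inter> S) = ball x \<epsilon> \<inter> X"
      and qp: "\<And>z. z \<in> ball x \<epsilon> \<inter> X \<Longrightarrow> q (p z) = z"
      and pq: "\<And>y. y \<in> ball (p x) \<epsilon> \<inter> S \<Longrightarrow> p (q y) = y"
      and qd: "\<And>y z. y \<in> ball (p x) \<epsilon> \<inter> S \<Longrightarrow> z \<in> ball (p x) \<epsilon> \<inter> S \<Longrightarrow> dist (q y) (q z) = dist y z"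
      using isometry_inverse[OF im[OF x] iso[OF x]] by metis
    have xb: "x \<in> ball x \<epsilon> \<inter> X"
      using x \<epsilon> by simp
    let ?B = "cball (p x) (\<epsilon> / 2) \<inter> S"
    have sub: "?B \<subseteq> ball (p x) \<epsilon> \<inter> S"
      using \<epsilon> by auto
    have "cball x (\<epsilon> / 2) \<inter> X = q ` ?B"
    proof (intro equalityI subsetI)
      fix z assume z: "z \<in> cball x (\<epsilon> / 2) \<inter> X"
      then have zb: "z \<in> ball x \<epsilon> \<inter> X"
        using \<epsilon> by auto
      then have "dist (p x) (p z) = dist x z" "p z \<in> S"
        using iso[OF x xb] im[OF x] by blast+
      then have "p z \<in> ?B"
        using z by auto
      then show "z \<in> q ` ?B"
        using qp[OF zb] by (metis imageI)
    next
      fix z assume "z \<in> q ` ?B"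
      then obtain y where y: "y \<in> ?B" "z = q y"
        by blast
      then have yb: "y \<in> ball (p x) \<epsilon> \<inter> S"
        using sub by blast
      have zb: "z \<in> ball x \<epsilon> \<inter> X"
        using qim yb y(2) by blast
      have "dist x z = dist (p x) y"
        using iso[OF x xb zb] pq[OF yb] y(2) by simp
      then show "z \<in> cball x (\<epsilon> / 2) \<inter> X"
        using y zb by auto
    qed
    moreover have "continuous_on ?B q"
      unfolding continuous_on_iff using qd sub by (metis subsetD)
    moreover have "compact ?B"
      using S by (simp add: closed_Int_compact)
    ultimately show ?thesis
      by (simp add: compact_continuous_image)
  qed
  then show ?thesis
    unfolding proper_on_def using length_space_proper[OF X, of "\<epsilon> / 2"] \<epsilon> by auto
qed

lemma covering_fibre_finite:
  assumes S: "compact S" "length_metric_on S" and X: "length_metric_on X"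
    and cov: "covering_space X p S" and p: "local_isometry_on X p S" and x: "x \<in> X"
  shows "finite {v \<in> X. p v = b \<and> dist x v \<le> R}"
proof -
  obtain r where r: "r > 0" "\<And>v w. v \<in> X \<Longrightarrow> w \<in> X \<Longrightarrow> p v = p w \<Longrightarrow> dist v w < r \<Longrightarrow> v = w"
    using covering_space_fibre_separation[OF S(1) X cov p] by blast
  let ?F = "{v \<in> X. p v = b \<and> dist x v \<le> R}"
  have "compact (cball x R \<inter> X)"
    using covering_proper[OF assms(1-5)] x by (simp add: proper_on_def)
  then obtain k where k: "finite k" "cball x R \<inter> X \<subseteq> (\<Union>z\<in>k. ball z (r / 2))"
    unfolding compact_eq_totally_bounded using r(1) by (metis half_gt_zero)
  then have "?F \<subseteq> (\<Union>z\<in>k. ball z (r / 2) \<inter> ?F)"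
    by auto
  moreover have "finite (ball z (r / 2) \<inter> ?F)" for z
  proof -
    have "v = w" if "v \<in> ball z (r / 2) \<inter> ?F" "w \<in> ball z (r / 2) \<inter> ?F" for v w
      using that r(2)[of v w] dist_triangle[of v w z] by (simp add: dist_commute)
    then have "ball z (r / 2) \<inter> ?F \<subseteq> {SOME v. v \<in> ball z (r / 2) \<inter> ?F}"
      by (metis (no_types, lifting) singletonI someI subsetI)
    then show ?thesis
      by (rule finite_subset) simp
  qed
  ultimately show ?thesis
    by (rule finite_subset[OF _ finite_UN_I[OF k(1)]])
qed

lemma covering_fibre_cobounded:
  assumes S: "compact S" "length_metric_on S"
    and cov: "covering_space X p S" and p: "local_isometry_on X p S" and b: "b \<in> S"
  shows "\<exists>R. \<forall>x\<in>X. \<exists>v\<in>X. p v = b \<and> dist x v \<le> R"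
proof -
  obtain D where D: "\<And>y. y \<in> S \<Longrightarrow> dist b y \<le> D"
    using compact_imp_bounded[OF S(1)] unfolding bounded_any_center[of S b] by blast
  have "\<exists>v\<in>X. p v = b \<and> dist x v \<le> D + 1" if x: "x \<in> X" for x
  proof -
    have px: "p x \<in> S"
      using cov x by (auto simp: covering_space_def)
    obtain g where g: "near_minimal_path S (p x) b 1 g"
      using near_minimal_path_exists[OF S(2) px b, of 1] by auto
    obtain h where h: "path_image h \<subseteq> X" "p (pathfinish h) = b" "dist x (pathfinish h) < dist (p x) b + 1"
      using lift_near_minimal_path[OF cov p g x] by metis
    then show ?thesis
      using D[OF px] by (intro bexI[of _ "pathfinish h"]) (auto simp: dist_commute)
  qed
  then show ?thesis
    by blast
qed

section \<open>Universal coverings and the word metric of the fundamental group\<close>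

text \<open>The comparison of \<open>X\<close> with \<open>\<pi>\<^sub>1(S)\<close> avoids deck transformations. Two points \<open>u\<close>, \<open>v\<close> of the fibre over
the base point determine an element of the fundamental group, the class of the projection of any
path from \<open>u\<close> to \<open>v\<close>. These elements multiply like differences.\<close>

locale compact_metric_covering =
  fixes S :: "'a::metric_space set" and X :: "'b::metric_space set" and p :: "'b \<Rightarrow> 'a"
  assumes compact_base: "compact S" and length_base: "length_metric_on S"
    and length_total: "length_metric_on X" and covering: "covering_space X p S"
    and local_isometry: "local_isometry_on X p S" and path_connected: "path_connected X"
    and simply_connected: "simply_connected X"
begin

lemma p_in: "x \<in> X \<Longrightarrow> p x \<in> S"
  using covering by (auto simp: covering_space_def)

lemma cont_p: "continuous_on X p"
  using covering by (simp add: covering_space_def)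

lemma proper: "proper_on X"
  by (intro covering_proper[OF compact_base length_base length_total covering local_isometry])

lemma path_between_exists:
  assumes "u \<in> X" "v \<in> X"
  shows "\<exists>\<gamma>. path \<gamma> \<and> path_image \<gamma> \<subseteq> X \<and> pathstart \<gamma> = u \<and> pathfinish \<gamma> = v"
  using path_connected assms unfolding path_connected_def by blast

definition fibre :: "'a \<Rightarrow> 'b set" where
  "fibre b = {v \<in> X. p v = b}"

definition loop_class :: "'b \<Rightarrow> 'b \<Rightarrow> (real \<Rightarrow> 'a) set" where
  "loop_class u v = path_class S (p \<circ>
     (SOME \<gamma>. path \<gamma> \<and> path_image \<gamma> \<subseteq> X \<and> pathstart \<gamma> = u \<and> pathfinish \<gamma> = v))"

lemma projected_loop:
  assumes "path \<gamma>" "path_image \<gamma> \<subseteq> X" "pathstart \<gamma> \<in> fibre b" "pathfinish \<gamma> \<in> fibre b"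
  shows "p \<circ> \<gamma> \<in> loops_at S b"
proof -
  have "path (p \<circ> \<gamma>)"
    using assms(1,2) continuous_on_subset[OF cont_p] by (intro path_continuous_image)
  moreover have "path_image (p \<circ> \<gamma>) \<subseteq> S"
    using assms(2) p_in by (auto simp: path_image_compose)
  ultimately show ?thesis
    using assms(3,4) by (simp add: loops_at_def fibre_def pathstart_compose pathfinish_compose)
qed

lemma loop_class_eq:
  assumes uv: "u \<in> fibre b" "v \<in> fibre b"
    and \<gamma>: "path \<gamma>" "path_image \<gamma> \<subseteq> X" "pathstart \<gamma> = u" "pathfinish \<gamma> = v"
  shows "loop_class u v = path_class S (p \<circ> \<gamma>)"
proof -
  define \<gamma>' where "\<gamma>' = (SOME \<gamma>. path \<gamma> \<and> path_image \<gamma> \<subseteq> X \<and> pathstart \<gamma> = u \<and> pathfinish \<gamma> = v)"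
  have \<gamma>': "path \<gamma>' \<and> path_image \<gamma>' \<subseteq> X \<and> pathstart \<gamma>' = u \<and> pathfinish \<gamma>' = v"
    unfolding \<gamma>'_def by (rule someI[of _ \<gamma>]) (use \<gamma> in simp)
  have "homotopic_paths X \<gamma>' \<gamma>"
    using \<gamma> \<gamma>' by (intro metric_simply_connected_homotopic_paths[OF simply_connected]) auto
  then have "homotopic_paths S (p \<circ> \<gamma>') (p \<circ> \<gamma>)"
    using cont_p p_in by (intro homotopic_paths_continuous_image[where S = X]) auto
  moreover have "p \<circ> \<gamma>' \<in> loops_at S b"
    using \<gamma>' uv by (intro projected_loop) auto
  ultimately show ?thesis
    unfolding loop_class_def \<gamma>'_def[symmetric] using path_class_eq_iff by blast
qed

lemma loop_class_closed:
  assumes "u \<in> fibre b" "v \<in> fibre b"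
  shows "loop_class u v \<in> carrier (fundamental_group S b)"
proof -
  obtain \<gamma> where "path \<gamma>" "path_image \<gamma> \<subseteq> X" "pathstart \<gamma> = u" "pathfinish \<gamma> = v"
    using path_between_exists[of u v] assms by (auto simp: fibre_def)
  then show ?thesis
    using loop_class_eq[OF assms] projected_loop[of \<gamma> b] assms by (auto simp: fundamental_group_def)
qed

lemma loop_class_mult:
  assumes "u \<in> fibre b" "v \<in> fibre b" "w \<in> fibre b"
  shows "loop_class u v \<otimes>\<^bsub>fundamental_group S b\<^esub> loop_class v w = loop_class u w"
proof -
  obtain \<gamma> where \<gamma>: "path \<gamma>" "path_image \<gamma> \<subseteq> X" "pathstart \<gamma> = u" "pathfinish \<gamma> = v"
    using path_between_exists[of u v] assms by (auto simp: fibre_def)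
  obtain \<gamma>' where \<gamma>': "path \<gamma>'" "path_image \<gamma>' \<subseteq> X" "pathstart \<gamma>' = v" "pathfinish \<gamma>' = w"
    using path_between_exists[of v w] assms by (auto simp: fibre_def)
  have "loop_class u w = path_class S (p \<circ> (\<gamma> +++ \<gamma>'))"
    using \<gamma> \<gamma>' assms by (intro loop_class_eq[of _ b]) (auto simp: path_image_join)
  also have "p \<circ> (\<gamma> +++ \<gamma>') = (p \<circ> \<gamma>) +++ (p \<circ> \<gamma>')"
    by (rule path_compose_join)
  finally show ?thesis
    using \<gamma> \<gamma>' assms projected_loop[of \<gamma> b] projected_loop[of \<gamma>' b]
    by (simp add: loop_class_eq[OF assms(1,2) \<gamma>] loop_class_eq[OF assms(2,3) \<gamma>'] fundamental_group_mult)
qed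

text \<open>Lift a representing loop.\<close>

lemma loop_class_surj:
  assumes a: "a \<in> carrier (fundamental_group S b)" and u: "u \<in> fibre b"
  shows "\<exists>v\<in>fibre b. loop_class u v = a"
proof -
  obtain g where g: "g \<in> loops_at S b" "a = path_class S g"
    using a by (auto simp: fundamental_group_def)
  have "u \<in> X" "path g" "path_image g \<subseteq> S" "pathstart g = p u"
    using g u by (auto simp: loops_at_def fibre_def)
  then obtain h where h: "path h" "path_image h \<subseteq> X" "pathstart h = u" "\<And>t. t \<in> {0..1} \<Longrightarrow> p (h t) = g t"
    using metric_covering_space_lift_path[OF covering, of u g] by blast
  have "p (pathfinish h) = b"
    using h(4)[of 1] g by (simp add: pathfinish_def loops_at_def)
  then have v: "pathfinish h \<in> fibre b"
    using h by (auto simp: fibre_def)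
  have "homotopic_paths S g (p \<circ> h)"
    using g h(4) by (intro homotopic_paths_eq) (auto simp: loops_at_def)
  then have "a = path_class S (p \<circ> h)"
    using g by (simp add: path_class_eq_iff)
  also have "\<dots> = loop_class u (pathfinish h)"
    using loop_class_eq[OF u v h(1,2,3)] by simp
  finally show ?thesis
    using v by blast
qed

text \<open>Lifts of homotopic loops from the same point have the same endpoint.\<close>

lemma loop_class_inj:
  assumes u: "u \<in> fibre b" and v: "v \<in> fibre b" and w: "w \<in> fibre b"
    and eq: "loop_class u v = loop_class u w"
  shows "v = w"
proof -
  obtain \<gamma> where \<gamma>: "path \<gamma>" "path_image \<gamma> \<subseteq> X" "pathstart \<gamma> = u" "pathfinish \<gamma> = v"
    using path_between_exists[of u v] u v by (auto simp: fibre_def)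
  obtain \<gamma>' where \<gamma>': "path \<gamma>'" "path_image \<gamma>' \<subseteq> X" "pathstart \<gamma>' = u" "pathfinish \<gamma>' = w"
    using path_between_exists[of u w] u w by (auto simp: fibre_def)
  have "p \<circ> \<gamma> \<in> loops_at S b"
    using \<gamma> u v by (intro projected_loop) auto
  then have "homotopic_paths S (p \<circ> \<gamma>) (p \<circ> \<gamma>')"
    using eq loop_class_eq[OF u v \<gamma>] loop_class_eq[OF u w \<gamma>'] path_class_eq_iff by metis
  then have "pathfinish \<gamma> = pathfinish \<gamma>'"
    using \<gamma> \<gamma>' by (intro metric_covering_space_monodromy[OF covering, of "p \<circ> \<gamma>" "p \<circ> \<gamma>'"]) auto
  then show ?thesis
    using \<gamma> \<gamma>' by simp
qed

text \<open>A substitute for the deck transformation that maps \<open>u\<close> to \<open>u'\<close>: project an almost shortest path from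
\<open>u\<close> to \<open>v\<close> and lift it from \<open>u'\<close>. It makes statements about all pairs in the fibre follow from those
about pairs with a fixed first point.\<close>

lemma loop_class_transfer:
  assumes u: "u \<in> fibre b" and v: "v \<in> fibre b" and u': "u' \<in> fibre b"
  shows "\<exists>v'\<in>fibre b. loop_class u' v' = loop_class u v \<and> dist u' v' < dist u v + 1"
proof -
  have uvX: "u \<in> X" "v \<in> X" "u' \<in> X"
    using u v u' by (auto simp: fibre_def)
  obtain \<gamma> where "near_minimal_path X u v 1 \<gamma>"
    using near_minimal_path_exists[OF length_total uvX(1,2), of 1] by auto
  note \<gamma> = near_minimal_pathD[OF this]
  have loop: "p \<circ> \<gamma> \<in> loops_at S b"
    using \<gamma> u v by (intro projected_loop) auto
  have len: "(\<Sum>i<n. dist ((p \<circ> \<gamma>) (real i / real n)) ((p \<circ> \<gamma>) (real (Suc i) / real n))) < dist u v + 1"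
    if n: "n > 0" for n
  proof -
    have "\<gamma> t \<in> X" if "t \<in> {0..1}" for t
      using \<gamma>(2) that by (auto simp: path_image_def)
    then have "(\<Sum>i<n. dist ((p \<circ> \<gamma>) (real i / real n)) ((p \<circ> \<gamma>) (real (Suc i) / real n)))
        \<le> (\<Sum>i<n. dist (\<gamma> (real i / real n)) (\<gamma> (real (Suc i) / real n)))"
      by (intro sum_mono) (auto intro!: local_isometry_nonexpanding[OF length_total local_isometry])
    also have "\<dots> < dist u v + 1"
      using \<gamma>(5)[OF n] .
    finally show ?thesis .
  qed
  have proj: "path (p \<circ> \<gamma>)" "path_image (p \<circ> \<gamma>) \<subseteq> S" "pathstart (p \<circ> \<gamma>) = p u'"
    using loop u' by (auto simp: loops_at_def fibre_def)
  obtain h where h: "path h" "path_image h \<subseteq> X" "pathstart h = u'" "\<And>t. t \<in> {0..1} \<Longrightarrow> p (h t) = (p \<circ> \<gamma>) t"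
    "dist u' (pathfinish h) < dist u v + 1"
    using lift_path_displacement[OF covering local_isometry uvX(3) proj len] by blast
  have v': "pathfinish h \<in> fibre b"
  proof -
    have "p (pathfinish h) = p v"
      using h(4)[of 1] \<gamma>(4) by (simp add: pathfinish_def)
    then show ?thesis
      using h(2) v by (auto simp: fibre_def)
  qed
  have "homotopic_paths S (p \<circ> \<gamma>) (p \<circ> h)"
    using loop h(4) by (intro homotopic_paths_eq) (auto simp: loops_at_def)
  then have "path_class S (p \<circ> \<gamma>) = path_class S (p \<circ> h)"
    using loop path_class_eq_iff by blast
  then have "loop_class u' (pathfinish h) = loop_class u v"
    using loop_class_eq[OF u v \<gamma>(1-4)] loop_class_eq[OF u' v' h(1-3)] by simp
  then show ?thesis
    using v' h(5) by blast
qed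

text \<open>By transfer, every such class already occurs between a fixed point of the fibre and one of
the finitely many points of the fibre in a ball around it.\<close>

lemma finitely_many_short_classes:
  assumes b: "b \<in> S"
  shows "finite {loop_class u v | u v. u \<in> fibre b \<and> v \<in> fibre b \<and> dist u v \<le> m}"
proof (cases "fibre b = {}")
  case False
  then obtain x where x: "x \<in> fibre b"
    by blast
  have "{loop_class u v | u v. u \<in> fibre b \<and> v \<in> fibre b \<and> dist u v \<le> m}
      \<subseteq> loop_class x ` {v \<in> X. p v = b \<and> dist x v \<le> m + 1}"
  proof
    fix a assume "a \<in> {loop_class u v | u v. u \<in> fibre b \<and> v \<in> fibre b \<and> dist u v \<le> m}"
    then obtain u v where uv: "u \<in> fibre b" "v \<in> fibre b" "dist u v \<le> m" "a = loop_class u v"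
      by blast
    then obtain v' where "v' \<in> fibre b" "loop_class x v' = a" "dist x v' < dist u v + 1"
      using loop_class_transfer[OF uv(1,2) x] by blast
    then show "a \<in> loop_class x ` {v \<in> X. p v = b \<and> dist x v \<le> m + 1}"
      using uv(3) by (intro image_eqI[of _ _ v']) (auto simp: fibre_def)
  qed
  moreover have "finite {v \<in> X. p v = b \<and> dist x v \<le> m + 1}"
    using x by (intro covering_fibre_finite[OF compact_base length_base length_total covering local_isometry])
      (auto simp: fibre_def)
  ultimately show ?thesis
    by (meson finite_imageI finite_subset)
qed auto

text \<open>By transfer, the displacement exceeds that at a fixed point of the fibre by at most one. The
length of a representing loop would give no bound, since it may be infinite.\<close>

lemma class_displacement_bounded:
  assumes a: "a \<in> carrier (fundamental_group S b)"
  shows "\<exists>l. \<forall>u\<in>fibre b. \<forall>v\<in>fibre b. loop_class u v = a \<longrightarrow> dist u v \<le> l"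
proof (cases "fibre b = {}")
  case False
  then obtain x where x: "x \<in> fibre b"
    by blast
  obtain w where w: "w \<in> fibre b" "loop_class x w = a"
    using loop_class_surj[OF a x] by blast
  have "dist u v \<le> dist x w + 1" if uv: "u \<in> fibre b" "v \<in> fibre b" "loop_class u v = a" for u v
  proof -
    obtain v' where "v' \<in> fibre b" "loop_class u v' = a" "dist u v' < dist x w + 1"
      using loop_class_transfer[OF x w(1) uv(1)] w(2) by auto
    then show ?thesis
      using loop_class_inj[OF uv(1,2), of v'] uv(3) by auto
  qed
  then show ?thesis
    by blast
qed auto

lemma inv_loop_class_mult:
  assumes b: "b \<in> S" and "u \<in> fibre b" "v \<in> fibre b" "w \<in> fibre b"
  shows "inv\<^bsub>fundamental_group S b\<^esub> (loop_class u v) \<otimes>\<^bsub>fundamental_group S b\<^esub> loop_class u w = loop_class v w"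
proof -
  interpret group "fundamental_group S b"
    using b by (rule group_fundamental_group)
  show ?thesis
    unfolding loop_class_mult[OF assms(2-4), symmetric]
    using loop_class_closed[OF assms(2,3)] loop_class_closed[OF assms(3,4)]
    by (simp add: m_assoc[symmetric])
qed

lemma dist_le_word_length:
  assumes b: "b \<in> S"
    and l: "\<And>a u v. a \<in> W \<Longrightarrow> u \<in> fibre b \<Longrightarrow> v \<in> fibre b \<Longrightarrow> loop_class u v = a \<Longrightarrow> dist u v \<le> l"
    and W: "W \<subseteq> carrier (fundamental_group S b)"
    and uv: "u \<in> fibre b" "v \<in> fibre b"
    and xs: "set xs \<subseteq> W" "loop_class u v = word_product (fundamental_group S b) xs"
  shows "dist u v \<le> l * length xs"
  using uv xs
proof (induction xs arbitrary: u)
  case Nil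
  interpret group "fundamental_group S b"
    using b by (rule group_fundamental_group)
  have "loop_class u u \<otimes>\<^bsub>fundamental_group S b\<^esub> loop_class u u = loop_class u u"
    by (rule loop_class_mult[OF Nil(1) Nil(1) Nil(1)])
  then have "loop_class u u = \<one>\<^bsub>fundamental_group S b\<^esub>"
    using loop_class_closed[OF Nil(1) Nil(1)] r_cancel_one by metis
  then have "u = v"
    using Nil by (intro loop_class_inj[of u b u v]) auto
  then show ?case
    by simp
next
  case (Cons a xs)
  interpret group "fundamental_group S b"
    using b by (rule group_fundamental_group)
  have a: "a \<in> carrier (fundamental_group S b)"
    using Cons.prems W by auto
  obtain w where w: "w \<in> fibre b" "loop_class u w = a"
    using loop_class_surj[OF a Cons.prems(1)] by blast
  have closed: "word_product (fundamental_group S b) xs \<in> carrier (fundamental_group S b)"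
    using Cons.prems W by (intro word_product_closed) auto
  have "a \<otimes>\<^bsub>fundamental_group S b\<^esub> loop_class w v = a \<otimes>\<^bsub>fundamental_group S b\<^esub> word_product (fundamental_group S b) xs"
    using loop_class_mult[OF Cons.prems(1) w(1) Cons.prems(2)] w Cons.prems by simp
  then have "loop_class w v = word_product (fundamental_group S b) xs"
    using a closed loop_class_closed[OF w(1) Cons.prems(2)] by simp
  then have "dist w v \<le> l * length xs"
    using Cons w by auto
  moreover have "dist u w \<le> l"
    using l[of a u w] w Cons.prems by auto
  ultimately show ?case
    using dist_triangle[of u v w] by (simp add: algebra_simps)
qed

text \<open>The map \<open>f\<close> sends \<open>x\<close> to the class of the projected path from a base point to a point of the fibre near \<open>x\<close>.
Points at distance at most \<open>1\<close> go to elements that differ by one of finitely many classes, which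
bounds the word metric along geodesics; conversely each generator moves the fibre by a
bounded distance.\<close>

theorem svarc_milnor:
  assumes b: "b \<in> S"
    and A: "finite A" "A \<subseteq> carrier (fundamental_group S b)"
      "generate (fundamental_group S b) A = carrier (fundamental_group S b)"
  shows "\<exists>f c. 1 \<le> c \<and> (\<forall>x\<in>X. f x \<in> carrier (fundamental_group S b)) \<and>
    (\<forall>x\<in>X. \<forall>y\<in>X. word_metric (fundamental_group S b) A (f x) (f y) \<le> c * dist x y + c \<and>
      dist x y \<le> c * word_metric (fundamental_group S b) A (f x) (f y) + c)"
proof -
  let ?G = "fundamental_group S b"
  interpret group ?G
    using b by (rule group_fundamental_group)
  define W where "W = A \<union> m_inv ?G ` A"
  have W: "W \<subseteq> carrier ?G" "finite W"
    using A by (auto simp: W_def)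
  obtain R where R: "\<And>x. x \<in> X \<Longrightarrow> \<exists>v\<in>X. p v = b \<and> dist x v \<le> R"
    using covering_fibre_cobounded[OF compact_base length_base covering local_isometry b] by metis
  then obtain \<pi> where \<pi>: "\<And>x. x \<in> X \<Longrightarrow> \<pi> x \<in> fibre b \<and> dist x (\<pi> x) \<le> R"
    unfolding fibre_def by (metis (mono_tags, lifting) mem_Collect_eq)
  obtain x0 where x0: "x0 \<in> fibre b"
    using b covering by (auto simp: covering_space_def fibre_def)
  define f where "f x = loop_class x0 (\<pi> x)" for x
  have f_closed: "f x \<in> carrier ?G" if "x \<in> X" for x
    unfolding f_def using loop_class_closed[OF x0] \<pi>[OF that] by blast
  have wm: "word_metric ?G A (f x) (f y) = word_length ?G A (loop_class (\<pi> x) (\<pi> y))"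
    if "x \<in> X" "y \<in> X" for x y
    unfolding word_metric_def f_def using inv_loop_class_mult[OF b x0] \<pi> that by simp
  \<comment> \<open>The inserted \<open>0\<close> keeps the set nonempty.\<close>
  define K where "K = Max (insert 0 (word_length ?G A `
      {loop_class u v | u v. u \<in> fibre b \<and> v \<in> fibre b \<and> dist u v \<le> 2 * R + 1}))"
  have step: "word_metric ?G A (f x) (f y) \<le> K" if "x \<in> X" "y \<in> X" "dist x y \<le> 1" for x y
  proof -
    have "dist (\<pi> x) (\<pi> y) \<le> 2 * R + 1"
      using \<pi>[OF that(1)] \<pi>[OF that(2)] that(3) dist_triangle[of "\<pi> x" "\<pi> y" x] dist_triangle[of x "\<pi> y" y]
      by (simp add: dist_commute)
    then have "loop_class (\<pi> x) (\<pi> y) \<in> {loop_class u v | u v. u \<in> fibre b \<and> v \<in> fibre b \<and> dist u v \<le> 2 * R + 1}"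
      using \<pi> that by blast
    then have "word_length ?G A (loop_class (\<pi> x) (\<pi> y)) \<le> K"
      unfolding K_def using finitely_many_short_classes[OF b, of "2 * R + 1"] by (intro Max_ge) auto
    then show ?thesis
      by (simp add: wm that)
  qed
  have upper: "word_metric ?G A (f x) (f y) \<le> real K * dist x y + real K" if xy: "x \<in> X" "y \<in> X" for x y
  proof -
    obtain \<sigma> where \<sigma>: "geodesic_segment X \<sigma> (dist x y)" "\<sigma> 0 = x" "\<sigma> (dist x y) = y"
      using geodesic_segment_exists[OF length_total proper xy] by blast
    define w where "w i = \<sigma> (min (real i) (dist x y))" for i
    have w: "w i \<in> X" "dist (w i) (w (Suc i)) \<le> 1" for i
      using \<sigma>(1) by (auto simp: geodesic_segment_def w_def)
    have "word_metric ?G A (f (w 0)) (f (w n)) \<le> real K * real n" for n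
    proof (induction n)
      case 0
      then show ?case
        using word_metric_self[OF A(2,3)] f_closed[OF w(1)] by simp
    next
      case (Suc n)
      then show ?case
        using word_metric_triangle[OF A(2,3) f_closed[OF w(1)[of 0]] f_closed[OF w(1)[of n]] f_closed[OF w(1)[of "Suc n"]]]
          step[OF w(1) w(1) w(2), of n] by (simp add: algebra_simps)
    qed
    note bound = this
    define n where "n = nat \<lceil>dist x y\<rceil>"
    have n: "dist x y \<le> real n" "real n \<le> dist x y + 1"
      unfolding n_def by (simp_all add: of_nat_ceiling)
    have "w n = y" "w 0 = x"
      using \<sigma> n(1) by (simp_all add: w_def)
    then have "word_metric ?G A (f x) (f y) \<le> real K * real n"
      using bound[of n] by simp
    also have "\<dots> \<le> K * (dist x y + 1)"
      using mult_left_mono[OF n(2), of "real K"] by simp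
    finally show ?thesis
      by (simp add: algebra_simps)
  qed
  have "\<exists>l. \<forall>a\<in>W. \<forall>u\<in>fibre b. \<forall>v\<in>fibre b. loop_class u v = a \<longrightarrow> dist u v \<le> l"
  proof -
    have "\<exists>l. \<forall>u\<in>fibre b. \<forall>v\<in>fibre b. loop_class u v = a \<longrightarrow> dist u v \<le> l" if "a \<in> W" for a
      using class_displacement_bounded[of a b] that W by blast
    then obtain l where l: "\<And>a u v. a \<in> W \<Longrightarrow> u \<in> fibre b \<Longrightarrow> v \<in> fibre b \<Longrightarrow> loop_class u v = a \<Longrightarrow> dist u v \<le> l a"
      by metis
    have "l a \<le> Max (l ` W)" if "a \<in> W" for a
      using W that by (intro Max_ge) auto
    then show ?thesis
      using l by (meson order_trans)
  qed
  then obtain l where l: "\<And>a u v. a \<in> W \<Longrightarrow> u \<in> fibre b \<Longrightarrow> v \<in> fibre b \<Longrightarrow> loop_class u v = a \<Longrightarrow> dist u v \<le> l"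
    by blast
  have lower: "dist x y \<le> \<bar>l\<bar> * word_metric ?G A (f x) (f y) + 2 * R" if xy: "x \<in> X" "y \<in> X" for x y
  proof -
    have \<pi>xy: "\<pi> x \<in> fibre b" "\<pi> y \<in> fibre b"
      using \<pi> xy by auto
    obtain xs where xs: "length xs = word_length ?G A (loop_class (\<pi> x) (\<pi> y))" "set xs \<subseteq> W"
      "word_product ?G xs = loop_class (\<pi> x) (\<pi> y)"
      using shortest_word_exists[OF A(2,3) loop_class_closed[OF \<pi>xy]] unfolding W_def by blast
    have "dist (\<pi> x) (\<pi> y) \<le> l * length xs"
      using dist_le_word_length[OF b l W(1) \<pi>xy xs(2)] xs(3) by simp
    also have "\<dots> \<le> \<bar>l\<bar> * length xs"
      by (intro mult_right_mono) auto
    finally have "dist (\<pi> x) (\<pi> y) \<le> \<bar>l\<bar> * word_metric ?G A (f x) (f y)"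
      using xs(1) by (simp add: wm xy)
    then show ?thesis
      using \<pi>[OF xy(1)] \<pi>[OF xy(2)] dist_triangle[of x y "\<pi> x"] dist_triangle[of "\<pi> x" y "\<pi> y"]
      by (simp add: dist_commute)
  qed
  define c where "c = Max {1, real K, \<bar>l\<bar>, 2 * R}"
  have c: "1 \<le> c" "real K \<le> c" "\<bar>l\<bar> \<le> c" "2 * R \<le> c"
    by (auto simp: c_def)
  have "word_metric ?G A (f x) (f y) \<le> c * dist x y + c \<and> dist x y \<le> c * word_metric ?G A (f x) (f y) + c"
    if "x \<in> X" "y \<in> X" for x y
  proof -
    have "K * dist x y \<le> c * dist x y"
      using c by (intro mult_right_mono) auto
    moreover have "\<bar>l\<bar> * word_metric ?G A (f x) (f y) \<le> c * word_metric ?G A (f x) (f y)"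
      using c by (intro mult_right_mono) (auto simp: word_metric_def)
    ultimately show ?thesis
      using upper[OF that] lower[OF that] c by linarith
  qed
  then show ?thesis
    using c(1) f_closed by blast
qed

end

section \<open>Geodesic rays in coarsely hyperbolic spaces\<close>

text \<open>A metric space with a second, hyperbolic pseudometric \<open>E\<close> that is comparable to the distance at large
scale and for which the geodesics are almost geodesic. Hyperbolicity of \<open>X\<close> is used in this form only.\<close>

locale coarsely_hyperbolic_space = hyperbolic_pseudometric X E \<delta>
  for X :: "'b::metric_space set" and E :: "'b \<Rightarrow> 'b \<Rightarrow> real" and \<delta> :: real +
  fixes c C :: real
  assumes c_ge: "1 \<le> c" and C_nonneg: "0 \<le> C"
    and E_le: "x \<in> X \<Longrightarrow> y \<in> X \<Longrightarrow> E x y \<le> c * dist x y + c"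
    and dist_le: "x \<in> X \<Longrightarrow> y \<in> X \<Longrightarrow> dist x y \<le> c * E x y + c"
    and segment: "geodesic_segment X \<sigma> l \<Longrightarrow> t \<in> {0..l} \<Longrightarrow> gromov_product E (\<sigma> t) (\<sigma> 0) (\<sigma> l) \<le> C"
begin

lemma E_le_bound:
  assumes "x \<in> X" "y \<in> X" "dist x y \<le> \<eta>"
  shows "E x y \<le> c * \<eta> + c"
  using E_le[OF assms(1,2)] mult_left_mono[OF assms(3), of c] c_ge by linarith

lemma dist_le_bound:
  assumes "x \<in> X" "y \<in> X" "E x y \<le> \<eta>"
  shows "dist x y \<le> c * \<eta> + c"
  using dist_le[OF assms(1,2)] mult_left_mono[OF assms(3), of c] c_ge by linarith

text \<open>A discrete intermediate value theorem: \<open>E\<close> need not be continuous, but it changes by at most \<open>2 c\<close>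
along a unit step.\<close>

lemma segment_crosses_sphere:
  assumes \<sigma>: "geodesic_segment X \<sigma> l" and l: "0 \<le> l" and \<tau>: "0 \<le> \<tau>" "\<tau> \<le> E (\<sigma> 0) (\<sigma> l)"
  shows "\<exists>s\<in>{0..l}. \<tau> \<le> E (\<sigma> 0) (\<sigma> s) \<and> E (\<sigma> 0) (\<sigma> s) \<le> \<tau> + 2 * c"
proof -
  define s where "s i = min (real i) l" for i
  have s: "s i \<in> {0..l}" "\<bar>s i - s (Suc i)\<bar> \<le> 1" for i
    using l by (auto simp: s_def)
  have sX: "\<sigma> (s i) \<in> X" and s0X: "\<sigma> 0 \<in> X" for i
    using \<sigma> s l by (auto simp: geodesic_segment_def)
  have "s (nat \<lceil>l\<rceil>) = l"
    unfolding s_def by (simp add: of_nat_ceiling min_absorb2)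
  then have ex: "\<exists>i. \<tau> \<le> E (\<sigma> 0) (\<sigma> (s i))"
    using \<tau> by metis
  define i where "i = (LEAST i. \<tau> \<le> E (\<sigma> 0) (\<sigma> (s i)))"
  have i: "\<tau> \<le> E (\<sigma> 0) (\<sigma> (s i))"
    unfolding i_def using ex by (rule LeastI_ex)
  have "E (\<sigma> 0) (\<sigma> (s i)) \<le> \<tau> + 2 * c"
  proof (cases i)
    case 0
    then have "s i = 0"
      using l by (simp add: s_def)
    then show ?thesis
      using s0X \<tau> c_ge by simp
  next
    case (Suc j)
    then have "E (\<sigma> 0) (\<sigma> (s j)) < \<tau>"
      using not_less_Least[of j "\<lambda>i. \<tau> \<le> E (\<sigma> 0) (\<sigma> (s i))"] by (simp add: i_def)
    moreover have "dist (\<sigma> (s j)) (\<sigma> (s i)) \<le> 1"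
      using \<sigma> s[of j] s[of i] Suc by (simp add: geodesic_segment_def)
    then have "E (\<sigma> (s j)) (\<sigma> (s i)) \<le> 2 * c"
      using E_le_bound[OF sX[of j] sX[of i]] by fastforce
    ultimately show ?thesis
      using triangle[OF s0X sX[of j] sX[of i]] by simp
  qed
  with i s show ?thesis
    by blast
qed

text \<open>If \<open>a\<close> lies almost between the endpoints, then the point of the segment at the same \<open>E\<close>-distance
from \<open>\<sigma> 0\<close> is near \<open>a\<close>, because both have a large Gromov product with \<open>\<sigma> l\<close>.\<close>

lemma gromov_product_small_imp_near_segment:
  assumes \<sigma>: "geodesic_segment X \<sigma> l" and l: "0 \<le> l" and a: "a \<in> X"
    and B: "gromov_product E a (\<sigma> 0) (\<sigma> l) \<le> B"
  shows "\<exists>s\<in>{0..l}. dist a (\<sigma> s) \<le> c * (2 * c + 6 * B + 2 * C + 2 * \<delta>) + c"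
proof -
  let ?y = "\<sigma> 0" and ?z = "\<sigma> l"
  have X: "?y \<in> X" "?z \<in> X"
    using \<sigma> l by (auto simp: geodesic_segment_def)
  have "0 \<le> B"
    using B triangle[OF X(1) a X(2)] sym[OF a X(2)] by (simp add: gromov_product_def)
  define \<tau> where "\<tau> = min (E ?y a) (E ?y ?z)"
  have "0 \<le> \<tau>" "\<tau> \<le> E ?y ?z"
    using nonneg X a by (auto simp: \<tau>_def)
  then obtain s where s: "s \<in> {0..l}" "\<tau> \<le> E ?y (\<sigma> s)" "E ?y (\<sigma> s) \<le> \<tau> + 2 * c"
    using segment_crosses_sphere[OF \<sigma> l] by blast
  let ?b = "\<sigma> s"
  have b: "?b \<in> X"
    using \<sigma> s by (auto simp: geodesic_segment_def)
  have syms: "E a ?y = E ?y a" "E ?z ?y = E ?y ?z" "E ?b ?y = E ?y ?b" "E ?z a = E a ?z" "E ?z ?b = E ?b ?z"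
    using sym X a b by auto
  have "E ?y a - 2 * B \<le> \<tau>" "\<tau> \<le> E ?y a"
    using B nonneg[OF a X(2)] \<open>0 \<le> B\<close> by (auto simp: gromov_product_def \<tau>_def syms)
  moreover have "gromov_product E ?b ?y ?z \<le> C"
    using segment[OF \<sigma> s(1)] .
  then have "E ?y ?b - C \<le> gromov_product E ?y ?b ?z"
    by (simp add: gromov_product_def syms field_simps)
  moreover have "E ?y a - B \<le> gromov_product E ?y a ?z"
    using B by (simp add: gromov_product_def syms field_simps)
  moreover have "min (gromov_product E ?y a ?z) (gromov_product E ?y ?z ?b) - \<delta> \<le> gromov_product E ?y a ?b"
    using X a b by (intro four_point)
  moreover have "gromov_product E ?y ?z ?b = gromov_product E ?y ?b ?z"
    using X b by (intro gromov_product_commute)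
  ultimately have "E ?y a - 3 * B - C - \<delta> \<le> gromov_product E ?y a ?b"
    using s \<open>0 \<le> B\<close> C_nonneg by linarith
  moreover have "E a ?b = E ?y a + E ?y ?b - 2 * gromov_product E ?y a ?b"
    by (simp add: gromov_product_def syms field_simps)
  ultimately have "E a ?b \<le> 2 * c + 6 * B + 2 * C + 2 * \<delta>"
    using s \<open>\<tau> \<le> E ?y a\<close> by linarith
  with dist_le_bound[OF a b] s(1) show ?thesis
    by blast
qed

text \<open>The first value covers points near the common start, the second those near the other segment, in the two
cases of the next proof.\<close>

definition fellow_bound :: "real \<Rightarrow> real" where
  "fellow_bound \<eta> = max (2 * (c * (C + 2 * \<delta> + c * \<eta> + c) + c) + \<eta>)
     (2 * (c * (2 * c + 6 * (C + 2 * \<delta>) + 2 * C + 2 * \<delta>) + c) + \<eta>)"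

text \<open>The point \<open>\<sigma> t\<close> is almost between the ends of \<open>\<sigma>\<close>. The four-point condition replaces the far end of
\<open>\<sigma>\<close> by that of \<open>\<sigma>'\<close>; a second application shows that \<open>\<sigma> t\<close> is near the start or almost between
the ends of \<open>\<sigma>'\<close>. The hypothesis on the far ends covers equal ends as well as ends that are close to each other
compared with their distance from \<open>\<sigma> t\<close>, as for asymptotic rays.\<close>

lemma segments_fellow_travel:
  assumes \<sigma>: "geodesic_segment X \<sigma> l" and \<sigma>': "geodesic_segment X \<sigma>' l'"
    and t: "0 \<le> t" "t \<le> l" "t \<le> l'"
    and start: "dist (\<sigma> 0) (\<sigma>' 0) \<le> \<eta>"
    and ends: "\<sigma> l = \<sigma>' l' \<or> C + \<delta> < gromov_product E (\<sigma> t) (\<sigma> l) (\<sigma>' l')"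
  shows "dist (\<sigma> t) (\<sigma>' t) \<le> fellow_bound \<eta>"
proof -
  define a where "a = \<sigma> t"
  have X: "\<sigma> 0 \<in> X" "\<sigma> l \<in> X" "\<sigma>' 0 \<in> X" "\<sigma>' l' \<in> X" "a \<in> X" "\<sigma>' t \<in> X"
    using \<sigma> \<sigma>' t by (auto simp: geodesic_segment_def a_def)
  have d': "dist (\<sigma>' s) (\<sigma>' u) = \<bar>s - u\<bar>" if "s \<in> {0..l'}" "u \<in> {0..l'}" for s u
    using \<sigma>' that by (simp add: geodesic_segment_def)
  have xa: "dist (\<sigma> 0) a = t"
    using \<sigma> t by (simp add: geodesic_segment_def a_def)
  have xz: "gromov_product E a (\<sigma> 0) (\<sigma> l) \<le> C"
    using segment[OF \<sigma>, of t] t by (simp add: a_def)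
  have "gromov_product E a (\<sigma> 0) (\<sigma>' l') \<le> C + \<delta>"
    using ends
  proof
    assume "\<sigma> l = \<sigma>' l'"
    then show ?thesis
      using xz delta_nonneg by simp
  next
    assume "C + \<delta> < gromov_product E (\<sigma> t) (\<sigma> l) (\<sigma>' l')"
    moreover have "min (gromov_product E a (\<sigma> 0) (\<sigma>' l')) (gromov_product E a (\<sigma>' l') (\<sigma> l)) - \<delta>
        \<le> gromov_product E a (\<sigma> 0) (\<sigma> l)"
      using X by (intro four_point)
    ultimately show ?thesis
      using xz gromov_product_commute[OF X(2,4), of a] by (simp add: a_def min_def split: if_splits)
  qed
  moreover have "min (gromov_product E a (\<sigma> 0) (\<sigma>' 0)) (gromov_product E a (\<sigma>' 0) (\<sigma>' l')) - \<delta>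
      \<le> gromov_product E a (\<sigma> 0) (\<sigma>' l')"
    using X by (intro four_point)
  ultimately consider "gromov_product E a (\<sigma> 0) (\<sigma>' 0) \<le> C + 2 * \<delta>"
    | "gromov_product E a (\<sigma>' 0) (\<sigma>' l') \<le> C + 2 * \<delta>"
    by linarith
  then show ?thesis
  proof cases
    case 1
    have "E (\<sigma> 0) (\<sigma>' 0) \<le> c * \<eta> + c"
      using E_le_bound[OF X(1,3) start] .
    then have "E (\<sigma> 0) a \<le> C + 2 * \<delta> + c * \<eta> + c"
      using gromov_product_ge[OF X(5,1,3)] 1 by simp
    define D where "D = c * (C + 2 * \<delta> + c * \<eta> + c) + c"
    have "t \<le> D"
      using dist_le_bound[OF X(1,5) \<open>E (\<sigma> 0) a \<le> C + 2 * \<delta> + c * \<eta> + c\<close>] xa by (simp add: D_def)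
    moreover have "dist a (\<sigma>' t) \<le> 2 * t + \<eta>"
      using dist_triangle[of a "\<sigma>' t" "\<sigma> 0"] dist_triangle[of "\<sigma> 0" "\<sigma>' t" "\<sigma>' 0"] d'[of 0 t] xa start t
      by (simp add: dist_commute)
    ultimately have "dist a (\<sigma>' t) \<le> 2 * D + \<eta>"
      by linarith
    then show ?thesis
      by (simp add: fellow_bound_def a_def D_def le_max_iff_disj)
  next
    case 2
    define D where "D = c * (2 * c + 6 * (C + 2 * \<delta>) + 2 * C + 2 * \<delta>) + c"
    have "0 \<le> l'"
      using t by simp
    then obtain s where s: "s \<in> {0..l'}" "dist a (\<sigma>' s) \<le> D"
      using gromov_product_small_imp_near_segment[OF \<sigma>' _ X(5) 2] unfolding D_def by blast
    have "dist (\<sigma>' 0) (\<sigma>' s) = s"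
      using d'[of 0 s] s by simp
    then have "\<bar>s - t\<bar> \<le> D + \<eta>"
      using s(2) xa start dist_triangle[of "\<sigma> 0" a "\<sigma>' 0"] dist_triangle[of "\<sigma>' 0" a "\<sigma>' s"]
        dist_triangle[of "\<sigma>' 0" "\<sigma>' s" "\<sigma> 0"] dist_triangle[of "\<sigma> 0" "\<sigma>' s" a]
        dist_commute[of "\<sigma>' s" a] dist_commute[of "\<sigma>' 0" "\<sigma> 0"] by linarith
    moreover have "dist (\<sigma>' s) (\<sigma>' t) = \<bar>s - t\<bar>"
      using d' s t by simp
    ultimately have "dist a (\<sigma>' t) \<le> 2 * D + \<eta>"
      using s(2) dist_triangle[of a "\<sigma>' t" "\<sigma>' s"] by linarith
    then show ?thesis
      by (simp add: fellow_bound_def a_def D_def le_max_iff_disj)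
  qed
qed

text \<open>The bound depends on the starting points alone and not on the constant of asymptoticity, which is
what makes it pass to limits of rays.\<close>

theorem asymptotic_rays_fellow_travel:
  assumes r: "geodesic_ray X r" and r': "geodesic_ray X r'" and asym: "asymptotic r r'"
    and start: "dist (r 0) (r' 0) \<le> \<eta>" and t: "0 \<le> t"
  shows "dist (r t) (r' t) \<le> fellow_bound \<eta>"
proof -
  obtain B where B: "\<And>s. 0 \<le> s \<Longrightarrow> dist (r s) (r' s) \<le> B"
    using asym by (auto simp: asymptotic_def)
  \<comment> \<open>Cut the rays at a time \<open>T\<close> so late that the distance \<open>B\<close> of their points is negligible as seen from \<open>r t\<close>.\<close>
  define T where "T = t + c * (c * B + c + C + \<delta> + 1) + c"
  have X: "r s \<in> X" "r' s \<in> X" if "0 \<le> s" for s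
    using r r' that by (auto simp: geodesic_ray_def)
  have "0 \<le> B"
    using B[of 0] zero_le_dist[of "r 0" "r' 0"] by linarith
  then have T: "t \<le> T"
    using c_ge C_nonneg delta_nonneg by (simp add: T_def)
  have rT: "r T \<in> X" "r' T \<in> X" "r t \<in> X"
    using X t T by auto
  have "dist (r T) (r t) = T - t"
    using r t T by (simp add: geodesic_ray_def)
  then have "c * (c * B + c + C + \<delta> + 1) \<le> c * E (r T) (r t)"
    using dist_le[OF rT(1,3)] by (simp add: T_def)
  then have "c * B + c + C + \<delta> + 1 \<le> E (r T) (r t)"
    using c_ge by simp
  moreover have "E (r T) (r' T) \<le> c * B + c"
    using E_le_bound[OF rT(1,2) B] t T by simp
  moreover have "E (r T) (r t) - E (r T) (r' T) \<le> gromov_product E (r t) (r T) (r' T)"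
    using rT by (intro gromov_product_ge)
  ultimately have "C + \<delta> < gromov_product E (r t) (r T) (r' T)"
    by linarith
  then show ?thesis
    using t T start by (intro segments_fellow_travel[OF geodesic_ray_imp_segment[OF r] geodesic_ray_imp_segment[OF r']]) auto
qed

text \<open>The segments from \<open>x\<close> to \<open>r n\<close> fellow travel with \<open>r\<close>, hence so does a limit ray.\<close>

theorem asymptotic_ray_exists:
  assumes X: "length_metric_on X" "proper_on X" and r: "geodesic_ray X r" and x: "x \<in> X"
  shows "\<exists>r'. geodesic_ray X r' \<and> r' 0 = x \<and> asymptotic r r'"
proof -
  have rX: "r s \<in> X" if "0 \<le> s" for s
    using r that by (auto simp: geodesic_ray_def)
  have "\<exists>\<sigma>. geodesic_segment X \<sigma> (dist x (r (real n))) \<and> \<sigma> 0 = x \<and> \<sigma> (dist x (r (real n))) = r (real n)" for n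
    using X x rX by (intro geodesic_segment_exists) auto
  then obtain \<sigma> where \<sigma>: "\<And>n. geodesic_segment X (\<sigma> n) (dist x (r (real n)))" "\<And>n. \<sigma> n 0 = x"
    "\<And>n. \<sigma> n (dist x (r (real n))) = r (real n)"
    by metis
  have lower: "real n - dist x (r 0) \<le> dist x (r (real n))" for n
    using r dist_triangle[of "r 0" "r (real n)" x] by (simp add: geodesic_ray_def dist_commute)
  have lim: "filterlim (\<lambda>n. dist x (r (real n))) at_top sequentially"
  proof (rule filterlim_at_top_mono)
    show "filterlim (\<lambda>n. real n - dist x (r 0)) at_top sequentially"
      by real_asymp
  qed (use lower in auto)
  have "dist x (\<sigma> n 0) \<le> 0" for n
    using \<sigma>(2) by simp
  then obtain r' where r': "geodesic_ray X r'" and cluster: "\<And>F e N. finite F \<Longrightarrow> F \<subseteq> {0..} \<Longrightarrow> e > 0 \<Longrightarrow>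
      \<exists>n\<ge>N. \<forall>t\<in>F. t \<le> dist x (r (real n)) \<and> dist (\<sigma> n t) (r' t) < e"
    using geodesic_segments_cluster_ray[where l = "\<lambda>n. dist x (r (real n))", OF X(2) x \<sigma>(1) lim] by metis
  have "dist x (r' 0) \<le> 0"
  proof (rule field_le_epsilon)
    fix e :: real assume "e > 0"
    then show "dist x (r' 0) \<le> 0 + e"
      using cluster[of "{0}" e 0] \<sigma>(2) by auto
  qed
  then have "r' 0 = x"
    by simp
  moreover have "dist (r t) (r' t) \<le> fellow_bound (dist (r 0) x) + 1" if t: "0 \<le> t" for t
  proof -
    obtain n where n: "n \<ge> nat \<lceil>t\<rceil>" "t \<le> dist x (r (real n))" "dist (\<sigma> n t) (r' t) < 1"
      using cluster[of "{t}" 1 "nat \<lceil>t\<rceil>"] t by auto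
    have "t \<le> real n"
      using n(1) by linarith
    then have "dist (r t) (\<sigma> n t) \<le> fellow_bound (dist (r 0) x)"
      using t n(2) \<sigma> by (intro segments_fellow_travel[OF geodesic_ray_imp_segment[OF r, of "real n"] \<sigma>(1)[of n]]) auto
    then show ?thesis
      using n(3) dist_triangle[of "r t" "r' t" "\<sigma> n t"] by linarith
  qed
  then have "asymptotic r r'"
    unfolding asymptotic_def by blast
  ultimately show ?thesis
    using r' by blast
qed

text \<open>If \<open>y n\<close> converges to \<open>x\<close>, a cluster ray of the rays from \<open>y n\<close> starts at \<open>x\<close> and is asymptotic
to them by the uniform fellow travelling bound, so it is the ray from \<open>x\<close>.\<close>

theorem unique_rays_continuous:
  assumes X: "proper_on X"
    and ray: "\<And>x. x \<in> X \<Longrightarrow> geodesic_ray X (\<phi> x) \<and> \<phi> x 0 = x \<and> asymptotic r0 (\<phi> x)"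
    and unique: "\<And>x r t. x \<in> X \<Longrightarrow> geodesic_ray X r \<Longrightarrow> r 0 = x \<Longrightarrow> asymptotic r0 r \<Longrightarrow> 0 \<le> t \<Longrightarrow> r t = \<phi> x t"
    and t: "0 \<le> t"
  shows "continuous_on X (\<lambda>x. \<phi> x t)"
proof (rule ccontr)
  assume "\<not> continuous_on X (\<lambda>x. \<phi> x t)"
  then obtain x e where x: "x \<in> X" and e: "e > 0"
    and "\<And>d. d > 0 \<Longrightarrow> \<exists>y\<in>X. dist y x < d \<and> e \<le> dist (\<phi> y t) (\<phi> x t)"
    unfolding continuous_on_iff by (metis not_le)
  then have "\<exists>y\<in>X. dist y x < 1 / real (Suc n) \<and> e \<le> dist (\<phi> y t) (\<phi> x t)" for n
    by simp
  then obtain y where y: "\<And>n. y n \<in> X" "\<And>n. dist (y n) x < 1 / real (Suc n)"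
    "\<And>n. e \<le> dist (\<phi> (y n) t) (\<phi> x t)"
    by metis
  have near: "dist (y n) x \<le> 1" for n
    using y(2)[of n] by (smt (verit) divide_le_eq_1_pos of_nat_0_less_iff of_nat_1 of_nat_mono Suc_leI zero_less_Suc One_nat_def)
  have asym: "asymptotic (\<phi> (y n)) (\<phi> x)" for n
  proof -
    have "asymptotic (\<phi> (y n)) r0"
      using ray[OF y(1)] by (simp add: asymptotic_def dist_commute)
    then show ?thesis
      using ray[OF x] asymptotic_trans by blast
  qed
  have fellow: "dist (\<phi> (y n) s) (\<phi> x s) \<le> fellow_bound 1" if "0 \<le> s" for n s
    using ray[OF y(1)[of n]] ray[OF x] near[of n] that by (intro asymptotic_rays_fellow_travel asym) auto
  obtain r where r: "geodesic_ray X r" and cluster: "\<And>F e N. finite F \<Longrightarrow> F \<subseteq> {0..} \<Longrightarrow> e > 0 \<Longrightarrow>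
      \<exists>n\<ge>N. \<forall>t\<in>F. t \<le> real n \<and> dist (\<phi> (y n) t) (r t) < e"
  proof -
    have "geodesic_segment X (\<phi> (y n)) (real n)" for n
      using ray[OF y(1)] by (intro geodesic_ray_imp_segment) auto
    moreover have "filterlim real at_top sequentially"
      by real_asymp
    moreover have "dist x (\<phi> (y n) 0) \<le> 1" for n
      using near[of n] ray[OF y(1)[of n]] by (simp add: dist_commute)
    ultimately show thesis
      using geodesic_segments_cluster_ray[OF X x, of "\<lambda>n. \<phi> (y n)" real 1] that by blast
  qed
  have "dist x (r 0) \<le> 0"
  proof (rule field_le_epsilon)
    fix \<epsilon> :: real assume "\<epsilon> > 0"
    then obtain N where N: "1 / real (Suc N) < \<epsilon> / 2"
      using nat_approx_posE[of "\<epsilon> / 2"] by auto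
    obtain n where n: "n \<ge> N" "dist (\<phi> (y n) 0) (r 0) < \<epsilon> / 2"
      using cluster[of "{0}" "\<epsilon> / 2" N] \<open>\<epsilon> > 0\<close> by auto
    have "1 / real (Suc n) \<le> 1 / real (Suc N)"
      using n by (simp add: frac_le)
    then show "dist x (r 0) \<le> 0 + \<epsilon>"
      using N n y(2)[of n] ray[OF y(1)[of n]] dist_triangle[of x "r 0" "y n"] by (simp add: dist_commute)
  qed
  then have r0: "r 0 = x"
    by simp
  have "dist (\<phi> x s) (r s) \<le> fellow_bound 1 + 1" if s: "0 \<le> s" for s
  proof -
    obtain n where "dist (\<phi> (y n) s) (r s) < 1"
      using cluster[of "{s}" 1 0] s by auto
    then show ?thesis
      using fellow[OF s, of n] dist_triangle[of "\<phi> x s" "r s" "\<phi> (y n) s"] by (simp add: dist_commute)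
  qed
  then have "asymptotic (\<phi> x) r"
    unfolding asymptotic_def by blast
  then have "r t = \<phi> x t"
    using ray[OF x] asymptotic_trans unique[OF x r r0 _ t] by blast
  moreover obtain n where "dist (\<phi> (y n) t) (r t) < e"
    using cluster[of "{t}" e 0] t e by auto
  ultimately show False
    using y(3)[of n] by simp
qed

end

context compact_metric_covering
begin

text \<open>The pseudometric is the pullback of the word metric. Sampled at integer times, a geodesic of \<open>X\<close>
becomes a quasi-geodesic of the group; rounding the times costs \<open>4 c\<close>.\<close>

theorem hyperbolic_fundamental_group_imp_coarsely_hyperbolic:
  assumes b: "b \<in> S" and hyp: "hyperbolic_group (fundamental_group S b)"
  shows "\<exists>E \<delta> c C. coarsely_hyperbolic_space X E \<delta> c C"
proof -
  let ?G = "fundamental_group S b"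
  obtain A \<delta> where A: "finite A" "A \<subseteq> carrier ?G" "generate ?G A = carrier ?G"
    and hypm: "hyperbolic_pseudometric (carrier ?G) (word_metric ?G A) \<delta>"
    and geod: "\<And>u v. u \<in> carrier ?G \<Longrightarrow> v \<in> carrier ?G \<Longrightarrow>
      \<exists>q N. hyperbolic_pseudometric.discrete_geodesic (carrier ?G) (word_metric ?G A) q N \<and> q 0 = u \<and> q N = v"
    using hyperbolic_group_word_metric[OF hyp] by blast
  interpret hyperbolic_pseudometric "carrier ?G" "word_metric ?G A" \<delta>
    by (rule hypm)
  obtain f c where c: "1 \<le> c" and f: "\<And>x. x \<in> X \<Longrightarrow> f x \<in> carrier ?G"
    and qi: "\<And>x y. x \<in> X \<Longrightarrow> y \<in> X \<Longrightarrow> word_metric ?G A (f x) (f y) \<le> c * dist x y + c"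
      "\<And>x y. x \<in> X \<Longrightarrow> y \<in> X \<Longrightarrow> dist x y \<le> c * word_metric ?G A (f x) (f y) + c"
    using svarc_milnor[OF b A] by blast
  define E where "E x y = word_metric ?G A (f x) (f y)" for x y
  have gp: "gromov_product E x y z = gromov_product (word_metric ?G A) (f x) (f y) (f z)" for x y z
    by (simp add: gromov_product_def E_def)
  interpret E: hyperbolic_pseudometric X E \<delta>
    using f delta_nonneg four_point by unfold_locales (auto simp: gp, auto simp: E_def intro: sym triangle)
  have "1 \<le> 2 * c"
    using c by simp
  then obtain C where C: "\<And>w n i. quasi_geodesic (2 * c) w n \<Longrightarrow> i \<le> n \<Longrightarrow>
      gromov_product (word_metric ?G A) (w i) (w 0) (w n) \<le> C"
    using quasi_geodesic_gromov_product_le[OF _ geod] by blast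
  have "gromov_product E (\<sigma> t) (\<sigma> 0) (\<sigma> l) \<le> C + 4 * c"
    if \<sigma>: "geodesic_segment X \<sigma> l" and t: "t \<in> {0..l}" for \<sigma> l t
  proof -
    define n i where "n = nat \<lfloor>l\<rfloor>" and "i = nat \<lfloor>t\<rfloor>"
    have n: "real n \<le> l" "l \<le> real n + 1" and i: "real i \<le> t" "t \<le> real i + 1" and "i \<le> n"
      using t by (auto simp: n_def i_def floor_mono intro!: nat_mono)
    have sX: "\<sigma> s \<in> X" if "s \<in> {0..l}" for s
      using \<sigma> that by (auto simp: geodesic_segment_def)
    have d: "dist (\<sigma> s) (\<sigma> u) = \<bar>s - u\<bar>" if "s \<in> {0..l}" "u \<in> {0..l}" for s u
      using \<sigma> that by (simp add: geodesic_segment_def)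
    \<comment> \<open>At distinct integer times the additive constant \<open>c\<close> is absorbed by doubling the factor.\<close>
    have "quasi_geodesic (2 * c) (\<lambda>i. f (\<sigma> (real i))) n"
      unfolding quasi_geodesic_def
    proof (intro conjI allI impI)
      fix j k assume jk: "j \<le> n" "k \<le> n"
      then have in_l: "real j \<in> {0..l}" "real k \<in> {0..l}"
        using n by auto
      show "f (\<sigma> (real j)) \<in> carrier ?G"
        using in_l sX f by blast
      show "word_metric ?G A (f (\<sigma> (real j))) (f (\<sigma> (real k))) \<le> 2 * c * \<bar>real j - real k\<bar>"
      proof (cases "j = k")
        case True
        then show ?thesis
          using in_l sX f by simp
      next
        case False
        then have "1 \<le> \<bar>real j - real k\<bar>"
          by linarith
        then have "c * 1 \<le> c * \<bar>real j - real k\<bar>"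
          using c by (intro mult_left_mono) auto
        then show ?thesis
          using qi(1)[OF sX sX, OF in_l] d[OF in_l] by simp
      qed
      have "0 \<le> c * word_metric ?G A (f (\<sigma> (real j))) (f (\<sigma> (real k)))"
        using c nonneg f sX in_l by simp
      then show "\<bar>real j - real k\<bar> \<le> 2 * c * word_metric ?G A (f (\<sigma> (real j))) (f (\<sigma> (real k))) + 2 * c"
        using qi(2)[OF sX sX, OF in_l] d[OF in_l] c by simp
    qed
    from C[OF this \<open>i \<le> n\<close>] have main: "gromov_product E (\<sigma> i) (\<sigma> 0) (\<sigma> n) \<le> C"
      by (simp add: gp)
    have near: "E (\<sigma> u) (\<sigma> v) \<le> 2 * c" if "u \<in> {0..l}" "v \<in> {0..l}" "\<bar>u - v\<bar> \<le> 1" for u v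
    proof -
      have "c * dist (\<sigma> u) (\<sigma> v) \<le> c * 1"
        using c d[OF that(1,2)] that(3) by (intro mult_left_mono) auto
      then show ?thesis
        using qi(1)[OF sX sX, OF that(1,2)] by (simp add: E_def)
    qed
    have in_l: "real i \<in> {0..l}" "real n \<in> {0..l}" "0 \<in> {0..l}" "l \<in> {0..l}"
      using i n t \<open>i \<le> n\<close> by auto
    have "E (\<sigma> i) (\<sigma> t) \<le> 2 * c" "E (\<sigma> n) (\<sigma> l) \<le> 2 * c" "E (\<sigma> l) (\<sigma> n) \<le> 2 * c"
      using near in_l t i n by auto
    then show ?thesis
      using main E.triangle[OF sX sX sX, of 0 "real i" t] E.triangle[OF sX sX sX, of l "real n" t]
        E.triangle[OF sX sX sX, of "real n" "real i" t] E.triangle[OF sX sX sX, of 0 l "real n"] in_l t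
      by (simp add: gromov_product_def)
  qed
  then have "gromov_product E (\<sigma> t) (\<sigma> 0) (\<sigma> l) \<le> max 0 (C + 4 * c)"
    if "geodesic_segment X \<sigma> l" "t \<in> {0..l}" for \<sigma> l t
    using that by fastforce
  then have "coarsely_hyperbolic_space X E \<delta> c (max 0 (C + 4 * c))"
    using c qi by unfold_locales (auto simp: E_def)
  then show ?thesis
    by blast
qed

end

section \<open>Cone points of angle less than a full turn\<close>

text \<open>The angle at the apex between two rays of the cone, capped at \<open>\<pi>\<close>.\<close>

definition cone_angle :: "real \<Rightarrow> real \<Rightarrow> real \<Rightarrow> real" where
  "cone_angle \<theta> \<phi> \<psi> = min pi (min \<bar>\<phi> - \<psi>\<bar> (\<theta> - \<bar>\<phi> - \<psi>\<bar>))"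

lemma cone_dist_eq:
  "cone_dist \<theta> (r, \<phi>) (s, \<psi>) = sqrt ((r - s)\<^sup>2 + 2 * r * s * (1 - cos (cone_angle \<theta> \<phi> \<psi>)))"
  by (simp add: cone_dist_def cone_angle_def power2_diff algebra_simps)

lemma cone_angle_bounds:
  assumes "\<phi> \<in> {0..<\<theta>}" "\<psi> \<in> {0..<\<theta>}"
  shows "0 \<le> cone_angle \<theta> \<phi> \<psi>" "cone_angle \<theta> \<phi> \<psi> \<le> pi" "cone_angle \<theta> \<phi> \<psi> \<le> \<theta> / 2"
  using assms by (auto simp: cone_angle_def min_def)

lemma cone_angle_eq_0_iff:
  assumes "\<phi> \<in> {0..<\<theta>}" "\<psi> \<in> {0..<\<theta>}"
  shows "cone_angle \<theta> \<phi> \<psi> = 0 \<longleftrightarrow> \<phi> = \<psi>"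
  using assms pi_gt_zero by (auto simp: cone_angle_def min_def simp del: pi_gt_zero)

lemma cone_dist_apex: "0 \<le> r \<Longrightarrow> cone_dist \<theta> (0, \<phi>) (r, \<psi>) = r"
  by (simp add: cone_dist_eq)

lemma cone_dist_eq_0:
  assumes "0 \<le> r" "0 \<le> s" "\<phi> \<in> {0..<\<theta>}" "\<psi> \<in> {0..<\<theta>}" "cone_dist \<theta> (r, \<phi>) (s, \<psi>) = 0"
  shows "r = s \<and> (r = 0 \<or> \<phi> = \<psi>)"
proof -
  let ?A = "cone_angle \<theta> \<phi> \<psi>"
  have "0 \<le> (r - s)\<^sup>2" "0 \<le> 2 * r * s * (1 - cos ?A)"
    using assms by auto
  moreover have "(r - s)\<^sup>2 + 2 * r * s * (1 - cos ?A) = 0"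
    using assms(5) by (simp add: cone_dist_eq)
  ultimately have "(r - s)\<^sup>2 = 0" and *: "2 * r * s * (1 - cos ?A) = 0"
    by linarith+
  then have "r = s"
    by simp
  moreover have "\<phi> = \<psi>" if "r \<noteq> 0"
  proof -
    have "cos ?A = cos 0"
      using * that \<open>r = s\<close> by simp
    then have "?A = 0"
      using cone_angle_bounds[OF assms(3,4)] cos_inj_pi[of ?A 0] by simp
    then show ?thesis
      using cone_angle_eq_0_iff[OF assms(3,4)] by simp
  qed
  ultimately show ?thesis
    by blast
qed

text \<open>The angle at the apex is at most \<open>\<theta> / 2 < \<pi>\<close>, so the two points are not opposite. This is why
geodesics avoid sharp cone points.\<close>

lemma cone_dist_equal_radius_less:
  assumes "0 < r" "\<theta> < 2 * pi" "\<phi> \<in> {0..<\<theta>}" "\<psi> \<in> {0..<\<theta>}"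
  shows "cone_dist \<theta> (r, \<phi>) (r, \<psi>) < 2 * r"
proof -
  let ?A = "cone_angle \<theta> \<phi> \<psi>"
  have "cos pi < cos ?A"
    using cone_angle_bounds[OF assms(3,4)] assms(2) by (intro cos_monotone_0_pi) auto
  then have "(2 * r * r) * (1 - cos ?A) < (2 * r * r) * 2"
    using assms(1) by (intro mult_strict_left_mono) auto
  then have "2 * r * r * (1 - cos ?A) < (2 * r)\<^sup>2"
    by (simp add: power2_eq_square)
  then have "sqrt (2 * r * r * (1 - cos ?A)) < sqrt ((2 * r)\<^sup>2)"
    by (rule real_sqrt_less_mono)
  also have "sqrt ((2 * r)\<^sup>2) = 2 * r"
    using assms(1) by (subst real_sqrt_abs) simp
  finally show ?thesis
    by (simp add: cone_dist_eq)
qed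

text \<open>Stretching all angles by \<open>2\<pi> / \<theta>\<close> maps the cone to the plane. On a sharp cone this
increases the angles and hence, by the law of cosines, the distances.\<close>

lemma cone_dist_le_plane:
  assumes \<theta>: "0 < \<theta>" "\<theta> \<le> 2 * pi" and r: "0 \<le> r" "0 \<le> s"
    and \<alpha>: "\<alpha> \<in> {0..<2 * pi}" "\<beta> \<in> {0..<2 * pi}"
  shows "cone_dist \<theta> (r, \<theta> / (2 * pi) * \<alpha>) (s, \<theta> / (2 * pi) * \<beta>) \<le> dist (rcis r \<alpha>) (rcis s \<beta>)"
proof -
  define k where "k = \<theta> / (2 * pi)"
  have k: "0 < k" "k \<le> 1" "\<theta> = k * (2 * pi)"
    using \<theta> by (auto simp: k_def)
  define \<gamma> where "\<gamma> = cone_angle (2 * pi) \<alpha> \<beta>"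
  have \<gamma>: "0 \<le> \<gamma>" "\<gamma> \<le> pi"
    using cone_angle_bounds[OF \<alpha>] by (auto simp: \<gamma>_def)
  have "\<gamma> = min \<bar>\<alpha> - \<beta>\<bar> (2 * pi - \<bar>\<alpha> - \<beta>\<bar>)"
    by (auto simp: \<gamma>_def cone_angle_def min_def)
  moreover have "\<bar>k * \<alpha> - k * \<beta>\<bar> = k * \<bar>\<alpha> - \<beta>\<bar>"
    using k by (simp add: right_diff_distrib[symmetric] abs_mult)
  ultimately have "min \<bar>k * \<alpha> - k * \<beta>\<bar> (\<theta> - \<bar>k * \<alpha> - k * \<beta>\<bar>) = k * \<gamma>"
    using k by (simp add: min_mult_distrib_left right_diff_distrib)
  moreover have "k * \<gamma> \<le> \<gamma>"
    using k \<gamma> by (simp add: mult_left_le_one_le)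
  ultimately have eq: "cone_angle \<theta> (k * \<alpha>) (k * \<beta>) = k * \<gamma>"
    using \<gamma> by (simp add: cone_angle_def min_absorb2)
  have "cos \<gamma> \<le> cos (k * \<gamma>)"
    using \<open>k * \<gamma> \<le> \<gamma>\<close> k \<gamma> by (intro cos_monotone_0_pi_le) auto
  then have "2 * r * s * (1 - cos (k * \<gamma>)) \<le> 2 * r * s * (1 - cos \<gamma>)"
    using r by (intro mult_left_mono) auto
  then have "cone_dist \<theta> (r, k * \<alpha>) (s, k * \<beta>) \<le> cone_dist (2 * pi) (r, \<alpha>) (s, \<beta>)"
    by (simp add: cone_dist_eq eq \<gamma>_def[symmetric])
  then show ?thesis
    using cone_dist_2pi[OF \<alpha>] by (simp add: k_def)
qed

text \<open>A chart of the cone by a plane disc, obtained by shrinking angles. It is a contraction, not an isometry; the last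
condition records that the total angle is less than \<open>2\<pi>\<close>.\<close>

definition sharp_cone_chart :: "'a::metric_space set \<Rightarrow> 'a \<Rightarrow> real \<Rightarrow> (complex \<Rightarrow> 'a) \<Rightarrow> bool" where
  "sharp_cone_chart X s \<epsilon> \<Psi> \<longleftrightarrow>
     \<epsilon> > 0 \<and> \<Psi> ` ball 0 \<epsilon> = ball s \<epsilon> \<inter> X \<and> inj_on \<Psi> (ball 0 \<epsilon>) \<and>
     (\<forall>z\<in>ball 0 \<epsilon>. dist s (\<Psi> z) = cmod z) \<and>
     (\<forall>z\<in>ball 0 \<epsilon>. \<forall>w\<in>ball 0 \<epsilon>. dist (\<Psi> z) (\<Psi> w) \<le> dist z w) \<and>
     (\<forall>z\<in>ball 0 \<epsilon>. \<forall>w\<in>ball 0 \<epsilon>. z \<noteq> 0 \<longrightarrow> cmod z = cmod w \<longrightarrow> dist (\<Psi> z) (\<Psi> w) < 2 * cmod z)"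

theorem cone_point_sharp_chart:
  assumes cone: "cone_point X s \<theta>" and \<theta>: "0 < \<theta>" "\<theta> < 2 * pi"
  shows "\<exists>\<epsilon> \<Psi>. sharp_cone_chart X s \<epsilon> \<Psi>"
proof -
  obtain \<epsilon> f where \<epsilon>: "\<epsilon> > 0" and f0: "f (0, 0) = s"
    and im: "f ` ({0..<\<epsilon>} \<times> {0..<\<theta>}) = ball s \<epsilon> \<inter> X"
    and d: "\<And>u v. u \<in> {0..<\<epsilon>} \<times> {0..<\<theta>} \<Longrightarrow> v \<in> {0..<\<epsilon>} \<times> {0..<\<theta>} \<Longrightarrow> dist (f u) (f v) = cone_dist \<theta> u v"
    using cone unfolding cone_point_def by blast
  define k where "k = \<theta> / (2 * pi)"
  have k: "0 < k" "\<theta> = k * (2 * pi)"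
    using \<theta> by (auto simp: k_def)
  define polar where "polar z = (cmod z, k * Arg2pi z)" for z
  define \<Psi> where "\<Psi> z = f (polar z)" for z
  have arg: "Arg2pi z \<in> {0..<2 * pi}" for z
    using Arg2pi[of z] by auto
  have karg: "k * Arg2pi z \<in> {0..<\<theta>}" for z
    using arg[of z] k by auto
  have polar: "polar z \<in> {0..<\<epsilon>} \<times> {0..<\<theta>}" if "z \<in> ball 0 \<epsilon>" for z
    using that karg[of z] by (simp add: polar_def)
  have rcis: "rcis (cmod z) (Arg2pi z) = z" for z
    using Arg2pi_eq[of z] by (simp add: rcis_def cis_conv_exp)
  have apex: "(0, 0) \<in> {0..<\<epsilon>} \<times> {0..<\<theta>}"
    using \<epsilon> \<theta> by simp
  have radius: "dist s (f (r, \<phi>)) = r" if "(r, \<phi>) \<in> {0..<\<epsilon>} \<times> {0..<\<theta>}" for r \<phi>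
    using d[OF apex that] that f0 by (simp add: cone_dist_apex)
  have "\<Psi> ` ball 0 \<epsilon> = ball s \<epsilon> \<inter> X"
  proof (intro equalityI subsetI)
    fix x assume "x \<in> \<Psi> ` ball 0 \<epsilon>"
    then show "x \<in> ball s \<epsilon> \<inter> X"
      unfolding im[symmetric] \<Psi>_def using polar by blast
  next
    fix x assume "x \<in> ball s \<epsilon> \<inter> X"
    then obtain r \<phi> where r: "(r, \<phi>) \<in> {0..<\<epsilon>} \<times> {0..<\<theta>}" "x = f (r, \<phi>)"
      unfolding im[symmetric] by blast
    define z where "z = rcis r (\<phi> / k)"
    have "cmod z = r"
      using r by (simp add: z_def rcis_def norm_mult)
    then have zb: "z \<in> ball 0 \<epsilon>"
      using r by simp
    have "\<Psi> z = x"
    proof (cases "r = 0")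
      case True
      then have "dist s x = 0" "dist s (\<Psi> z) = 0"
        using radius[OF r(1)] r(2) radius[of "cmod z" "k * Arg2pi z"] polar[OF zb] \<open>cmod z = r\<close>
        by (auto simp: \<Psi>_def polar_def)
      then show ?thesis
        by simp
    next
      case False
      have "\<phi> / k \<in> {0..<2 * pi}"
        using r k by (auto simp: field_simps)
      then have "Arg2pi z = \<phi> / k"
        using False r by (intro Arg2pi_unique[of r]) (auto simp: z_def rcis_def cis_conv_exp)
      then show ?thesis
        using r k \<open>cmod z = r\<close> by (simp add: \<Psi>_def polar_def)
    qed
    with zb show "x \<in> \<Psi> ` ball 0 \<epsilon>"
      by blast
  qed
  moreover have "inj_on \<Psi> (ball 0 \<epsilon>)"
  proof (rule inj_onI)
    fix z w assume zw: "z \<in> ball 0 \<epsilon>" "w \<in> ball 0 \<epsilon>" "\<Psi> z = \<Psi> w"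
    then have "cone_dist \<theta> (polar z) (polar w) = 0"
      using d[OF polar[OF zw(1)] polar[OF zw(2)]] by (simp add: \<Psi>_def)
    then have "cmod z = cmod w \<and> (cmod z = 0 \<or> k * Arg2pi z = k * Arg2pi w)"
      unfolding polar_def using karg by (intro cone_dist_eq_0) auto
    then have "cmod z = cmod w" "cmod z = 0 \<or> Arg2pi z = Arg2pi w"
      using k(1) by auto
    then show "z = w"
      using rcis[of z] rcis[of w] by (metis norm_eq_zero)
  qed
  moreover have "dist s (\<Psi> z) = cmod z" if "z \<in> ball 0 \<epsilon>" for z
    using radius[of "cmod z" "k * Arg2pi z"] polar[OF that] by (simp add: \<Psi>_def polar_def)
  moreover have "dist (\<Psi> z) (\<Psi> w) \<le> dist z w" if "z \<in> ball 0 \<epsilon>" "w \<in> ball 0 \<epsilon>" for z w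
    using d[OF polar[OF that(1)] polar[OF that(2)]] \<theta> arg[of z] arg[of w]
      cone_dist_le_plane[of \<theta> "cmod z" "cmod w" "Arg2pi z" "Arg2pi w"]
    by (simp add: \<Psi>_def polar_def k_def rcis)
  moreover have "dist (\<Psi> z) (\<Psi> w) < 2 * cmod z"
    if "z \<in> ball 0 \<epsilon>" "w \<in> ball 0 \<epsilon>" "z \<noteq> 0" "cmod z = cmod w" for z w
  proof -
    have "cone_dist \<theta> (cmod z, k * Arg2pi z) (cmod z, k * Arg2pi w) < 2 * cmod z"
      using that(3) by (intro cone_dist_equal_radius_less \<theta>(2) karg) auto
    then show ?thesis
      using d[OF polar[OF that(1)] polar[OF that(2)]] that(4) by (simp add: \<Psi>_def polar_def)
  qed
  ultimately have "sharp_cone_chart X s \<epsilon> \<Psi>"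
    using \<epsilon> unfolding sharp_cone_chart_def by blast
  then show ?thesis
    by blast
qed

theorem cone_point_lift:
  assumes cone: "cone_point S (p x) \<theta>" and \<theta>: "0 < \<theta>"
    and p: "local_isometry_on X p S" and x: "x \<in> X"
  shows "cone_point X x \<theta>"
proof -
  obtain \<epsilon> f where \<epsilon>: "\<epsilon> > 0" and f0: "f (0, 0) = p x"
    and im: "f ` ({0..<\<epsilon>} \<times> {0..<\<theta>}) = ball (p x) \<epsilon> \<inter> S"
    and d: "\<And>u v. u \<in> {0..<\<epsilon>} \<times> {0..<\<theta>} \<Longrightarrow> v \<in> {0..<\<epsilon>} \<times> {0..<\<theta>} \<Longrightarrow> dist (f u) (f v) = cone_dist \<theta> u v"
    using cone unfolding cone_point_def by blast
  obtain \<rho> where \<rho>: "\<rho> > 0" and imp: "p ` (ball x \<rho> \<inter> X) = ball (p x) \<rho> \<inter> S"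
    and iso: "\<And>u v. u \<in> ball x \<rho> \<inter> X \<Longrightarrow> v \<in> ball x \<rho> \<inter> X \<Longrightarrow> dist (p u) (p v) = dist u v"
    using p x unfolding local_isometry_on_def by metis
  obtain q where q: "q ` (ball (p x) \<rho> \<inter> S) = ball x \<rho> \<inter> X" "\<And>v. v \<in> ball x \<rho> \<inter> X \<Longrightarrow> q (p v) = v"
    "\<And>y. y \<in> ball (p x) \<rho> \<inter> S \<Longrightarrow> p (q y) = y"
    "\<And>y z. y \<in> ball (p x) \<rho> \<inter> S \<Longrightarrow> z \<in> ball (p x) \<rho> \<inter> S \<Longrightarrow> dist (q y) (q z) = dist y z"
    using isometry_inverse[OF imp iso] by metis
  have xb: "x \<in> ball x \<rho> \<inter> X"
    using x \<rho> by simp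
  define \<epsilon>' where "\<epsilon>' = min \<epsilon> \<rho>"
  have \<epsilon>': "0 < \<epsilon>'" "\<epsilon>' \<le> \<epsilon>" "\<epsilon>' \<le> \<rho>"
    using \<epsilon> \<rho> by (auto simp: \<epsilon>'_def)
  let ?D = "{0..<\<epsilon>'} \<times> {0..<\<theta>}"
  have D: "u \<in> {0..<\<epsilon>} \<times> {0..<\<theta>}" if "u \<in> ?D" for u
    using that \<epsilon>' by auto
  have apex: "(0, 0) \<in> {0..<\<epsilon>} \<times> {0..<\<theta>}"
    using \<epsilon> \<theta> by simp
  have radius: "dist (p x) (f u) = fst u" if "u \<in> {0..<\<epsilon>} \<times> {0..<\<theta>}" for u
    using d[OF apex that] that f0 by (auto simp: cone_dist_apex)
  have f_in: "f u \<in> ball (p x) \<rho> \<inter> S" if "u \<in> ?D" for u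
    using im D[OF that] radius[OF D[OF that]] that \<epsilon>' by auto
  have "(q \<circ> f) ` ?D = ball x \<epsilon>' \<inter> X"
  proof (intro equalityI subsetI)
    fix y assume "y \<in> (q \<circ> f) ` ?D"
    then obtain u where u: "u \<in> ?D" "y = q (f u)"
      by auto
    have y: "y \<in> ball x \<rho> \<inter> X"
      using q(1) f_in[OF u(1)] u(2) by blast
    have "dist x y = dist (p x) (f u)"
      using iso[OF xb y] q(3)[OF f_in[OF u(1)]] u(2) by simp
    then show "y \<in> ball x \<epsilon>' \<inter> X"
      using radius[OF D[OF u(1)]] u(1) y by auto
  next
    fix y assume y: "y \<in> ball x \<epsilon>' \<inter> X"
    then have yb: "y \<in> ball x \<rho> \<inter> X"
      using \<epsilon>' by auto
    then have "dist (p x) (p y) = dist x y" "p y \<in> S"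
      using iso[OF xb yb] imp by blast+
    then have "p y \<in> ball (p x) \<epsilon> \<inter> S"
      using y \<epsilon>' by auto
    then obtain u where u: "u \<in> {0..<\<epsilon>} \<times> {0..<\<theta>}" "p y = f u"
      unfolding im[symmetric] by blast
    then have "u \<in> ?D"
      using radius[OF u(1)] \<open>dist (p x) (p y) = dist x y\<close> y by auto
    moreover have "y = q (f u)"
      using q(2)[OF yb] u(2) by simp
    ultimately show "y \<in> (q \<circ> f) ` ?D"
      by auto
  qed
  moreover have "(q \<circ> f) (0, 0) = x"
    using q(2)[OF xb] f0 by simp
  moreover have "dist ((q \<circ> f) u) ((q \<circ> f) v) = cone_dist \<theta> u v" if "u \<in> ?D" "v \<in> ?D" for u v
    using q(4)[OF f_in[OF that(1)] f_in[OF that(2)]] d[OF D[OF that(1)] D[OF that(2)]] by simp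
  ultimately show ?thesis
    unfolding cone_point_def using \<epsilon>'(1) by blast
qed

lemma ray_avoids_sharp_cone_point:
  assumes chart: "sharp_cone_chart X s \<epsilon> \<Psi>" and r: "geodesic_ray X r" and t: "0 < t"
  shows "r t \<noteq> s"
proof
  assume rt: "r t = s"
  have \<epsilon>: "\<epsilon> > 0"
    using chart by (simp add: sharp_cone_chart_def)
  define h where "h = min t (\<epsilon> / 2)"
  have h: "0 < h" "h \<le> t" "h < \<epsilon>"
    using t \<epsilon> by (auto simp: h_def)
  have X: "r (t - h) \<in> X" "r (t + h) \<in> X"
    using r h by (auto simp: geodesic_ray_def)
  have d: "dist s (r (t - h)) = h" "dist s (r (t + h)) = h" "dist (r (t - h)) (r (t + h)) = 2 * h"
    using r h unfolding rt[symmetric] by (auto simp: geodesic_ray_def)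
  then have "r (t - h) \<in> \<Psi> ` ball 0 \<epsilon>" "r (t + h) \<in> \<Psi> ` ball 0 \<epsilon>"
    using X h chart unfolding sharp_cone_chart_def by auto
  then obtain z w where zw: "z \<in> ball 0 \<epsilon>" "w \<in> ball 0 \<epsilon>" "r (t - h) = \<Psi> z" "r (t + h) = \<Psi> w"
    by blast
  have "cmod z = h" "cmod w = h"
    using chart zw d unfolding sharp_cone_chart_def by metis+
  moreover from this have "z \<noteq> 0"
    using h by auto
  ultimately have "dist (\<Psi> z) (\<Psi> w) < 2 * h"
    using chart zw(1,2) unfolding sharp_cone_chart_def by metis
  then show False
    using zw d by simp
qed

lemma continuous_on_unit_speed_flow:
  fixes \<phi> :: "'a::metric_space \<Rightarrow> real \<Rightarrow> 'a" and g :: "'z::metric_space \<Rightarrow> 'a"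
  assumes cont: "\<And>t. 0 \<le> t \<Longrightarrow> continuous_on X (\<lambda>x. \<phi> x t)"
    and speed: "\<And>x t u. x \<in> X \<Longrightarrow> 0 \<le> t \<Longrightarrow> 0 \<le> u \<Longrightarrow> dist (\<phi> x t) (\<phi> x u) = \<bar>t - u\<bar>"
    and g: "continuous_on A g" "g ` A \<subseteq> X" and \<tau>: "continuous_on A \<tau>" "\<And>z. z \<in> A \<Longrightarrow> 0 \<le> \<tau> z"
  shows "continuous_on A (\<lambda>z. \<phi> (g z) (\<tau> z))"
  unfolding continuous_on_iff
proof (intro ballI allI impI)
  fix z and e :: real assume z: "z \<in> A" and e: "0 < e"
  have "continuous_on A (\<lambda>w. \<phi> (g w) (\<tau> z))"
    using continuous_on_compose2[OF cont[OF \<tau>(2)[OF z]] g] .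
  then obtain d1 where d1: "d1 > 0" "\<And>w. w \<in> A \<Longrightarrow> dist w z < d1 \<Longrightarrow> dist (\<phi> (g w) (\<tau> z)) (\<phi> (g z) (\<tau> z)) < e / 2"
    using z e unfolding continuous_on_iff by (metis half_gt_zero)
  obtain d2 where d2: "d2 > 0" "\<And>w. w \<in> A \<Longrightarrow> dist w z < d2 \<Longrightarrow> dist (\<tau> w) (\<tau> z) < e / 2"
    using \<tau>(1) z e unfolding continuous_on_iff by (metis half_gt_zero)
  have "dist (\<phi> (g w) (\<tau> w)) (\<phi> (g z) (\<tau> z)) < e" if w: "w \<in> A" "dist w z < min d1 d2" for w
  proof -
    have "dist (\<phi> (g w) (\<tau> w)) (\<phi> (g w) (\<tau> z)) = \<bar>\<tau> w - \<tau> z\<bar>"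
      using speed[of "g w" "\<tau> w" "\<tau> z"] g(2) \<tau>(2) w z by auto
    then show ?thesis
      using d1(2)[of w] d2(2)[of w] w dist_triangle[of "\<phi> (g w) (\<tau> w)" "\<phi> (g z) (\<tau> z)" "\<phi> (g w) (\<tau> z)"]
      by (simp add: dist_real_def)
  qed
  then show "\<exists>d>0. \<forall>w\<in>A. dist w z < d \<longrightarrow> dist (\<phi> (g w) (\<tau> w)) (\<phi> (g z) (\<tau> z)) < e"
    using d1(1) d2(1) by (intro exI[of _ "min d1 d2"]) auto
qed

text \<open>Read in the chart, the flow is a homotopy of maps of a disc of radius \<open>R\<close> whose later stages omit the
centre. The map \<open>H\<close> puts this homotopy on a collar of the disc: at radius \<open>\<rho> \<ge> R / 2\<close> it flows from the
boundary point in the same direction for time \<open>2 (R - \<rho>)\<close>, and on the inner half it is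
the stage at time \<open>R\<close> of the flow, precomposed with doubling. Thus \<open>H\<close> fixes the boundary circle and omits the centre.\<close>

theorem no_flow_avoiding_sharp_cone_point:
  assumes chart: "sharp_cone_chart X s \<epsilon> \<Psi>"
    and cont: "\<And>t. 0 \<le> t \<Longrightarrow> continuous_on X (\<lambda>x. \<phi> x t)"
    and ray: "\<And>x. x \<in> X \<Longrightarrow> geodesic_ray X (\<phi> x) \<and> \<phi> x 0 = x"
  shows False
proof -
  have \<epsilon>: "\<epsilon> > 0" and im: "\<Psi> ` ball 0 \<epsilon> = ball s \<epsilon> \<inter> X" and inj: "inj_on \<Psi> (ball 0 \<epsilon>)"
    and radius: "\<And>z. z \<in> ball 0 \<epsilon> \<Longrightarrow> dist s (\<Psi> z) = cmod z"
    and contract: "\<And>z w. z \<in> ball 0 \<epsilon> \<Longrightarrow> w \<in> ball 0 \<epsilon> \<Longrightarrow> dist (\<Psi> z) (\<Psi> w) \<le> dist z w"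
    using chart unfolding sharp_cone_chart_def by blast+
  have \<phi>X: "\<phi> x t \<in> X" and speed: "dist (\<phi> x t) (\<phi> x u) = \<bar>t - u\<bar>" if "x \<in> X" "0 \<le> t" "0 \<le> u" for x t u
    using ray[OF that(1)] that by (auto simp: geodesic_ray_def)
  \<comment> \<open>Points within \<open>R\<close> of \<open>s\<close> stay in the chart for time \<open>R\<close>.\<close>
  define R where "R = \<epsilon> / 3"
  have R: "0 < R" "2 * R < \<epsilon>"
    using \<epsilon> by (auto simp: R_def)
  have ball: "z \<in> ball 0 \<epsilon>" if "cmod z \<le> 2 * R" for z
    using that R by simp
  have cont\<Psi>: "continuous_on (ball 0 \<epsilon>) \<Psi>"
    unfolding continuous_on_iff using contract by (meson order_le_less_trans)
  have im2: "\<Psi> ` cball 0 (2 * R) = cball s (2 * R) \<inter> X"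
  proof (intro equalityI subsetI)
    fix y assume "y \<in> \<Psi> ` cball 0 (2 * R)"
    then show "y \<in> cball s (2 * R) \<inter> X"
      using im radius ball by force
  next
    fix y assume y: "y \<in> cball s (2 * R) \<inter> X"
    then have "y \<in> \<Psi> ` ball 0 \<epsilon>"
      using im R by auto
    then obtain z where "z \<in> ball 0 \<epsilon>" "y = \<Psi> z"
      by blast
    then show "y \<in> \<Psi> ` cball 0 (2 * R)"
      using y radius by auto
  qed
  obtain \<Psi>' where \<Psi>': "\<And>z. z \<in> cball 0 (2 * R) \<Longrightarrow> \<Psi>' (\<Psi> z) = z"
    and cont\<Psi>': "continuous_on (cball s (2 * R) \<inter> X) \<Psi>'"
  proof -
    have sub: "cball 0 (2 * R) \<subseteq> ball (0::complex) \<epsilon>"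
      using R by auto
    have inv: "inv_into (cball 0 (2 * R)) \<Psi> (\<Psi> z) = z" if "z \<in> cball 0 (2 * R)" for z
      using inj_on_subset[OF inj sub] that by simp
    moreover have "continuous_on (\<Psi> ` cball 0 (2 * R)) (inv_into (cball 0 (2 * R)) \<Psi>)"
      using continuous_on_subset[OF cont\<Psi> sub] inv by (intro continuous_on_inv) auto
    ultimately show thesis
      using that unfolding im2 by blast
  qed
  \<comment> \<open>The argument of \<open>\<Psi>\<close> is \<open>2 * z\<close>, projected radially to the disc of radius \<open>R\<close>.\<close>
  define g where "g z = \<Psi> ((R / max R (cmod (2 * z))) *\<^sub>R (2 * z))" for z :: complex
  define \<tau> where "\<tau> z = min R (2 * (R - cmod z))" for z :: complex
  define H where "H z = \<Psi>' (\<phi> (g z) (\<tau> z))" for z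
  have clamp: "cmod ((R / max R (cmod (2 * z))) *\<^sub>R (2 * z)) \<le> R" for z
  proof -
    have "R / max R (cmod (2 * z)) * cmod (2 * z) \<le> R"
      using R by (simp add: field_simps max_def mult_mono)
    then show ?thesis
      using R by simp
  qed
  have gX: "g z \<in> X" "dist s (g z) \<le> R" for z
    using clamp[of z] R im ball[of "(R / max R (cmod (2 * z))) *\<^sub>R (2 * z)"] radius unfolding g_def by auto
  have "continuous_on UNIV g"
    unfolding g_def
  proof (rule continuous_on_compose2[OF cont\<Psi>])
    show "continuous_on UNIV (\<lambda>z::complex. (R / max R (cmod (2 * z))) *\<^sub>R (2 * z))"
      using R by (intro continuous_intros) (auto simp: max_def)
    show "(\<lambda>z. (R / max R (cmod (2 * z))) *\<^sub>R (2 * z)) ` UNIV \<subseteq> ball 0 \<epsilon>"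
      using order_trans[OF clamp] R by (intro image_subsetI ball) auto
  qed
  have \<tau>: "0 \<le> \<tau> z" "\<tau> z \<le> R" if "z \<in> cball 0 R" for z
    using that R by (auto simp: \<tau>_def)
  have \<phi>_in: "\<phi> (g z) (\<tau> z) \<in> cball s (2 * R) \<inter> X" if z: "z \<in> cball 0 R" for z
  proof -
    have "dist (g z) (\<phi> (g z) (\<tau> z)) = \<tau> z"
      using speed[OF gX(1)[of z], of 0 "\<tau> z"] ray[OF gX(1)] \<tau>[OF z] by simp
    then show ?thesis
      using \<phi>X[OF gX(1)] \<tau>[OF z] gX(2)[of z] dist_triangle[of s "\<phi> (g z) (\<tau> z)" "g z"] by auto
  qed
  have "continuous_on (cball 0 R) (\<lambda>z. \<phi> (g z) (\<tau> z))"
  proof (rule continuous_on_unit_speed_flow[where X = X and \<phi> = \<phi>])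
    show "continuous_on (cball 0 R) \<tau>"
      unfolding \<tau>_def by (intro continuous_intros)
    show "continuous_on (cball 0 R) g"
      using \<open>continuous_on UNIV g\<close> continuous_on_subset by blast
  qed (use cont speed gX \<tau> in auto)
  then have contH: "continuous_on (cball 0 R) H"
    unfolding H_def using \<phi>_in by (intro continuous_on_compose2[OF cont\<Psi>']) auto
  have boundary: "H z = z" if z: "cmod z = R" for z
  proof -
    have "(R / max R (cmod (2 * z))) *\<^sub>R (2 * z) = z"
      using z R by (simp add: norm_mult max_def scaleR_conv_of_real)
    then have "g z = \<Psi> z" "\<tau> z = 0"
      using z R by (auto simp: g_def \<tau>_def)
    then have "H z = \<Psi>' (\<Psi> z)"
      using ray[OF gX(1)[of z]] by (simp add: H_def)
    then show ?thesis
      using \<Psi>'[of z] z R by simp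
  qed
  have nonzero: "H z \<noteq> 0" if z: "z \<in> cball 0 R" for z
  proof (cases "cmod z = R")
    case True
    then show ?thesis
      using boundary R by auto
  next
    case False
    then have "0 < \<tau> z"
      using z R by (simp add: \<tau>_def)
    then have "\<phi> (g z) (\<tau> z) \<noteq> s"
      using ray[OF gX(1)] ray_avoids_sharp_cone_point[OF chart] by blast
    moreover obtain w where "w \<in> cball 0 (2 * R)" "\<phi> (g z) (\<tau> z) = \<Psi> w"
      using \<phi>_in[OF z] unfolding im2[symmetric] by blast
    ultimately show ?thesis
      using \<Psi>'[of w] radius[OF ball, of w] by (auto simp: H_def)
  qed
  have "sphere (0::complex) R retract_of cball 0 R"
    unfolding retract_of_def retraction_def
  proof (intro exI[of _ "\<lambda>z. (R / cmod (H z)) *\<^sub>R H z"] conjI ballI)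
    show "continuous_on (cball 0 R) (\<lambda>z. (R / cmod (H z)) *\<^sub>R H z)"
      using nonzero by (intro continuous_intros contH) auto
    show "(\<lambda>z. (R / cmod (H z)) *\<^sub>R H z) \<in> cball 0 R \<rightarrow> sphere 0 R"
      using nonzero R by auto
    show "(R / cmod (H z)) *\<^sub>R H z = z" if "z \<in> sphere 0 R" for z
      using that boundary[of z] R by simp
  qed auto
  then show False
    using no_retraction_cball[OF R(1), of "0::complex"] by simp
qed

section \<open>Two rays to a boundary point\<close>

theorem proposition11:
  fixes S Sing :: "'a::metric_space set"
    and \<theta> :: "'a \<Rightarrow> real"
    and X :: "'b::metric_space set"
    and p :: "'b \<Rightarrow> 'a"
    and x\<^sub>0 :: 'a
    and \<xi> :: "(real \<Rightarrow> 'b) set"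
  assumes "euclidean_cone_surface S Sing \<theta>"
    and "genus_at_least 1 S"
    and "\<exists>s\<in>Sing. \<theta> s < 2 * pi"
    and "x\<^sub>0 \<in> S"
    and "hyperbolic_group (fundamental_group S x\<^sub>0)"
    and "metric_universal_covering X p S"
    and "boundary_topology X homeomorphic_space top_of_set (sphere (0::complex) 1)"
    and "\<xi> \<in> visual_boundary X"
  shows "\<exists>x\<in>X. \<exists>r\<^sub>1 r\<^sub>2.
           geodesic_ray X r\<^sub>1 \<and> geodesic_ray X r\<^sub>2 \<and>
           r\<^sub>1 0 = x \<and> r\<^sub>2 0 = x \<and>
           ray_end X r\<^sub>1 = \<xi> \<and> ray_end X r\<^sub>2 = \<xi> \<and>
           (\<exists>t\<ge>0. r\<^sub>1 t \<noteq> r\<^sub>2 t)"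
proof (rule ccontr)
  assume contra: "\<not> ?thesis"
  have S: "compact S" "length_metric_on S" "Sing \<subseteq> S"
    and cone: "\<And>s. s \<in> Sing \<Longrightarrow> 0 < \<theta> s \<and> cone_point S s (\<theta> s)"
    using assms(1) by (auto simp: euclidean_cone_surface_def closed_surface_def)
  interpret compact_metric_covering S X p
    using assms(6) S by unfold_locales (auto simp: metric_universal_covering_def)
  obtain E \<delta> c C where "coarsely_hyperbolic_space X E \<delta> c C"
    using hyperbolic_fundamental_group_imp_coarsely_hyperbolic[OF assms(4,5)] by blast
  then interpret coarsely_hyperbolic_space X E \<delta> c C .
  obtain r0 where r0: "geodesic_ray X r0" "\<xi> = ray_end X r0"
    using assms(8) by (auto simp: visual_boundary_def)
  have "\<forall>x\<in>X. \<exists>r. geodesic_ray X r \<and> r 0 = x \<and> asymptotic r0 r"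
    using asymptotic_ray_exists[OF length_total proper r0(1)] by blast
  then obtain \<phi> where \<phi>: "\<And>x. x \<in> X \<Longrightarrow> geodesic_ray X (\<phi> x) \<and> \<phi> x 0 = x \<and> asymptotic r0 (\<phi> x)"
    by metis
  have unique: "r t = \<phi> x t"
    if "x \<in> X" "geodesic_ray X r" "r 0 = x" "asymptotic r0 r" "0 \<le> t" for x r t
    using contra \<phi>[OF that(1)] that ray_end_eq_iff[OF r0(1)] unfolding r0(2) by metis
  obtain s where s: "s \<in> Sing" "\<theta> s < 2 * pi"
    using assms(3) by blast
  obtain x where x: "x \<in> X" "p x = s"
    using s(1) S(3) covering by (auto simp: covering_space_def)
  have "cone_point X x (\<theta> s)"
    using cone[OF s(1)] x by (intro cone_point_lift[OF _ _ local_isometry]) auto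
  then obtain \<epsilon> \<Psi> where chart: "sharp_cone_chart X x \<epsilon> \<Psi>"
    using cone_point_sharp_chart cone[OF s(1)] s(2) by blast
  have "continuous_on X (\<lambda>x. \<phi> x t)" if t: "0 \<le> t" for t
  proof (rule unique_rays_continuous[OF proper])
    show "geodesic_ray X (\<phi> x) \<and> \<phi> x 0 = x \<and> asymptotic r0 (\<phi> x)" if "x \<in> X" for x
      by (rule \<phi>[OF that])
    show "r t = \<phi> x t" if "x \<in> X" "geodesic_ray X r" "r 0 = x" "asymptotic r0 r" "0 \<le> t" for x r t
      by (rule unique[OF that])
    show "0 \<le> t"
      by (rule t)
  qed
  then show False
    using \<phi> no_flow_avoiding_sharp_cone_point[OF chart, where \<phi> = \<phi>] by blast
qed

end
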